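(* Let $A$ be a $C^*$-algebra of stable rank one, and let $x,y\in W(A)$ be such that $x+\langle c\rangle\le y+\langle (c-\varepsilon)_+\rangle$ for some positive $c\in M_\infty(A)$ and some $\varepsilon>0$. Then $x\le y$.
   Context: For positive $a\in M_k(A)$, $b\in M_l(A)$, $a\precsim b$ if there are $r_m$ with $r_m^*br_m\to a$. $W(A)$ is the set of classes $\langle a\rangle$ of positive elements of $M_\infty(A)=\bigcup_kM_k(A)$ modulo mutual Cuntz subequivalence, with $\langle a\rangle+\langle b\rangle=\langle a\oplus b\rangle$ and $\langle a\rangle\le\langle b\rangle\iff a\precsim b$. For positive $c$ and $\varepsilon>0$, $(c-\varepsilon)_+$ is obtained by continuous functional calculus with $t\mapsto\max(t-\varepsilon,0)$. *)

theory Defs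
  imports "HOL-Analysis.Analysis" "HOL-Computational_Algebra.Polynomial"
begin

class cstar_algebra = real_normed_algebra + banach +
  fixes cscale :: "complex \<Rightarrow> 'a \<Rightarrow> 'a"
    and cstar :: "'a \<Rightarrow> 'a"
  assumes cscale_add_left: "cscale (s + t) x = cscale s x + cscale t x"
    and cscale_add_right: "cscale s (x + y) = cscale s x + cscale s y"
    and cscale_cscale: "cscale s (cscale t x) = cscale (s * t) x"
    and cscale_one: "cscale 1 x = x"
    and scaleR_cscale: "scaleR r x = cscale (complex_of_real r) x"
    and norm_cscale: "norm (cscale s x) = cmod s * norm x"
    and cscale_mult_left: "cscale s (x * y) = cscale s x * y"
    and cscale_mult_right: "cscale s (x * y) = x * cscale s y"
    and cstar_cstar: "cstar (cstar x) = x"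
    and cstar_add: "cstar (x + y) = cstar x + cstar y"
    and cstar_mult: "cstar (x * y) = cstar y * cstar x"
    and cstar_cscale: "cstar (cscale s x) = cscale (cnj s) (cstar x)"
    and cstar_identity: "norm (cstar x * x) = norm x ^ 2"

text \<open>Minimal unitization \<open>A~ = A \<oplus> \<complex>\<close>, elements \<open>(a, \<lambda>)\<close> standing for \<open>a + \<lambda>1\<close>.\<close>

definition umult :: "'a::cstar_algebra \<times> complex \<Rightarrow> 'a \<times> complex \<Rightarrow> 'a \<times> complex" where
  "umult u v = (fst u * fst v + cscale (snd u) (fst v) + cscale (snd v) (fst u), snd u * snd v)"

definition uinvertible :: "'a::cstar_algebra \<times> complex \<Rightarrow> bool" where
  "uinvertible u \<longleftrightarrow> (\<exists>v. umult u v = (0, 1) \<and> umult v u = (0, 1))"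

text \<open>\<open>tsr(A) = 1\<close>: invertible elements are dense in the unitization. The norm
  \<open>\<parallel>a\<parallel> + |\<lambda>|\<close> used here is equivalent to the C*-norm of the unitization.\<close>

definition stable_rank_one :: "'a::cstar_algebra itself \<Rightarrow> bool" where
  "stable_rank_one _ \<longleftrightarrow>
     (\<forall>(a::'a) s e. e > 0 \<longrightarrow>
        (\<exists>b \<mu>. uinvertible (b, \<mu>) \<and> norm (a - b) + cmod (s - \<mu>) < e))"

text \<open>Matrices are functions \<open>nat \<Rightarrow> nat \<Rightarrow> 'a\<close>; a \<open>k\<times>l\<close> matrix vanishes outside
  \<open>{..<k} \<times> {..<l}\<close>. \<open>M_\<infinity>(A)\<close> is the union over all sizes.\<close>

definition mat_in :: "nat \<Rightarrow> nat \<Rightarrow> (nat \<Rightarrow> nat \<Rightarrow> 'a::zero) \<Rightarrow> bool" where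
  "mat_in k l x \<longleftrightarrow> (\<forall>i j. (k \<le> i \<or> l \<le> j) \<longrightarrow> x i j = 0)"

definition mmul :: "nat \<Rightarrow> (nat \<Rightarrow> nat \<Rightarrow> 'a::cstar_algebra) \<Rightarrow> (nat \<Rightarrow> nat \<Rightarrow> 'a) \<Rightarrow> nat \<Rightarrow> nat \<Rightarrow> 'a" where
  "mmul n x y = (\<lambda>i j. \<Sum>t<n. x i t * y t j)"

definition mstar :: "(nat \<Rightarrow> nat \<Rightarrow> 'a::cstar_algebra) \<Rightarrow> nat \<Rightarrow> nat \<Rightarrow> 'a" where
  "mstar x = (\<lambda>i j. cstar (x j i))"

definition mpositive :: "nat \<Rightarrow> (nat \<Rightarrow> nat \<Rightarrow> 'a::cstar_algebra) \<Rightarrow> bool" where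
  "mpositive k a \<longleftrightarrow> mat_in k k a \<and> (\<exists>b. mat_in k k b \<and> a = mmul k (mstar b) b)"

definition dsum :: "nat \<Rightarrow> (nat \<Rightarrow> nat \<Rightarrow> 'a::zero) \<Rightarrow> (nat \<Rightarrow> nat \<Rightarrow> 'a) \<Rightarrow> nat \<Rightarrow> nat \<Rightarrow> 'a" where
  "dsum k a c = (\<lambda>i j. if i < k \<and> j < k then a i j
                       else if k \<le> i \<and> k \<le> j then c (i - k) (j - k) else 0)"

text \<open>Cuntz subequivalence \<open>a \<precsim> b\<close> for \<open>a \<in> M_k(A)\<close>, \<open>b \<in> M_l(A)\<close>: there are
  \<open>r_m \<in> M_{l,k}(A)\<close> with \<open>r_m* b r_m \<rightarrow> a\<close>. Norm convergence in \<open>M_k(A)\<close> is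
  (equivalently) expressed as entrywise convergence.\<close>

definition cuntz_le :: "nat \<Rightarrow> nat \<Rightarrow> (nat \<Rightarrow> nat \<Rightarrow> 'a::cstar_algebra) \<Rightarrow> (nat \<Rightarrow> nat \<Rightarrow> 'a) \<Rightarrow> bool" where
  "cuntz_le k l a b \<longleftrightarrow>
     (\<exists>r :: nat \<Rightarrow> nat \<Rightarrow> nat \<Rightarrow> 'a. (\<forall>m. mat_in l k (r m)) \<and>
        (\<forall>i j. (\<lambda>m. mmul l (mstar (r m)) (mmul l b (r m)) i j) \<longlonglongrightarrow> a i j))"

fun mpow :: "nat \<Rightarrow> (nat \<Rightarrow> nat \<Rightarrow> 'a::cstar_algebra) \<Rightarrow> nat \<Rightarrow> nat \<Rightarrow> nat \<Rightarrow> 'a" where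
  "mpow k c 0 = c"
| "mpow k c (Suc n) = mmul k (mpow k c n) c"

text \<open>\<open>peval k p c = \<Sum>_{t\<ge>1} coeff p t \<cdot> c^t\<close> (constant term dropped; A need not be unital).\<close>

definition peval :: "nat \<Rightarrow> real poly \<Rightarrow> (nat \<Rightarrow> nat \<Rightarrow> 'a::cstar_algebra) \<Rightarrow> nat \<Rightarrow> nat \<Rightarrow> 'a" where
  "peval k p c = (\<lambda>i j. \<Sum>t<degree p. cscale (complex_of_real (coeff p (Suc t))) (mpow k c t i j))"

text \<open>Continuous functional calculus for \<open>f(t) = max (t - \<epsilon>) 0\<close> on a positive
  \<open>c \<in> M_k(A)\<close>: \<open>f(c)\<close> is the limit of \<open>p_n(c)\<close> for any polynomials \<open>p_n\<close> with
  \<open>p_n(0) = 0\<close> converging uniformly to \<open>f\<close> on \<open>[0,R]\<close>, where \<open>R\<close> is large enough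
  (any \<open>R \<ge> \<parallel>c\<parallel>\<close>). This determines \<open>f(c)\<close> uniquely.\<close>

definition pos_part :: "nat \<Rightarrow> (nat \<Rightarrow> nat \<Rightarrow> 'a::cstar_algebra) \<Rightarrow> real \<Rightarrow> nat \<Rightarrow> nat \<Rightarrow> 'a" where
  "pos_part k c \<epsilon> = (THE d. \<exists>R>0. \<forall>P :: nat \<Rightarrow> real poly.
      ((\<forall>n. poly (P n) 0 = 0) \<and>
       (\<forall>e>0. \<forall>\<^sub>F n in sequentially. \<forall>t\<in>{0..R}. \<bar>poly (P n) t - max (t - \<epsilon>) 0\<bar> < e))
      \<longrightarrow> (\<forall>i j. (\<lambda>n. peval k (P n) c i j) \<longlonglongrightarrow> d i j))"

end

theory Submission
  imports Defs
begin

text \<open>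
  Positivity of a matrix \<open>T\<close> over the unitization of \<open>A\<close> is tested on columns: all
  \<open>\<xi>* T \<xi>\<close> must be positive elements of the unitization. This replaces a C*-norm on
  matrices, since \<open>T* T \<le> r\<^sup>2\<close> already bounds every entry of \<open>T\<close> by \<open>r\<close>.

  Let \<open>b = \<beta>* \<beta>\<close> and \<open>d = (c - \<epsilon>)\<^sub>+ = \<delta>\<^sup>2\<close>, and let the blocks \<open>z\<^sub>i\<^sub>j\<close> implement
  \<open>a \<oplus> c \<precsim> b \<oplus> d\<close> up to a small error. Put \<open>x\<^sub>j = \<beta> z\<^sub>1\<^sub>j\<close> and \<open>y\<^sub>j = \<delta> z\<^sub>2\<^sub>j\<close>, so that
  the Gram matrix of the columns \<open>(x\<^sub>1, y\<^sub>1)\<close>, \<open>(x\<^sub>2, y\<^sub>2)\<close> is close to \<open>a \<oplus> c\<close>. If \<open>y\<^sub>2 s = y\<^sub>1\<close>, then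
  \<open>v = x\<^sub>1 - x\<^sub>2 s\<close> satisfies \<open>v* v \<approx> a + s* c s \<ge> a\<close>, while \<open>v = \<beta> (z\<^sub>1\<^sub>1 - z\<^sub>1\<^sub>2 s)\<close> makes
  \<open>v* v\<close> Cuntz-below \<open>b\<close>. Stable rank one provides such an \<open>s\<close> after an arbitrarily small
  perturbation of \<open>y\<^sub>2\<close>. There is no control on the size of \<open>s\<close>, but functional calculus in \<open>c\<close>
  yields \<open>s = e s\<close> with \<open>e (c - \<epsilon>/4) e \<ge> 0\<close>; hence \<open>s* c s \<ge> (\<epsilon>/4) s* s\<close> absorbs the error terms,
  which are at most a small multiple of \<open>1 + s* s\<close>.
\<close>

section \<open>Positivity in unital C*-algebras\<close>

text \<open>Stable rank one enters through the equation for \<open>s\<close>. Both columns factor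
  through \<open>\<delta>\<close>, so they live where \<open>c\<close> is at least
  \<open>\<epsilon>\<close>, and three cut-offs of \<open>c\<close> with \<open>e1 * e2 = e2\<close>
  and \<open>e3 * e2 = e3\<close> fit below that level. The matrix \<open>1 + y2 - e2\<close> is
  invertible up to a small perturbation. Multiplication by \<open>e3\<close> from the left sends
  \<open>1 - e2\<close> to 0 and leaves a perturbed \<open>y2\<close>; since \<open>e2\<close>,
  \<open>y1\<close> and \<open>y2\<close> lie under \<open>e1\<close>, so does \<open>s\<close>.
  Three ramps and the gap below them are four intervals of equal length, whence
  \<open>\<epsilon>/4\<close>.

  The outcome is only an order relation: \<open>a\<close> is at most \<open>h + \<eta>\<close>,
  where \<open>h\<close> is the square of \<open>v\<close>. It becomes a Cuntz relation through the
  element \<open>(h + \<eta>)^(-1/2) a^(1/2)\<close>, which compresses \<open>h\<close> to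
  \<open>a\<close> up to \<open>\<eta>\<close>.

  The calculus in \<open>c\<close> is built on this order alone: a polynomial that is nonnegative on
  [0, M] is shown to be nonnegative at \<open>c\<close> by its Bernstein expansion, and all
  estimates by sup norms follow from that.\<close>

class cstar_algebra_1 = cstar_algebra + real_normed_algebra_1

lemma cstar_0 [simp]: "cstar (0::'a::cstar_algebra) = 0"
  using cstar_add[of "0::'a" 0] by simp

lemma cstar_minus [simp]: "cstar (- x) = - cstar (x::'a::cstar_algebra)"
  using cstar_add[of x "- x"] by (simp add: add_eq_0_iff)

lemma cstar_diff: "cstar (x - y) = cstar x - cstar (y::'a::cstar_algebra)"
  using cstar_add[of x "- y"] by simp

lemma cstar_scaleR [simp]: "cstar (r *\<^sub>R x) = r *\<^sub>R cstar (x::'a::cstar_algebra)"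
  by (simp add: scaleR_cscale cstar_cscale)

lemma cstar_sum: "cstar (sum f I) = (\<Sum>i\<in>I. cstar (f i :: 'a::cstar_algebra))"
  by (induction I rule: infinite_finite_induct) (simp_all add: cstar_add)

lemma cstar_1 [simp]: "cstar (1::'a::cstar_algebra_1) = 1"
  by (metis cstar_cstar cstar_mult mult_1_left mult_1_right)

lemma cstar_power: "cstar (x ^ n) = cstar (x::'a::cstar_algebra_1) ^ n"
  by (induction n) (simp_all add: cstar_mult power_commutes)

lemma norm_le_norm_cstar: "norm x \<le> norm (cstar (x::'a::cstar_algebra))"
proof (cases "norm x = 0")
  case False
  have "norm x * norm x \<le> norm (cstar x) * norm x"
    using norm_mult_ineq[of "cstar x" x] by (simp add: cstar_identity power2_eq_square)
  then show ?thesis using False by simp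
qed simp

lemma norm_cstar [simp]: "norm (cstar x) = norm (x::'a::cstar_algebra)"
  using norm_le_norm_cstar[of x] norm_le_norm_cstar[of "cstar x"] by (simp add: cstar_cstar)

lemma norm_square_selfadjoint:
  "cstar x = x \<Longrightarrow> norm (x * x) = norm (x::'a::cstar_algebra) ^ 2"
  by (metis cstar_identity)

lemma bounded_linear_cstar: "bounded_linear (cstar :: 'a::cstar_algebra \<Rightarrow> 'a)"
  by (rule bounded_linear_intro[where K=1]) (simp_all add: cstar_add)

lemmas tendsto_cstar [tendsto_intros] = bounded_linear.tendsto[OF bounded_linear_cstar]

lemma cscale_0 [simp]: "cscale 0 (x::'a::cstar_algebra) = 0"
  using norm_cscale[of 0 x] by simp

lemma cscale_minus_right [simp]: "cscale s (- x) = - cscale s (x::'a::cstar_algebra)"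
  using cscale_add_right[of s x "-x"] norm_cscale[of s "0::'a"] by (simp add: add_eq_0_iff)

lemma cscale_zero_right [simp]: "cscale s (0::'a::cstar_algebra) = 0"
  using norm_cscale[of s "0::'a"] by simp

lemma cscale_minus_left: "cscale (- s) x = - cscale s (x::'a::cstar_algebra)"
  using cscale_add_left[of s "-s" x] by (simp add: add_eq_0_iff)

lemma cscale_diff_right: "cscale s (x - y) = cscale s x - cscale s (y::'a::cstar_algebra)"
  using cscale_add_right[of s x "-y"] by simp

lemma cscale_scaleR: "cscale s (r *\<^sub>R x) = r *\<^sub>R cscale s (x::'a::cstar_algebra)"
  by (simp add: scaleR_cscale cscale_cscale mult.commute)

lemma cstar_algebra_cancel: "cstar x * x = 0 \<Longrightarrow> x = (0::'a::cstar_algebra)"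
  using cstar_identity[of x] by simp

section \<open>Square roots by the binomial series\<close>

definition sqrt_coeff :: "nat \<Rightarrow> real" where
  "sqrt_coeff k = (-1) ^ k * ((1/2) gchoose k)"

lemma sqrt_coeff_0 [simp]: "sqrt_coeff 0 = 1"
  by (simp add: sqrt_coeff_def)

lemma sqrt_coeff_Suc: "sqrt_coeff (Suc k) * real (Suc k) = sqrt_coeff k * (real k - 1/2)"
proof -
  have "((1/2::real) gchoose Suc k) * real (Suc k) = ((1/2) gchoose k) * (1/2 - real k)"
    using gbinomial_mult_1[of "1/2::real" k] by (simp add: algebra_simps)
  then have "(-1) ^ k * (((1/2::real) gchoose Suc k) * real (Suc k)) = (-1) ^ k * (((1/2) gchoose k) * (1/2 - real k))"
    by (rule arg_cong)
  then show ?thesis unfolding sqrt_coeff_def power_Suc by (simp only: mult_ac) (simp add: algebra_simps)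
qed

lemma sqrt_coeff_nonpos: "sqrt_coeff (Suc k) \<le> 0"
proof (induction k)
  case 0
  then show ?case using sqrt_coeff_Suc[of 0] by simp
next
  case (Suc k)
  have "sqrt_coeff (Suc (Suc k)) * real (Suc (Suc k)) \<le> 0"
    unfolding sqrt_coeff_Suc[of "Suc k"] using Suc by (intro mult_nonpos_nonneg) auto
  then show ?case by (simp add: mult_le_0_iff)
qed

lemma sum_sqrt_coeff: "(\<Sum>k\<le>n. sqrt_coeff k) = - 2 * real (Suc n) * sqrt_coeff (Suc n)"
proof (induction n)
  case 0
  then show ?case using sqrt_coeff_Suc[of 0] by simp
next
  case (Suc n)
  then show ?case using sqrt_coeff_Suc[of "Suc n"] by (simp add: algebra_simps)
qed

text \<open>The coefficients after the first are nonpositive while the partial sums of all of them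
  stay nonnegative, so their absolute values cannot add up to more than the leading 1. This gives
  convergence on the closed unit ball and the bound of \<open>norm_1_minus_csqrt1\<close>.\<close>

lemma sum_abs_sqrt_coeff_le: "(\<Sum>k<n. \<bar>sqrt_coeff (Suc k)\<bar>) \<le> 1"
proof -
  have "(\<Sum>k\<le>n. sqrt_coeff k) = 1 - (\<Sum>k<n. \<bar>sqrt_coeff (Suc k)\<bar>)"
    using sqrt_coeff_nonpos by (simp add: sum.atMost_shift sum_negf)
  moreover have "(\<Sum>k\<le>n. sqrt_coeff k) \<ge> 0"
    unfolding sum_sqrt_coeff using sqrt_coeff_nonpos[of n] by (intro mult_nonpos_nonpos) auto
  ultimately show ?thesis by simp
qed

lemma summable_sqrt_coeff_Suc: "summable (\<lambda>k. \<bar>sqrt_coeff (Suc k)\<bar>)"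
  by (rule summableI_nonneg_bounded[OF _ sum_abs_sqrt_coeff_le]) simp

lemma summable_sqrt_coeff: "summable (\<lambda>k. \<bar>sqrt_coeff k\<bar>)"
  using summable_sqrt_coeff_Suc by (subst (asm) summable_Suc_iff)

lemma suminf_sqrt_coeff_le: "(\<Sum>k. \<bar>sqrt_coeff (Suc k)\<bar>) \<le> 1"
  by (rule suminf_le_const[OF summable_sqrt_coeff_Suc sum_abs_sqrt_coeff_le])

text \<open>Vandermonde's identity for 1/2 + 1/2 = 1: the square of the series has the coefficients
  of 1 - t.\<close>

lemma sqrt_coeff_convolution:
  "(\<Sum>i\<le>k. sqrt_coeff i * sqrt_coeff (k - i)) = (if k = 0 then 1 else if k = 1 then -1 else 0)"
proof -
  have "(\<Sum>i\<le>k. sqrt_coeff i * sqrt_coeff (k - i)) =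
    (\<Sum>i\<in>{0..k}. (-1)^k * (((1/2) gchoose i) * ((1/2) gchoose (k - i))))"
    unfolding atMost_atLeast0 sqrt_coeff_def
    by (intro sum.cong refl) (auto simp: mult_ac simp flip: power_add)
  also have "\<dots> = (-1)^k * ((1::real) gchoose k)"
    unfolding sum_distrib_left[symmetric] gbinomial_Vandermonde by simp
  also have "((1::real) gchoose k) = of_nat (1 choose k)"
    by (metis binomial_gbinomial of_nat_1)
  also have "(-1)^k * of_nat (1 choose k) = (if k = 0 then 1 else if k = 1 then -1 else (0::real))"
    by (cases k; cases "k - 1") auto
  finally show ?thesis .
qed

text \<open>\<open>csqrt1 y\<close> is \<open>\<surd>(1 - y)\<close> as a binomial series, which still converges for \<open>\<parallel>y\<parallel> = 1\<close>.\<close>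

definition csqrt1 :: "'a::{banach,real_normed_algebra_1} \<Rightarrow> 'a" where
  "csqrt1 y = (\<Sum>k. sqrt_coeff k *\<^sub>R y ^ k)"

context
  fixes y :: "'a::{banach,real_normed_algebra_1}"
  assumes y: "norm y \<le> 1"
begin

lemma norm_sqrt_term: "norm (sqrt_coeff k *\<^sub>R y ^ k) \<le> \<bar>sqrt_coeff k\<bar>"
proof -
  have "norm (y ^ k) \<le> 1"
    using norm_power_ineq[of y k] power_le_one[OF norm_ge_zero y, of k] by linarith
  then show ?thesis by (simp add: mult_left_le)
qed

lemma summable_norm_csqrt1: "summable (\<lambda>k. norm (sqrt_coeff k *\<^sub>R y ^ k))"
  by (rule summable_comparison_test[OF _ summable_sqrt_coeff]) (use norm_sqrt_term in auto)

lemma sums_csqrt1: "(\<lambda>k. sqrt_coeff k *\<^sub>R y ^ k) sums csqrt1 y"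
  unfolding csqrt1_def using summable_norm_cancel[OF summable_norm_csqrt1] by (rule summable_sums)

lemma csqrt1_square: "csqrt1 y * csqrt1 y = 1 - y"
proof -
  have "(\<lambda>k. \<Sum>i\<le>k. (sqrt_coeff i *\<^sub>R y ^ i) * (sqrt_coeff (k - i) *\<^sub>R y ^ (k - i))) sums
      (csqrt1 y * csqrt1 y)"
    unfolding csqrt1_def by (rule Cauchy_product_sums[OF summable_norm_csqrt1 summable_norm_csqrt1])
  also have "(\<lambda>k. \<Sum>i\<le>k. (sqrt_coeff i *\<^sub>R y ^ i) * (sqrt_coeff (k - i) *\<^sub>R y ^ (k - i))) =
     (\<lambda>k. (\<Sum>i\<le>k. sqrt_coeff i * sqrt_coeff (k - i)) *\<^sub>R y ^ k)"
    by (auto simp: scaleR_sum_left simp flip: power_add intro!: sum.cong ext)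
  also have "\<dots> = (\<lambda>k. if k \<in> {0,1} then (if k = 0 then 1 else - y) else 0)"
    by (auto simp: sqrt_coeff_convolution)
  finally have "(\<lambda>k. if k \<in> {0,1} then (if k = 0 then 1 else - y) else 0) sums
      (csqrt1 y * csqrt1 y)" .
  moreover have "(\<lambda>k. if k \<in> {0,1} then (if k = 0 then 1 else - y) else 0) sums
      (\<Sum>k\<in>{0,1::nat}. if k = 0 then 1 else - y)"
    by (rule sums_If_finite_set) simp
  ultimately have "csqrt1 y * csqrt1 y = (\<Sum>k\<in>{0,1::nat}. if k = 0 then 1 else - y)"
    by (rule sums_unique2)
  then show ?thesis by simp
qed

lemma csqrt1_commute:
  assumes "z * y = y * z" shows "z * csqrt1 y = csqrt1 y * z"
proof -
  have "z * y ^ k = y ^ k * z" for k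
    by (metis assms power_commuting_commutes)
  then have "(\<lambda>k. z * (sqrt_coeff k *\<^sub>R y ^ k)) = (\<lambda>k. (sqrt_coeff k *\<^sub>R y ^ k) * z)"
    by simp
  with sums_mult[OF sums_csqrt1, of z] sums_mult2[OF sums_csqrt1, of z] show ?thesis
    using sums_unique2 by metis
qed

lemma norm_1_minus_csqrt1: "norm (1 - csqrt1 y) \<le> 1"
proof -
  have s: "(\<lambda>k. sqrt_coeff (Suc k) *\<^sub>R y ^ Suc k) sums (csqrt1 y - 1)"
    using sums_csqrt1 by (subst sums_Suc_iff) simp
  have "norm (\<Sum>k. sqrt_coeff (Suc k) *\<^sub>R y ^ Suc k) \<le> (\<Sum>k. \<bar>sqrt_coeff (Suc k)\<bar>)"
    by (rule norm_suminf_le) (rule norm_sqrt_term, rule summable_sqrt_coeff_Suc)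
  with s suminf_sqrt_coeff_le show ?thesis
    by (simp add: sums_iff norm_minus_commute)
qed

end

lemma cstar_csqrt1:
  fixes y :: "'a::cstar_algebra_1"
  assumes "norm y \<le> 1" "cstar y = y"
  shows "cstar (csqrt1 y) = csqrt1 y"
  using bounded_linear.sums[OF bounded_linear_cstar sums_csqrt1[OF assms(1)]] sums_csqrt1[OF assms(1)]
  by (simp add: cstar_power assms(2) sums_unique2)

text \<open>The distance of the inverse from 1 is recorded because later perturbations enter through
  such inverses.\<close>

lemma neumann_inverse:
  fixes v :: "'a::{banach,real_normed_algebra_1}"
  assumes "norm v < 1"
  obtains w where "(1 - v) * w = 1" "w * (1 - v) = 1" "norm (w - 1) \<le> norm v / (1 - norm v)"
proof -
  have sn: "summable (\<lambda>k. norm v ^ k)"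
    using assms by (simp add: summable_geometric)
  have s: "summable (\<lambda>k. v ^ k)"
    by (rule summable_norm_cancel, rule summable_comparison_test[OF _ sn])
      (auto simp: norm_power_ineq)
  define w where "w = (\<Sum>k. v ^ k)"
  have w: "(\<lambda>k. v ^ k) sums w" unfolding w_def using s by (rule summable_sums)
  have w1: "(\<lambda>k. v ^ Suc k) sums (w - 1)" using w by (subst sums_Suc_iff) simp
  have "v * w = w - 1"
    using sums_mult[OF w, of v] w1 by (simp add: sums_unique2)
  moreover have "w * v = w - 1"
    using sums_mult2[OF w, of v] w1 by (simp add: sums_unique2 power_commutes)
  moreover have "norm (w - 1) \<le> norm v / (1 - norm v)"
  proof -
    have g: "(\<lambda>k. norm v * norm v ^ k) sums (norm v * (1 / (1 - norm v)))"
      using assms by (intro sums_mult geometric_sums) simp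
    have "norm (\<Sum>k. v ^ Suc k) \<le> (\<Sum>k. norm v * norm v ^ k)"
      by (rule norm_suminf_le)
        (use g norm_power_ineq[of v "Suc _"] in \<open>auto simp: sums_iff\<close>)
    with g w1 show ?thesis by (simp add: sums_iff)
  qed
  ultimately show ?thesis using that[of w] by (simp add: algebra_simps)
qed

text \<open>The inequality places \<open>h\<close> in the ball of radius \<open>t\<close> around
  \<open>t\<close>; for selfadjoint \<open>h\<close> this means that the spectrum lies in [0, 2t].
  In this form sums and scalings are immediate and no spectral theory is involved.\<close>

definition Pos :: "'a::cstar_algebra_1 \<Rightarrow> bool" where
  "Pos h \<longleftrightarrow> cstar h = h \<and> (\<exists>t. norm (t *\<^sub>R 1 - h) \<le> t)"

lemma Pos_cstar: "Pos h \<Longrightarrow> cstar h = h"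
  by (simp add: Pos_def)

lemma PosI: "cstar h = h \<Longrightarrow> norm (t *\<^sub>R 1 - h) \<le> t \<Longrightarrow> Pos h"
  by (auto simp: Pos_def)

text \<open>With \<open>h = t (1 - y)\<close> and \<open>norm y \<le> 1\<close> the binomial series
  supplies the root. The commutation clause makes roots of commuting elements commute, which
  replaces the passage to a commutative subalgebra.\<close>

lemma Pos_sqrt:
  fixes h :: "'a::cstar_algebra_1"
  assumes "Pos h"
  obtains k where "Pos k" "k * k = h" "\<And>z. z * h = h * z \<Longrightarrow> z * k = k * z"
proof -
  from assms obtain t where t: "cstar h = h" "norm (t *\<^sub>R 1 - h) \<le> t" by (auto simp: Pos_def)
  show ?thesis
  proof (cases "t = 0")
    case True
    with t have "h = 0" by simp
    with assms show ?thesis using that[of 0] by simp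
  next
    case False
    with t(2) have t0: "t > 0" using norm_ge_zero[of "t *\<^sub>R 1 - h"] by linarith
    define y where "y = (1/t) *\<^sub>R (t *\<^sub>R 1 - h)"
    have y: "norm y \<le> 1" using t(2) t0 by (simp add: y_def)
    have ys: "cstar y = y" by (simp add: y_def cstar_diff t)
    have hy: "1 - y = (1/t) *\<^sub>R h" using t0 by (simp add: y_def algebra_simps)
    let ?k = "sqrt t *\<^sub>R csqrt1 y"
    have "?k * ?k = h"
      using csqrt1_square[OF y] hy t0 by simp
    moreover have "Pos ?k"
    proof (rule PosI)
      show "cstar ?k = ?k" using cstar_csqrt1[OF y ys] by simp
      have "norm (sqrt t *\<^sub>R 1 - ?k) = sqrt t * norm (1 - csqrt1 y)"
        using t0 by (metis abs_of_pos norm_scaleR real_sqrt_gt_zero scaleR_right_diff_distrib)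
      also have "\<dots> \<le> sqrt t" using norm_1_minus_csqrt1[OF y] t0 by (simp add: mult_left_le)
      finally show "norm (sqrt t *\<^sub>R 1 - ?k) \<le> sqrt t" .
    qed
    moreover have "z * ?k = ?k * z" if "z * h = h * z" for z
    proof -
      have "z * y = y * z" using that by (simp add: y_def algebra_simps)
      from csqrt1_commute[OF y this] show ?thesis by simp
    qed
    ultimately show ?thesis by (intro that[of ?k]) auto
  qed
qed

section \<open>Squares of selfadjoint elements are positive\<close>

abbreviation ci :: "'a::cstar_algebra \<Rightarrow> 'a" where "ci \<equiv> cscale \<i>"

lemma ci_ci [simp]: "ci (ci x) = - x"
  by (simp add: cscale_cscale cscale_minus_left cscale_one)

lemma ci_mult [simp]: "ci x * y = ci (x * y)" "x * ci y = ci (x * y)"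
  by (simp_all add: cscale_mult_left[symmetric] cscale_mult_right[symmetric])

lemma cstar_ci [simp]: "cstar (ci x) = - ci (cstar x)"
  by (simp add: cstar_cscale cscale_minus_left)

lemma norm_real_part_le:
  fixes j k :: "'a::cstar_algebra"
  assumes "cstar j = j" "cstar k = k"
  shows "norm j \<le> norm (j + ci k)"
proof -
  have "2 *\<^sub>R j = (j + ci k) + cstar (j + ci k)"
    by (simp add: cstar_add assms scaleR_2)
  then have "2 * norm j \<le> norm (j + ci k) + norm (cstar (j + ci k))"
    by (metis norm_scaleR norm_triangle_ineq abs_numeral)
  then show ?thesis by simp
qed

text \<open>\<open>j + ci k\<close> is normal with real part \<open>j\<close>, and by the
  C*-identity its squared norm is the norm of the sum of squares.\<close>

lemma commuting_sum_squares:
  fixes j k :: "'a::cstar_algebra"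
  assumes "cstar j = j" "cstar k = k" "j * k = k * j"
  shows "norm j ^ 2 \<le> norm (j * j + k * k)"
proof -
  have "cstar (j + ci k) * (j + ci k) = j * j + k * k"
    using assms by (simp add: cstar_add algebra_simps cscale_diff_right cscale_add_right)
  then have "norm (j * j + k * k) = norm (j + ci k) ^ 2"
    by (metis cstar_identity)
  then show ?thesis using norm_real_part_le[OF assms(1,2)] by simp
qed

text \<open>\<open>t - k * k\<close> is the square of a selfadjoint element commuting with
  \<open>k\<close>, and the two squares add up to \<open>t\<close>; so
  \<open>commuting_sum_squares\<close> applies.\<close>

lemma norm_t_minus_square:
  fixes k :: "'a::cstar_algebra_1"
  assumes k: "cstar k = k" and t: "norm (k * k) \<le> t"
  shows "norm (t *\<^sub>R 1 - k * k) \<le> t"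
proof (cases "t = 0")
  case True
  then show ?thesis using t by simp
next
  case False
  with t have t0: "t > 0" using norm_ge_zero[of "k * k"] by linarith
  define y where "y = (1/t) *\<^sub>R (k * k)"
  have y: "norm y \<le> 1" using t t0 by (simp add: y_def)
  have ys: "cstar y = y" by (simp add: y_def cstar_mult k)
  have "k * csqrt1 y = csqrt1 y * k"
    by (rule csqrt1_commute[OF y]) (simp add: y_def mult.assoc)
  then have w: "norm (sqrt t *\<^sub>R csqrt1 y) ^ 2 \<le>
      norm ((sqrt t *\<^sub>R csqrt1 y) * (sqrt t *\<^sub>R csqrt1 y) + k * k)"
    by (intro commuting_sum_squares) (simp_all add: cstar_csqrt1 y ys k)
  have eq: "(sqrt t *\<^sub>R csqrt1 y) * (sqrt t *\<^sub>R csqrt1 y) = t *\<^sub>R 1 - k * k"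
    using arg_cong[OF csqrt1_square[OF y], of "scaleR t"] t0 by (simp add: y_def scaleR_right_diff_distrib)
  have "norm (sqrt t *\<^sub>R csqrt1 y) ^ 2 = norm (t *\<^sub>R 1 - k * k)"
    unfolding eq[symmetric]
    by (rule norm_square_selfadjoint[symmetric]) (simp add: cstar_csqrt1 y ys)
  with w eq show ?thesis using t0 by simp
qed

lemma Pos_square:
  fixes k :: "'a::cstar_algebra_1"
  assumes "cstar k = k" shows "Pos (k * k)"
  using norm_t_minus_square[OF assms order_refl] assms by (intro PosI) (simp_all add: cstar_mult)

text \<open>Any bound of the norm can serve as the witness in \<open>Pos\<close>, because
  \<open>h\<close> is a square. Such a uniform witness makes the cone closed under limits.\<close>

lemma Pos_norm:
  fixes h :: "'a::cstar_algebra_1"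
  assumes "Pos h" "norm h \<le> t" shows "norm (t *\<^sub>R 1 - h) \<le> t"
  using Pos_sqrt[OF assms(1)] norm_t_minus_square assms(2) Pos_cstar by metis

lemma Pos_0 [simp]: "Pos 0" and Pos_1 [simp]: "Pos 1"
  using Pos_square[of 0] Pos_square[of 1] by simp_all

lemma Pos_add:
  assumes "Pos g" "Pos h" shows "Pos (g + h)"
proof -
  from assms obtain s t where st: "norm (s *\<^sub>R 1 - g) \<le> s" "norm (t *\<^sub>R 1 - h) \<le> t"
    by (auto simp: Pos_def)
  have "norm ((s + t) *\<^sub>R 1 - (g + h)) \<le> norm (s *\<^sub>R 1 - g) + norm (t *\<^sub>R 1 - h)"
    using norm_triangle_ineq[of "s *\<^sub>R 1 - g" "t *\<^sub>R 1 - h"] by (simp add: algebra_simps)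
  with st show ?thesis using assms
    by (intro PosI[of _ "s + t"]) (simp_all add: cstar_add Pos_cstar)
qed

lemma Pos_scaleR:
  assumes "Pos h" "r \<ge> 0" shows "Pos (r *\<^sub>R h)"
proof -
  from assms obtain t where t: "norm (t *\<^sub>R 1 - h) \<le> t"
    by (auto simp: Pos_def)
  have "norm ((r * t) *\<^sub>R 1 - r *\<^sub>R h) = r * norm (t *\<^sub>R 1 - h)"
    using assms(2) by (metis abs_of_nonneg norm_scaleR scaleR_right_diff_distrib scaleR_scaleR)
  with t assms show ?thesis
    by (intro PosI[of _ "r * t"]) (simp_all add: Pos_cstar mult_left_mono)
qed

lemma Pos_sum: "(\<And>i. i \<in> I \<Longrightarrow> Pos (f i)) \<Longrightarrow> Pos (sum f I)"
  by (induction I rule: infinite_finite_induct) (simp_all add: Pos_add)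

lemma Pos_limit:
  assumes "\<And>n. Pos (h n)" "h \<longlonglongrightarrow> (l::'a::cstar_algebra_1)" shows "Pos l"
proof -
  have "Bseq h" using assms(2) by (simp add: convergentI convergent_imp_Bseq)
  then obtain K where K: "\<And>n. norm (h n) \<le> K" by (auto simp: Bseq_def)
  have "(\<lambda>n. cstar (h n)) \<longlonglongrightarrow> cstar l" by (intro tendsto_intros assms)
  then have "cstar l = l" using assms LIMSEQ_unique by (fastforce simp: Pos_cstar)
  moreover have "norm (K *\<^sub>R 1 - l) \<le> K"
  proof (rule LIMSEQ_le_const2)
    show "(\<lambda>n. norm (K *\<^sub>R 1 - h n)) \<longlonglongrightarrow> norm (K *\<^sub>R 1 - l)" by (intro tendsto_intros assms)
    show "\<exists>N. \<forall>n\<ge>N. norm (K *\<^sub>R 1 - h n) \<le> K" using Pos_norm[OF assms(1) K] by blast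
  qed
  ultimately show ?thesis by (rule PosI)
qed

lemma Pos_scalar_nonneg:
  assumes "Pos (s *\<^sub>R (1::'a::cstar_algebra_1))" shows "s \<ge> 0"
proof -
  from assms obtain t where "norm (t *\<^sub>R (1::'a) - s *\<^sub>R 1) \<le> t" by (auto simp: Pos_def)
  then have "\<bar>t - s\<bar> \<le> t" by (simp flip: scaleR_left_diff_distrib)
  then show ?thesis by linarith
qed

text \<open>The roots of \<open>h\<close> and of \<open>s - h\<close> commute, and their squares add
  up to \<open>s\<close>.\<close>

lemma Pos_norm_le:
  fixes h :: "'a::cstar_algebra_1"
  assumes "Pos h" "Pos (s *\<^sub>R 1 - h)" shows "norm h \<le> s"
proof -
  obtain j where j: "Pos j" "j * j = h" "\<And>z. z * h = h * z \<Longrightarrow> z * j = j * z"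
    using Pos_sqrt[OF assms(1)] by blast
  obtain k where k: "Pos k" "k * k = s *\<^sub>R 1 - h"
      "\<And>z. z * (s *\<^sub>R 1 - h) = (s *\<^sub>R 1 - h) * z \<Longrightarrow> z * k = k * z"
    using Pos_sqrt[OF assms(2)] by blast
  have s: "s \<ge> 0" using Pos_add[OF assms] Pos_scalar_nonneg by simp
  have "j * h = h * j" unfolding j(2)[symmetric] by (simp add: mult.assoc)
  then have "j * k = k * j" by (intro k(3)) (simp add: algebra_simps)
  then have "norm j ^ 2 \<le> norm (j * j + k * k)"
    using j(1) k(1) by (intro commuting_sum_squares) (simp_all add: Pos_cstar)
  also have "\<dots> = s" using j(2) k(2) s by simp
  finally show ?thesis using norm_square_selfadjoint[OF Pos_cstar[OF j(1)]] j(2) by simp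
qed

text \<open>Before \<open>Pos_cstar_mult_self\<close> only commuting conjugations are within reach;
  here the result is the square of \<open>j * z\<close>.\<close>

lemma Pos_sandwich_commuting:
  fixes z h :: "'a::cstar_algebra_1"
  assumes "Pos h" "cstar z = z" "z * h = h * z"
  shows "Pos (z * h * z)"
proof -
  obtain j where j: "Pos j" "j * j = h" "z * j = j * z"
    using Pos_sqrt[OF assms(1)] assms(3) by metis
  have "z * h * z = (j * z) * (j * z)" unfolding j(2)[symmetric] using j(3) by (metis mult.assoc)
  moreover have "cstar (j * z) = j * z" using j assms by (simp add: cstar_mult Pos_cstar)
  ultimately show ?thesis using Pos_square by metis
qed

text \<open>Divided by \<open>1 + norm z\<close>, the element \<open>1 + z\<close> has distance less
  than 1 from the unit, so a Neumann series inverts it. Both positivity claims come from writing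
  \<open>r\<close> and \<open>1 - r\<close> as a square plus \<open>r * z * r\<close>.\<close>

lemma Pos_resolvent:
  fixes z :: "'a::cstar_algebra_1"
  assumes "Pos z"
  obtains r where "(1 + z) * r = 1" "r * (1 + z) = 1" "Pos r" "Pos (1 - r)"
proof -
  have s: "norm (norm z *\<^sub>R 1 - z) \<le> norm z" by (rule Pos_norm[OF assms order_refl])
  define c where "c = 1 / (1 + norm z)"
  have c: "c > 0" and c1: "c * (1 + norm z) = 1" unfolding c_def
    by (simp_all add: add_pos_nonneg divide_simps)
       (use norm_ge_zero[of z] in linarith)
  define v where "v = c *\<^sub>R (norm z *\<^sub>R 1 - z)"
  have "norm v \<le> c * norm z" using s c by (simp add: v_def)
  also have "\<dots> < 1" using c1 c by (simp add: algebra_simps)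
  finally obtain w where w: "(1 - v) * w = 1" "w * (1 - v) = 1" by (rule neumann_inverse)
  have cc: "(c + c * norm z) *\<^sub>R (1::'a) = 1" using c1 by (simp add: algebra_simps)
  then have v: "1 - v = c *\<^sub>R (1 + z)"
    by (simp add: v_def algebra_simps)
  define r where "r = c *\<^sub>R w"
  have r1: "(1 + z) * r = 1" and r2: "r * (1 + z) = 1" using w by (simp_all add: v r_def)
  have zr: "z * r = 1 - r" and rz: "r * z = 1 - r" using r1 r2 by (simp_all add: algebra_simps)
  have zs: "cstar z = z" using assms by (rule Pos_cstar)
  have "cstar r * (1 + z) = 1" using arg_cong[OF r1, of cstar] by (simp add: cstar_mult cstar_add zs)
  then have rs: "cstar r = r" by (metis r1 mult.assoc mult_1_left mult_1_right)
  have rzr: "Pos (r * z * r)" by (rule Pos_sandwich_commuting[OF assms rs]) (simp add: zr rz)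
  have "r = r * r + r * z * r" by (simp add: rz algebra_simps)
  then have "Pos r" using Pos_add[OF Pos_square[OF rs] rzr] by simp
  moreover have "1 - r = r * z * r + (1 - r) * (1 - r)" by (simp add: rz algebra_simps)
  then have "Pos (1 - r)" using Pos_add[OF rzr Pos_square[of "1 - r"]] by (simp add: cstar_diff rs)
  ultimately show ?thesis using that r1 r2 by blast
qed

text \<open>The usual argument compares the spectra of \<open>cstar y * y\<close> and
  \<open>y * cstar y\<close>; here resolvents do this. Since \<open>y * cstar y\<close> is positive,
  \<open>1 + (y * cstar y) / t\<close> has an inverse \<open>r\<close>, and \<open>g\<close> plays
  the role of \<open>- q / (t - q)\<close>. From \<open>norm g \<le> 1\<close> it follows that
  \<open>q\<close> is at most \<open>t/2\<close> for every \<open>t > 0\<close>, so \<open>q\<close>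
  vanishes.\<close>

lemma neg_square_eq_0:
  fixes y :: "'a::cstar_algebra_1"
  assumes q: "Pos (- (cstar y * y))" shows "y = 0"
proof -
  define q where "q = - (cstar y * y)"
  define u where "u = (1/2) *\<^sub>R (y + cstar y)"
  define v where "v = (1/2) *\<^sub>R ci (cstar y - y)"
  have us: "cstar u = u" "cstar v = v"
    by (simp_all add: u_def v_def cstar_add cstar_diff cstar_cstar add.commute flip: cscale_minus_right)
  \<comment> \<open>\<open>u\<close> and \<open>v\<close> are the real and imaginary parts of
    \<open>y\<close>; the two products of \<open>y\<close> and \<open>cstar y\<close> add up to
    twice the sum of their squares.\<close>
  have "y * cstar y = 2 *\<^sub>R (u * u + v * v) + q"
  proof -
    have "2 *\<^sub>R (u * u + v * v) = (1/2) *\<^sub>R ((y + cstar y) * (y + cstar y) - (cstar y - y) * (cstar y - y))"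
      by (simp add: u_def v_def cscale_scaleR scaleR_right_diff_distrib)
    also have "(y + cstar y) * (y + cstar y) - (cstar y - y) * (cstar y - y) = 2 *\<^sub>R (y * cstar y + cstar y * y)"
      by (simp add: algebra_simps scaleR_2)
    finally show ?thesis by (simp add: q_def)
  qed
  then have yy: "Pos (y * cstar y)"
  proof -
    have "Pos (2 *\<^sub>R (u * u + v * v) + q)"
      using us assms unfolding q_def by (intro Pos_add Pos_scaleR Pos_square) auto
    then show ?thesis by (simp only: \<open>y * cstar y = _\<close>)
  qed
  have half: "Pos ((t/2) *\<^sub>R 1 - q)" if t: "t > 0" for t
  proof -
    define z where "z = (1/t) *\<^sub>R (y * cstar y)"
    have z: "Pos z" unfolding z_def using yy t by (intro Pos_scaleR) auto
    obtain r where r: "(1 + z) * r = 1" "r * (1 + z) = 1" "Pos r" "Pos (1 - r)"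
      using Pos_resolvent[OF z] by blast
    have tz: "y * cstar y = t *\<^sub>R z" using t by (simp add: z_def)
    have zr: "z * r = 1 - r" and rz: "r * z = 1 - r" using r by (simp_all add: algebra_simps)
    define g where "g = (1/t) *\<^sub>R (cstar y * r * y)"
    obtain p where p: "Pos p" "p * p = r" "\<And>w. w * r = r * w \<Longrightarrow> w * p = p * w"
      using Pos_sqrt[OF r(3)] by blast
    have zp: "z * p = p * z" by (rule p(3)) (simp add: zr rz)
    have "norm (p * y) ^ 2 = norm (cstar (p * y)) ^ 2" by simp
    also have "\<dots> = norm (cstar (cstar (p * y)) * cstar (p * y))" by (rule cstar_identity[symmetric])
    also have "cstar (cstar (p * y)) * cstar (p * y) = p * (y * cstar y) * p"
      using p(1) by (simp add: cstar_cstar cstar_mult Pos_cstar mult.assoc)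
    also have "\<dots> = t *\<^sub>R (1 - r)"
    proof -
      have "p * z * p = z * (p * p)" by (simp only: zp[symmetric] mult.assoc)
      then show ?thesis by (simp add: tz p(2) zr)
    qed
    finally have py: "norm (p * y) ^ 2 = t * norm (1 - r)" using t by simp
    have "cstar (p * y) * (p * y) = cstar y * r * y"
      unfolding p(2)[symmetric] using p(1) by (simp add: cstar_mult Pos_cstar mult.assoc)
    then have "norm (cstar y * r * y) = norm (p * y) ^ 2" by (metis cstar_identity)
    then have "norm g = norm (1 - r)" using py t by (simp add: g_def)
    also have "\<dots> \<le> 1" using r by (intro Pos_norm_le) auto
    finally have g1: "norm g \<le> 1" .
    have gs: "cstar g = g"
      using r(3) by (simp add: g_def cstar_mult cstar_cstar Pos_cstar mult.assoc)
    have "cstar y * r * y * (cstar y * y) = cstar y * (r * (y * cstar y)) * y" by (simp only: mult.assoc)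
    also have "\<dots> = t *\<^sub>R (cstar y * y) - t *\<^sub>R (cstar y * r * y)"
      by (simp add: tz rz algebra_simps)
    finally have 1: "g * q = q + t *\<^sub>R g"
      using arg_cong[of _ _ "scaleR (1/t)"] t by (fastforce simp: g_def q_def scaleR_right_diff_distrib)
    have "(cstar y * y) * (cstar y * r * y) = cstar y * ((y * cstar y) * r) * y" by (simp only: mult.assoc)
    also have "\<dots> = t *\<^sub>R (cstar y * y) - t *\<^sub>R (cstar y * r * y)"
      by (simp add: tz zr algebra_simps)
    finally have 2: "q * g = q + t *\<^sub>R g"
      using arg_cong[of _ _ "scaleR (1/t)"] t by (fastforce simp: g_def q_def scaleR_right_diff_distrib)
    have gg: "norm (g * g) \<le> 1"
      using norm_square_selfadjoint[OF gs] g1 by (simp add: power_le_one)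
    \<comment> \<open>Conjugating \<open>1 - g * g\<close> by \<open>t - q\<close> gives
      \<open>(t - q)^2 - q^2 = 2t (t/2 - q)\<close>, because
      \<open>g * (t - q) = - q\<close>.\<close>
    have "Pos (1 - g * g)"
      by (rule PosI[of _ 1]) (use gg gs in \<open>simp_all add: cstar_diff cstar_mult\<close>)
    moreover have qs: "cstar q = q" by (simp add: q_def cstar_mult cstar_cstar)
    moreover have gq: "g * q = q * g" using 1 2 by simp
    ultimately have P: "Pos ((t *\<^sub>R 1 - q) * (1 - g * g) * (t *\<^sub>R 1 - q))"
    proof (intro Pos_sandwich_commuting)
      have "q * (g * g) = g * g * q" by (metis gq mult.assoc)
      then show "(t *\<^sub>R 1 - q) * (1 - g * g) = (1 - g * g) * (t *\<^sub>R 1 - q)" by (simp add: algebra_simps)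
    qed (simp_all add: cstar_diff)
    have "(t *\<^sub>R 1 - q) * g = - q" using 2 by (simp add: algebra_simps)
    moreover have "g * (t *\<^sub>R 1 - q) = - q" using 1 by (simp add: algebra_simps)
    ultimately have "(t *\<^sub>R 1 - q) * (g * g) * (t *\<^sub>R 1 - q) = q * q"
      by (metis minus_mult_minus mult.assoc)
    moreover have "w * (1 - g * g) * w = w * w - w * (g * g) * w" for w
      by (simp only: right_diff_distrib left_diff_distrib mult_1_left mult_1_right)
    ultimately have "(t *\<^sub>R 1 - q) * (1 - g * g) * (t *\<^sub>R 1 - q) = (t *\<^sub>R 1 - q) * (t *\<^sub>R 1 - q) - q * q"
      by simp
    also have "\<dots> = (2 * t) *\<^sub>R ((t/2) *\<^sub>R 1 - q)"
      using scaleR_add_left[of t t q] by (simp add: algebra_simps flip: mult_2)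
    finally have "Pos ((2 * t) *\<^sub>R ((t/2) *\<^sub>R 1 - q))" using P by simp
    then have "Pos ((1 / (2 * t)) *\<^sub>R ((2 * t) *\<^sub>R ((t/2) *\<^sub>R 1 - q)))"
      by (rule Pos_scaleR) (use t in simp)
    then show ?thesis using t by simp
  qed
  have "norm q \<le> t" if "t > 0" for t
    using Pos_norm_le[of q t] half[of "2 * t"] that q by (simp add: q_def)
  then have "norm q \<le> 0" by (rule field_le_epsilon[of _ 0, simplified])
  then show ?thesis using cstar_algebra_cancel by (simp add: q_def)
qed

text \<open>\<open>p\<close> is the absolute value of \<open>h\<close>, and \<open>n = p - h\<close>
  is twice the negative part. The square of \<open>x * n\<close> equals
  \<open>n * h * n = - (n * p * n)\<close> and is therefore nonpositive, so \<open>x * n\<close>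
  vanishes; this forces \<open>n = 0\<close> and \<open>h = p\<close>.\<close>

theorem Pos_cstar_mult_self: "Pos (cstar x * (x::'a::cstar_algebra_1))"
proof -
  define h where "h = cstar x * x"
  have hs: "cstar h = h" by (simp add: h_def cstar_mult cstar_cstar)
  obtain p where p: "Pos p" "p * p = h * h" "\<And>z. z * (h * h) = h * h * z \<Longrightarrow> z * p = p * z"
    using Pos_sqrt[OF Pos_square[OF hs]] by blast
  have hp: "h * p = p * h" by (rule p(3)) (simp add: mult.assoc)
  define n where "n = p - h"
  have ns: "cstar n = n" using p(1) hs by (simp add: n_def cstar_diff Pos_cstar)
  have np: "n * p = p * n" using hp by (simp add: n_def algebra_simps)
  have hn: "h * n = - (p * n)" using hp p(2) by (simp add: n_def algebra_simps)
  have "cstar (x * n) * (x * n) = n * (h * n)" by (simp add: cstar_mult ns h_def mult.assoc)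
  then have eq: "- (cstar (x * n) * (x * n)) = n * p * n" by (simp add: hn mult.assoc)
  have P: "Pos (n * p * n)" by (rule Pos_sandwich_commuting[OF p(1) ns np])
  have "x * n = 0" by (rule neg_square_eq_0) (simp add: eq P)
  then have "h * n = 0" by (simp add: h_def mult.assoc)
  then have "h * n = 0" "p * n = 0" using hn by auto
  then have "n * n = 0" by (simp add: n_def left_diff_distrib)
  then have "n = 0" using cstar_algebra_cancel[of n] ns by simp
  then show ?thesis using p(1) by (simp add: n_def h_def)
qed

lemma Pos_conj:
  fixes h :: "'a::cstar_algebra_1"
  assumes "Pos h" shows "Pos (cstar x * h * x)"
proof -
  obtain j where j: "Pos j" "j * j = h" using Pos_sqrt[OF assms] by metis
  then have "cstar x * h * x = cstar (j * x) * (j * x)"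
    unfolding j(2)[symmetric] by (simp add: cstar_mult Pos_cstar mult.assoc)
  then show ?thesis using Pos_cstar_mult_self by metis
qed

lemma Pos_bound_imp_norm_le:
  fixes x :: "'a::cstar_algebra_1"
  assumes "Pos (r\<^sup>2 *\<^sub>R 1 - cstar x * x)" "r \<ge> 0" shows "norm x \<le> r"
proof -
  have "norm x ^ 2 \<le> r ^ 2"
    using Pos_norm_le[OF Pos_cstar_mult_self assms(1)] by (simp add: cstar_identity)
  then show ?thesis using assms(2) power2_le_imp_le by blast
qed

lemma norm_le_imp_Pos_bound:
  fixes x :: "'a::cstar_algebra_1"
  assumes "norm x \<le> r" shows "Pos (r\<^sup>2 *\<^sub>R 1 - cstar x * x)"
proof -
  have n: "norm (cstar x * x) \<le> r^2" using assms by (simp add: cstar_identity power_mono)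
  then show ?thesis by (intro PosI[of _ "r\<^sup>2"]) (simp_all add: cstar_diff cstar_mult cstar_cstar)
qed

section \<open>The unitization as a C*-algebra\<close>

lemma cscale_diff_left: "cscale (s - t) x = cscale s x - cscale t (x::'a::cstar_algebra)"
  using cscale_add_left[of s "-t" x] by (simp add: cscale_minus_left)

typedef (overloaded) 'a unitz = "UNIV :: ('a::cstar_algebra \<times> complex) set"
  morphisms of_unitz Unitz by simp

setup_lifting type_definition_unitz

instantiation unitz :: (cstar_algebra) ring_1
begin

lift_definition zero_unitz :: "'a unitz" is "(0, 0)" .
lift_definition one_unitz :: "'a unitz" is "(0, 1)" .
lift_definition plus_unitz :: "'a unitz \<Rightarrow> 'a unitz \<Rightarrow> 'a unitz" is "(+)" .
lift_definition minus_unitz :: "'a unitz \<Rightarrow> 'a unitz \<Rightarrow> 'a unitz" is "(-)" .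
lift_definition uminus_unitz :: "'a unitz \<Rightarrow> 'a unitz" is "uminus" .
lift_definition times_unitz :: "'a unitz \<Rightarrow> 'a unitz \<Rightarrow> 'a unitz" is umult .

instance
proof
  fix a b c :: "'a unitz"
  show "a * b * c = a * (b * c)"
    by transfer (simp add: umult_def prod_eq_iff cscale_add_right cscale_cscale
      cscale_mult_left[symmetric] cscale_mult_right[symmetric] algebra_simps)
  show "(a + b) * c = a * c + b * c" "a * (b + c) = a * b + a * c"
    by (transfer, simp add: umult_def prod_eq_iff cscale_add_right cscale_add_left algebra_simps)+
  show "1 * a = a" "a * 1 = a"
    by (transfer, simp add: umult_def prod_eq_iff cscale_one)+
  show "a + b + c = a + (b + c)" "a + b = b + a" "0 + a = a" "- a + a = 0" "a - b = a + - b"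
    by (transfer, simp add: prod_eq_iff)+
  show "0 \<noteq> (1::'a unitz)" by transfer simp
qed

end

instantiation unitz :: (cstar_algebra) real_algebra_1
begin

lift_definition scaleR_unitz :: "real \<Rightarrow> 'a unitz \<Rightarrow> 'a unitz" is "\<lambda>r u. r *\<^sub>R u" .

instance
proof
  fix a b :: "'a unitz" and r s :: real
  show "r *\<^sub>R (a + b) = r *\<^sub>R a + r *\<^sub>R b" "(r + s) *\<^sub>R a = r *\<^sub>R a + s *\<^sub>R a"
    "r *\<^sub>R s *\<^sub>R a = (r * s) *\<^sub>R a" "1 *\<^sub>R a = a"
    by (transfer, simp add: algebra_simps)+
  show "r *\<^sub>R a * b = r *\<^sub>R (a * b)" "a * r *\<^sub>R b = r *\<^sub>R (a * b)"
    by (transfer, simp add: umult_def prod_eq_iff scaleR_conv_of_real,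
        simp add: scaleR_cscale cscale_add_right cscale_cscale mult.commute)+
qed

end

definition umul_op :: "'a unitz \<Rightarrow> 'a::cstar_algebra \<Rightarrow> 'a" where
  "umul_op u a = fst (of_unitz u) * a + cscale (snd (of_unitz u)) a"

lemma bounded_linear_umul_op: "bounded_linear (umul_op u)"
proof (rule bounded_linear_intro[where K="norm (fst (of_unitz u)) + cmod (snd (of_unitz u))"])
  fix a b r
  show "umul_op u (a + b) = umul_op u a + umul_op u b"
    by (simp add: umul_op_def cscale_add_right algebra_simps)
  show "umul_op u (r *\<^sub>R a) = r *\<^sub>R umul_op u a"
    by (simp add: umul_op_def cscale_scaleR algebra_simps)
  have "norm (umul_op u a) \<le> norm (fst (of_unitz u) * a) + norm (cscale (snd (of_unitz u)) a)"
    unfolding umul_op_def by (rule norm_triangle_ineq)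
  also have "\<dots> \<le> norm (fst (of_unitz u)) * norm a + cmod (snd (of_unitz u)) * norm a"
    by (simp add: norm_cscale norm_mult_ineq)
  finally show "norm (umul_op u a) \<le> norm a * (norm (fst (of_unitz u)) + cmod (snd (of_unitz u)))"
    by (simp add: algebra_simps)
qed

lemma umul_op_mult: "umul_op (u * v) a = umul_op u (umul_op v a)"
  unfolding umul_op_def by (simp add: times_unitz.rep_eq umult_def cscale_add_right cscale_cscale
      cscale_mult_left[symmetric] cscale_mult_right[symmetric] algebra_simps)

lemma umul_op_add: "umul_op (u + v) a = umul_op u a + umul_op v a"
  by (simp add: umul_op_def plus_unitz.rep_eq cscale_add_left algebra_simps)

lemma umul_op_scaleR: "umul_op (r *\<^sub>R u) a = r *\<^sub>R umul_op u a"
  by (simp add: umul_op_def scaleR_unitz.rep_eq scaleR_conv_of_real[where 'a=complex])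
     (simp add: scaleR_cscale cscale_cscale cscale_add_right)

text \<open>The C*-identity shows that \<open>cstar x\<close> attains the norm; hence A embeds
  isometrically into its unitization.\<close>

lemma onorm_left_mult: "onorm (\<lambda>a. x * a) = norm (x::'a::cstar_algebra)"
proof (rule antisym)
  show "onorm (\<lambda>a. x * a) \<le> norm x"
    by (rule onorm_bound) (simp_all add: norm_mult_ineq)
  show "norm x \<le> onorm (\<lambda>a. x * a)"
  proof (cases "norm x = 0")
    case True
    then show ?thesis by (simp add: onorm_pos_le bounded_linear_mult_right)
  next
    case False
    have "norm x * norm x = norm (x * cstar x)"
      using cstar_identity[of "cstar x"] by (simp add: cstar_cstar power2_eq_square)
    also have "\<dots> \<le> onorm (\<lambda>a. x * a) * norm x"
      using onorm[OF bounded_linear_mult_right, of x "cstar x"] by simp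
    finally show ?thesis using False by simp
  qed
qed

text \<open>If \<open>A\<close> is unital, the operator norm alone is only a seminorm on \<open>A \<oplus> \<complex>\<close>; the maximum with
  \<open>|\<lambda>|\<close> is a C*-norm in every case.\<close>

instantiation unitz :: (cstar_algebra) real_normed_algebra_1
begin

definition norm_unitz :: "'a unitz \<Rightarrow> real" where
  "norm_unitz u = max (onorm (umul_op u)) (cmod (snd (of_unitz u)))"
definition dist_unitz :: "'a unitz \<Rightarrow> 'a unitz \<Rightarrow> real" where
  "dist_unitz u v = norm (u - v)"
definition sgn_unitz :: "'a unitz \<Rightarrow> 'a unitz" where
  "sgn_unitz u = inverse (norm u) *\<^sub>R u"
definition uniformity_unitz :: "('a unitz \<times> 'a unitz) filter" where
  "uniformity_unitz = (INF e\<in>{0 <..}. principal {(x, y). dist x y < e})"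
definition open_unitz :: "'a unitz set \<Rightarrow> bool" where
  "open_unitz U = (\<forall>x\<in>U. eventually (\<lambda>(x', y). x' = x \<longrightarrow> y \<in> U) uniformity)"

instance
proof
  fix u v :: "'a unitz" and r :: real
  note bl = bounded_linear_umul_op
  show "dist u v = norm (u - v)" by (rule dist_unitz_def)
  show "sgn u = inverse (norm u) *\<^sub>R u" by (rule sgn_unitz_def)
  show "uniformity = (INF e\<in>{0 <..}. principal {(x, y::'a unitz). dist x y < e})"
    by (rule uniformity_unitz_def)
  show "open U = (\<forall>x\<in>U. eventually (\<lambda>(x', y). x' = x \<longrightarrow> y \<in> U) uniformity)" for U :: "'a unitz set"
    by (rule open_unitz_def)
  show "(norm u = 0) = (u = 0)"
  proof
    assume "norm u = 0"
    then have "cmod (snd (of_unitz u)) \<le> 0" "onorm (umul_op u) \<le> 0"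
      by (simp_all add: norm_unitz_def max_def split: if_splits)
    then have 0: "snd (of_unitz u) = 0" "onorm (umul_op u) = 0"
      using onorm_pos_le[OF bl[of u]] by auto
    then have "umul_op u = (\<lambda>a. fst (of_unitz u) * a)" by (simp add: umul_op_def fun_eq_iff)
    with 0 have "norm (fst (of_unitz u)) = 0" using onorm_left_mult by metis
    with 0 show "u = 0" by (simp add: of_unitz_inject[symmetric] zero_unitz.rep_eq prod_eq_iff)
  next
    assume "u = 0"
    then have "umul_op u = (\<lambda>a. 0)" "snd (of_unitz u) = 0"
      by (simp_all add: umul_op_def zero_unitz.rep_eq fun_eq_iff)
    then show "norm u = 0" by (simp add: norm_unitz_def onorm_zero)
  qed
  show "norm (u + v) \<le> norm u + norm v"
  proof -
    have "onorm (umul_op (u + v)) \<le> onorm (umul_op u) + onorm (umul_op v)"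
      using onorm_triangle[OF bl bl, of u v] by (simp add: umul_op_add[abs_def])
    moreover have "cmod (snd (of_unitz (u + v))) \<le> cmod (snd (of_unitz u)) + cmod (snd (of_unitz v))"
      by (simp add: plus_unitz.rep_eq norm_triangle_ineq)
    ultimately show ?thesis unfolding norm_unitz_def by linarith
  qed
  show "norm (r *\<^sub>R u) = \<bar>r\<bar> * norm u"
  proof -
    have "onorm (umul_op (r *\<^sub>R u)) = \<bar>r\<bar> * onorm (umul_op u)"
      using onorm_scaleR[OF bl, of r u] by (simp add: umul_op_scaleR[abs_def])
    then show ?thesis by (simp add: norm_unitz_def scaleR_unitz.rep_eq max_mult_distrib_left)
  qed
  show "norm (u * v) \<le> norm u * norm v"
  proof -
    have "onorm (umul_op (u * v)) \<le> onorm (umul_op u) * onorm (umul_op v)"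
      using onorm_compose[OF bl bl, of u v] by (simp add: umul_op_mult[abs_def] o_def)
    also have "\<dots> \<le> norm u * norm v"
      by (intro mult_mono) (simp_all add: norm_unitz_def onorm_pos_le[OF bl] le_max_iff_disj)
    finally have "onorm (umul_op (u * v)) \<le> norm u * norm v" .
    moreover have "cmod (snd (of_unitz (u * v))) \<le> norm u * norm v"
      by (simp add: times_unitz.rep_eq umult_def norm_mult)
         (intro mult_mono, auto simp: norm_unitz_def le_max_iff_disj)
    ultimately show ?thesis unfolding norm_unitz_def[of "u * v"] by simp
  qed
  show "norm (1::'a unitz) = 1"
  proof -
    have "umul_op (1::'a unitz) = (\<lambda>a. a)"
      by (simp add: umul_op_def one_unitz.rep_eq cscale_one fun_eq_iff)
    then show ?thesis using onorm_id_le by (simp add: norm_unitz_def one_unitz.rep_eq max_def)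
  qed
qed

end

lift_definition incl :: "'a::cstar_algebra \<Rightarrow> 'a unitz" is "\<lambda>a. (a, 0)" .

definition in_ideal :: "'a::cstar_algebra unitz \<Rightarrow> bool" where
  "in_ideal u \<longleftrightarrow> snd (of_unitz u) = 0"

lemma in_ideal_incl [simp]: "in_ideal (incl a)"
  by (simp add: in_ideal_def incl.rep_eq)

lemma in_idealE: assumes "in_ideal u" obtains a where "u = incl a"
  using that[of "fst (of_unitz u)"] assms
  by (simp add: of_unitz_inject[symmetric] incl.rep_eq in_ideal_def prod_eq_iff)

lemma incl_inject [simp]: "incl a = incl b \<longleftrightarrow> a = b"
  by (simp add: of_unitz_inject[symmetric] incl.rep_eq)

lemma incl_0 [simp]: "incl 0 = 0"
  by (simp add: of_unitz_inject[symmetric] incl.rep_eq zero_unitz.rep_eq)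

lemma incl_add: "incl (a + b) = incl a + incl b"
  by (simp add: of_unitz_inject[symmetric] incl.rep_eq plus_unitz.rep_eq)

lemma incl_diff: "incl (a - b) = incl a - incl b"
  by (simp add: of_unitz_inject[symmetric] incl.rep_eq minus_unitz.rep_eq)

lemma incl_mult: "incl (a * b) = incl a * incl b"
  by (simp add: of_unitz_inject[symmetric] incl.rep_eq times_unitz.rep_eq umult_def)

lemma incl_scaleR: "incl (r *\<^sub>R a) = r *\<^sub>R incl a"
  by (simp add: of_unitz_inject[symmetric] incl.rep_eq scaleR_unitz.rep_eq)

lemma incl_sum: "incl (sum f I) = (\<Sum>i\<in>I. incl (f i))"
  by (induction I rule: infinite_finite_induct) (simp_all add: incl_add)

lemma norm_incl [simp]: "norm (incl a) = norm a"
proof -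
  have "umul_op (incl a) = (\<lambda>x. a * x)" by (simp add: umul_op_def incl.rep_eq fun_eq_iff)
  then show ?thesis by (simp add: norm_unitz_def incl.rep_eq onorm_left_mult)
qed

lemma cmod_snd_le: "cmod (snd (of_unitz u)) \<le> norm u"
  by (simp add: norm_unitz_def)

lemma in_ideal_simps [simp]:
  "in_ideal 0" "in_ideal u \<Longrightarrow> in_ideal v \<Longrightarrow> in_ideal (u + v)"
  "in_ideal u \<Longrightarrow> in_ideal v \<Longrightarrow> in_ideal (u - v)" "in_ideal u \<Longrightarrow> in_ideal (- u)"
  "in_ideal u \<Longrightarrow> in_ideal (r *\<^sub>R u)"
  by (simp_all add: in_ideal_def zero_unitz.rep_eq plus_unitz.rep_eq minus_unitz.rep_eq
      uminus_unitz.rep_eq scaleR_unitz.rep_eq)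

lemma in_ideal_mult [simp]:
  "in_ideal u \<Longrightarrow> in_ideal (u * v)" "in_ideal v \<Longrightarrow> in_ideal (u * v)"
  by (simp_all add: in_ideal_def times_unitz.rep_eq umult_def)

lemma in_ideal_sum: "(\<And>i. i \<in> I \<Longrightarrow> in_ideal (f i)) \<Longrightarrow> in_ideal (sum f I)"
  by (induction I rule: infinite_finite_induct) simp_all

lemma norm_Unitz_le: "norm (Unitz (a, s)) \<le> norm a + cmod s"
proof -
  have *: "Unitz (a, s) = incl a + Unitz (0, s)"
    by (simp add: of_unitz_inject[symmetric] incl.rep_eq plus_unitz.rep_eq Unitz_inverse)
  have "norm (Unitz (0::'a, s)) \<le> cmod s"
  proof -
    have "onorm (umul_op (Unitz (0::'a, s))) \<le> cmod s"
      by (rule onorm_bound) (simp_all add: umul_op_def Unitz_inverse norm_cscale)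
    then show ?thesis by (simp add: norm_unitz_def Unitz_inverse)
  qed
  then show ?thesis unfolding * using norm_triangle_ineq[of "incl a" "Unitz (0, s)"] by simp
qed

lemma Unitz_eta: "Unitz (fst (of_unitz u), snd (of_unitz u)) = u"
  by (simp add: of_unitz_inverse)

text \<open>With \<open>cmod_snd_le\<close> this passes Cauchy sequences to the two complete
  components, and \<open>norm_Unitz_le\<close> brings the limit back.\<close>

lemma norm_fst_le: "norm (fst (of_unitz u)) \<le> 2 * norm u"
proof -
  have "incl (fst (of_unitz u)) = u - Unitz (0, snd (of_unitz u))"
    by (simp add: of_unitz_inject[symmetric] incl.rep_eq minus_unitz.rep_eq Unitz_inverse prod_eq_iff)
  then have "norm (fst (of_unitz u)) \<le> norm u + norm (Unitz (0::'a, snd (of_unitz u)))"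
    by (metis norm_incl norm_triangle_ineq4)
  then show ?thesis using norm_Unitz_le[of "0::'a" "snd (of_unitz u)"] cmod_snd_le[of u] by simp
qed

instance unitz :: (cstar_algebra) banach
proof
  fix X :: "nat \<Rightarrow> 'a unitz" assume C: "Cauchy X"
  have c1: "Cauchy (\<lambda>n. fst (of_unitz (X n)))"
  proof (rule metric_CauchyI)
    fix e :: real assume "e > 0"
    then obtain M where M: "\<And>m n. m \<ge> M \<Longrightarrow> n \<ge> M \<Longrightarrow> norm (X m - X n) < e / 2"
      using CauchyD[OF C, of "e/2"] by auto
    then show "\<exists>M. \<forall>m\<ge>M. \<forall>n\<ge>M. dist (fst (of_unitz (X m))) (fst (of_unitz (X n))) < e"
    proof (intro exI allI impI)
      fix m n assume "M \<le> m" "M \<le> n"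
      with M[of m n] norm_fst_le[of "X m - X n"]
      show "dist (fst (of_unitz (X m))) (fst (of_unitz (X n))) < e"
        by (simp add: dist_norm minus_unitz.rep_eq)
    qed
  qed
  have c2: "Cauchy (\<lambda>n. snd (of_unitz (X n)))"
  proof (rule metric_CauchyI)
    fix e :: real assume "e > 0"
    then obtain M where M: "\<And>m n. m \<ge> M \<Longrightarrow> n \<ge> M \<Longrightarrow> norm (X m - X n) < e"
      using CauchyD[OF C, of e] by auto
    then show "\<exists>M. \<forall>m\<ge>M. \<forall>n\<ge>M. dist (snd (of_unitz (X m))) (snd (of_unitz (X n))) < e"
    proof (intro exI allI impI)
      fix m n assume "M \<le> m" "M \<le> n"
      with M[of m n] cmod_snd_le[of "X m - X n"]
      show "dist (snd (of_unitz (X m))) (snd (of_unitz (X n))) < e"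
        by (simp add: dist_norm minus_unitz.rep_eq)
    qed
  qed
  from c1 c2 obtain a s where a: "(\<lambda>n. fst (of_unitz (X n))) \<longlonglongrightarrow> a"
      and s: "(\<lambda>n. snd (of_unitz (X n))) \<longlonglongrightarrow> s"
    by (auto simp: Cauchy_convergent_iff convergent_def)
  have lim: "(\<lambda>n. norm (fst (of_unitz (X n)) - a) + cmod (snd (of_unitz (X n)) - s)) \<longlonglongrightarrow> 0"
    using tendsto_add[OF tendsto_norm[OF LIM_zero[OF a]] tendsto_norm[OF LIM_zero[OF s]]] by simp
  have "norm (X n - Unitz (a, s)) \<le>
      norm (fst (of_unitz (X n)) - a) + cmod (snd (of_unitz (X n)) - s)" for n
    using norm_Unitz_le[of "fst (of_unitz (X n - Unitz (a, s)))" "snd (of_unitz (X n - Unitz (a, s)))"]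
    unfolding Unitz_eta by (simp add: minus_unitz.rep_eq Unitz_inverse)
  then have "(\<lambda>n. X n - Unitz (a, s)) \<longlonglongrightarrow> 0"
    by (intro Lim_null_comparison[OF always_eventually lim] allI)
  then show "convergent X" using LIM_zero_cancel convergentI by blast
qed

instantiation unitz :: (cstar_algebra) cstar_algebra_1
begin

lift_definition cscale_unitz :: "complex \<Rightarrow> 'a unitz \<Rightarrow> 'a unitz" is
  "\<lambda>s u. (cscale s (fst u), s * snd u)" .
lift_definition cstar_unitz :: "'a unitz \<Rightarrow> 'a unitz" is
  "\<lambda>u. (cstar (fst u), cnj (snd u))" .

lemma umul_op_cscale: "umul_op (cscale s u) a = cscale s (umul_op u a)"
  by (simp add: umul_op_def cscale_unitz.rep_eq cscale_add_right cscale_cscale cscale_mult_left)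

lemma cstar_umul_op_mult: "cstar (umul_op u a) * umul_op u a = cstar a * umul_op (cstar u * u) a"
  unfolding umul_op_mult
  by (simp add: umul_op_def cstar_unitz.rep_eq cstar_add cstar_mult cstar_cscale cscale_add_right
      cscale_cscale cscale_mult_left[symmetric] cscale_mult_right[symmetric] algebra_simps)

text \<open>The C*-identity of A, applied to \<open>umul_op u a\<close>, moves
  \<open>cstar u\<close> to the other side. Together with submultiplicativity this inequality forces
  the C*-identity for the operator norm.\<close>

lemma onorm_umul_op_square_le: "onorm (umul_op u) ^ 2 \<le> onorm (umul_op (cstar u * u))"
proof -
  let ?N = "onorm (umul_op (cstar u * u))"
  have N: "?N \<ge> 0" by (rule onorm_pos_le[OF bounded_linear_umul_op])
  have "norm (umul_op u a) \<le> sqrt ?N * norm a" for a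
  proof (rule power2_le_imp_le)
    have "norm (umul_op u a) ^ 2 = norm (cstar a * umul_op (cstar u * u) a)"
      unfolding cstar_umul_op_mult[symmetric] by (rule cstar_identity[symmetric])
    also have "\<dots> \<le> norm (cstar a) * norm (umul_op (cstar u * u) a)" by (rule norm_mult_ineq)
    also have "\<dots> \<le> norm a * (?N * norm a)"
      unfolding norm_cstar by (intro mult_left_mono onorm bounded_linear_umul_op) simp
    finally show "norm (umul_op u a) ^ 2 \<le> (sqrt ?N * norm a)^2"
      using N by (simp add: power_mult_distrib power2_eq_square mult_ac)
  qed (use N in simp)
  then have "onorm (umul_op u) \<le> sqrt ?N" using N by (intro onorm_bound) auto
  then have "onorm (umul_op u) ^ 2 \<le> sqrt ?N ^ 2"
    by (intro power_mono onorm_pos_le bounded_linear_umul_op)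
  with N show ?thesis by simp
qed

instance
proof
  fix s t :: complex and x y :: "'a unitz" and r :: real
  show "cscale (s + t) x = cscale s x + cscale t x" "cscale s (x + y) = cscale s x + cscale s y"
       "cscale s (cscale t x) = cscale (s * t) x" "cscale 1 x = x"
    by (transfer, simp add: prod_eq_iff cscale_add_left cscale_add_right cscale_cscale cscale_one algebra_simps)+
  show "r *\<^sub>R x = cscale (complex_of_real r) x"
    by transfer (simp add: prod_eq_iff scaleR_cscale scaleR_conv_of_real)
  show "norm (cscale s x) = cmod s * norm x"
  proof -
    have le: "onorm (umul_op (cscale s x)) \<le> cmod s * onorm (umul_op x)" for s and x :: "'a unitz"
    proof (rule onorm_bound)
      show "norm (umul_op (cscale s x) a) \<le> cmod s * onorm (umul_op x) * norm a" for a
        using onorm[OF bounded_linear_umul_op, of x a]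
        by (simp add: umul_op_cscale norm_cscale mult.assoc mult_left_mono)
    qed (simp add: onorm_pos_le[OF bounded_linear_umul_op])
    have "onorm (umul_op (cscale s x)) = cmod s * onorm (umul_op x)"
    proof (cases "s = 0")
      case True
      then show ?thesis using le[of s x] onorm_pos_le[OF bounded_linear_umul_op, of "cscale s x"] by simp
    next
      case False
      have "cscale (1/s) (cscale s x) = x"
        using False by transfer (simp add: cscale_cscale cscale_one)
      then have "onorm (umul_op x) \<le> cmod (1/s) * onorm (umul_op (cscale s x))"
        using le[of "1/s" "cscale s x"] by simp
      then have "cmod s * onorm (umul_op x) \<le> onorm (umul_op (cscale s x))"
        using False by (simp add: norm_divide field_simps)
      with le[of s x] show ?thesis by simp
    qed
    then show ?thesis
      by (simp add: norm_unitz_def cscale_unitz.rep_eq norm_mult max_mult_distrib_left)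
  qed
  show "cscale s (x * y) = cscale s x * y" "cscale s (x * y) = x * cscale s y"
    by (transfer, simp add: umult_def prod_eq_iff cscale_add_right cscale_cscale
      cscale_mult_left[symmetric] cscale_mult_right[symmetric] algebra_simps)+
  show "cstar (cstar x) = x" "cstar (x + y) = cstar x + cstar y"
      "cstar (x * y) = cstar y * cstar x" "cstar (cscale s x) = cscale (cnj s) (cstar x)"
    by (transfer, simp add: umult_def prod_eq_iff cstar_cstar cstar_add cstar_mult cstar_cscale algebra_simps)+
  show "norm (cstar x * x) = norm x ^ 2"
  proof -
    have mult_le: "onorm (umul_op (u * v)) \<le> onorm (umul_op u) * onorm (umul_op v)" for u v :: "'a unitz"
      using onorm_compose[OF bounded_linear_umul_op bounded_linear_umul_op, of u v]
      by (simp add: umul_op_mult[abs_def] o_def)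
    have le: "onorm (umul_op u) \<le> onorm (umul_op (cstar u))" for u :: "'a unitz"
    proof (cases "onorm (umul_op u) = 0")
      case True
      then show ?thesis by (simp add: onorm_pos_le bounded_linear_umul_op)
    next
      case False
      then have "onorm (umul_op u) > 0" using onorm_pos_le[OF bounded_linear_umul_op, of u] by simp
      moreover have "onorm (umul_op u) * onorm (umul_op u) \<le> onorm (umul_op (cstar u)) * onorm (umul_op u)"
        using onorm_umul_op_square_le[of u] mult_le[of "cstar u" u] by (simp add: power2_eq_square)
      ultimately show ?thesis by simp
    qed
    have "cstar (cstar x) = x" by transfer (simp add: cstar_cstar)
    then have "onorm (umul_op (cstar x)) = onorm (umul_op x)" using le[of x] le[of "cstar x"] by simp
    then have "onorm (umul_op (cstar x * x)) = onorm (umul_op x) ^ 2"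
      using onorm_umul_op_square_le[of x] mult_le[of "cstar x" x] by (simp add: power2_eq_square)
    moreover have "cmod (snd (of_unitz (cstar x * x))) = cmod (snd (of_unitz x)) ^ 2"
      by (simp add: times_unitz.rep_eq umult_def cstar_unitz.rep_eq norm_mult power2_eq_square)
    moreover have "max (p ^ 2) (q ^ 2) = (max p q) ^ 2" if "p \<ge> 0" "q \<ge> 0" for p q :: real
      using that by (simp add: max_def power_mono)
    ultimately show ?thesis
      by (simp add: norm_unitz_def onorm_pos_le bounded_linear_umul_op)
  qed
qed

end

lemma incl_cstar: "incl (cstar a) = cstar (incl a)"
  by (simp add: of_unitz_inject[symmetric] incl.rep_eq cstar_unitz.rep_eq)

lemma in_ideal_cstar [simp]: "in_ideal u \<Longrightarrow> in_ideal (cstar u)"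
  by (simp add: in_ideal_def cstar_unitz.rep_eq)

lemma incl_tendsto_iff: "(\<lambda>n. incl (x n)) \<longlonglongrightarrow> incl a \<longleftrightarrow> x \<longlonglongrightarrow> a"
  unfolding LIMSEQ_iff by (simp flip: incl_diff)

lemma in_ideal_limit:
  assumes "\<And>n. in_ideal (u n)" "u \<longlonglongrightarrow> l" shows "in_ideal l"
proof -
  have "(\<lambda>n. norm (u n - l)) \<longlonglongrightarrow> 0" using assms(2) by (simp add: LIM_zero tendsto_norm_zero)
  moreover have "cmod (snd (of_unitz l)) \<le> norm (u n - l)" for n
    using cmod_snd_le[of "u n - l"] assms(1)[of n] by (simp add: minus_unitz.rep_eq in_ideal_def)
  ultimately have "cmod (snd (of_unitz l)) \<le> 0" by (intro LIMSEQ_le_const) auto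
  then show ?thesis by (simp add: in_ideal_def)
qed

text \<open>Dividing the nearby invertible element by its scalar part makes that part exactly 1, so
  the perturbation \<open>g\<close> stays in A.\<close>

lemma stable_rank_one_invertible:
  assumes "stable_rank_one TYPE('a::cstar_algebra)" "in_ideal (x :: 'a unitz)" "e > 0"
  obtains g y where "in_ideal g" "norm g < e" "(1 + x + g) * y = 1" "y * (1 + x + g) = 1"
proof -
  obtain a where a: "x = incl a" using assms(2) by (rule in_idealE)
  \<comment> \<open>The bound 1/2 keeps \<open>cmod m\<close> at least 1/2. Division by
    \<open>m\<close> then costs at most \<open>2 * (d + d * norm a)\<close>; the 4 instead of a 2
    makes this strictly less than \<open>e\<close>.\<close>
  define d where "d = min (1/2) (e / (4 + 2 * norm a))"
  have d: "d > 0" "d \<le> 1/2" "d * (4 + 2 * norm a) \<le> e"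
    using assms(3) norm_ge_zero[of a]
    by (simp_all add: d_def min_def field_simps add_pos_nonneg not_le split: if_splits)
  obtain b m where "uinvertible (b, m)" and near: "norm (a - b) + cmod (1 - m) < d"
    using assms(1) d(1) unfolding stable_rank_one_def by metis
  then obtain v where v: "umult (b, m) v = (0, 1)" "umult v (b, m) = (0, 1)"
    unfolding uinvertible_def by blast
  have "cmod (1 - m) < d" using near norm_ge_zero[of "a - b"] by linarith
  then have m2: "cmod m \<ge> 1/2" using d(2) norm_triangle_ineq2[of 1 m] by simp
  then have m0: "m \<noteq> 0" by auto
  define u where "u = Unitz (b, m)"
  define w where "w = Unitz v"
  have uw: "u * w = 1" "w * u = 1"
    using v by (simp_all add: u_def w_def of_unitz_inject[symmetric] times_unitz.rep_eq
        one_unitz.rep_eq Unitz_inverse)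
  define g where "g = incl (cscale (1/m) b - a)"
  have eq: "1 + x + g = cscale (1/m) u"
    using m0 by (simp add: a g_def u_def of_unitz_inject[symmetric] plus_unitz.rep_eq incl.rep_eq
        one_unitz.rep_eq cscale_unitz.rep_eq Unitz_inverse)
  have "cscale (1/m) b - a = cscale (1/m) ((b - a) + cscale (1 - m) a)"
    using m0 by (simp add: cscale_add_right cscale_diff_right cscale_cscale diff_divide_distrib
        cscale_one cscale_diff_left)
  then have "norm (cscale (1/m) b - a) \<le> (1 / cmod m) * (norm (b - a) + cmod (1 - m) * norm a)"
    using norm_triangle_ineq[of "b - a" "cscale (1 - m) a"]
    by (simp add: norm_cscale norm_divide divide_right_mono)
  also have "\<dots> \<le> 2 * (norm (b - a) + cmod (1 - m) * norm a)"
  proof (rule mult_right_mono)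
    show "1 / cmod m \<le> 2" using m2 m0 divide_left_mono[of "1/2" "cmod m" 1] by simp
  qed simp
  also have "\<dots> \<le> 2 * (d + d * norm a)"
  proof -
    have "norm (b - a) \<le> d" "cmod (1 - m) \<le> d"
      using near norm_ge_zero[of "a - b"] norm_ge_zero[of "1 - m"] norm_minus_commute[of a b] by linarith+
    then show ?thesis by (intro mult_left_mono add_mono mult_right_mono) auto
  qed
  also have "\<dots> < e" using d by (simp add: algebra_simps)
  finally have "norm g < e" by (simp add: g_def)
  moreover have "(1 + x + g) * cscale m w = 1" "cscale m w * (1 + x + g) = 1"
    unfolding eq using uw m0
    by (simp_all add: cscale_mult_left[symmetric] cscale_mult_right[symmetric] cscale_cscale cscale_one)
  ultimately show ?thesis using that[of g "cscale m w"] by (simp add: g_def)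
qed

section \<open>Row- and column-finite matrices\<close>

text \<open>One unital ring holds the matrices of every size, so inverses and complements
  \<open>1 - P\<close> make sense throughout and a size becomes a condition on the support.
  Finiteness of rows and columns keeps products and adjoints well defined.\<close>

typedef (overloaded) 'b rcf = "{x :: nat \<Rightarrow> nat \<Rightarrow> 'b::zero.
    (\<forall>i. finite {j. x i j \<noteq> 0}) \<and> (\<forall>j. finite {i. x i j \<noteq> 0})}"
  morphisms ent Rcf
  by (rule exI[of _ "\<lambda>_ _. 0"]) simp

setup_lifting type_definition_rcf

lemma finite_row [simp]: "finite {j. ent x i j \<noteq> 0}"
  and finite_column [simp]: "finite {i. ent x i j \<noteq> 0}"
  using ent[of x] by auto

lemma rcf_eqI: "(\<And>i j. ent x i j = ent y i j) \<Longrightarrow> x = y"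
  by (simp add: ent_inject[symmetric] fun_eq_iff)

instantiation rcf :: (ring_1) ring_1
begin

lift_definition zero_rcf :: "'a rcf" is "\<lambda>i j. 0" by simp
lift_definition one_rcf :: "'a rcf" is "\<lambda>i j. if i = j then 1 else 0" by simp
lift_definition plus_rcf :: "'a rcf \<Rightarrow> 'a rcf \<Rightarrow> 'a rcf" is "\<lambda>x y i j. x i j + y i j"
proof (intro conjI allI)
  fix x y :: "nat \<Rightarrow> nat \<Rightarrow> 'a" and i j
  assume "(\<forall>i. finite {j. x i j \<noteq> 0}) \<and> (\<forall>j. finite {i. x i j \<noteq> 0})"
     and "(\<forall>i. finite {j. y i j \<noteq> 0}) \<and> (\<forall>j. finite {i. y i j \<noteq> 0})"
  then have f: "finite ({j. x i j \<noteq> 0} \<union> {j. y i j \<noteq> 0})" "finite ({i. x i j \<noteq> 0} \<union> {i. y i j \<noteq> 0})"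
    by auto
  show "finite {j. x i j + y i j \<noteq> 0}" by (rule finite_subset[OF _ f(1)]) auto
  show "finite {i. x i j + y i j \<noteq> 0}" by (rule finite_subset[OF _ f(2)]) auto
qed
lift_definition uminus_rcf :: "'a rcf \<Rightarrow> 'a rcf" is "\<lambda>x i j. - x i j" by simp
definition minus_rcf :: "'a rcf \<Rightarrow> 'a rcf \<Rightarrow> 'a rcf" where "minus_rcf x y = x + - y"

lift_definition times_rcf :: "'a rcf \<Rightarrow> 'a rcf \<Rightarrow> 'a rcf" is
  "\<lambda>x y i j. \<Sum>t\<in>{t. x i t \<noteq> 0}. x i t * y t j"
proof (intro conjI allI)
  fix x y :: "nat \<Rightarrow> nat \<Rightarrow> 'a" and i j
  assume x: "(\<forall>i. finite {j. x i j \<noteq> 0}) \<and> (\<forall>j. finite {i. x i j \<noteq> 0})"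
     and y: "(\<forall>i. finite {j. y i j \<noteq> 0}) \<and> (\<forall>j. finite {i. y i j \<noteq> 0})"
  have nz: "\<exists>t. x i t \<noteq> 0 \<and> y t j \<noteq> 0" if "(\<Sum>t\<in>{t. x i t \<noteq> 0}. x i t * y t j) \<noteq> 0" for i j
    using that by (metis (mono_tags, lifting) mem_Collect_eq mult_zero_right sum.neutral)
  have "finite (\<Union>t\<in>{t. x i t \<noteq> 0}. {j. y t j \<noteq> 0})" using x y by auto
  then show "finite {j. (\<Sum>t\<in>{t. x i t \<noteq> 0}. x i t * y t j) \<noteq> 0}"
    by (rule rev_finite_subset) (use nz in blast)
  have "finite (\<Union>t\<in>{t. y t j \<noteq> 0}. {i. x i t \<noteq> 0})" using x y by auto
  then show "finite {i. (\<Sum>t\<in>{t. x i t \<noteq> 0}. x i t * y t j) \<noteq> 0}"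
    by (rule rev_finite_subset) (use nz in blast)
qed

lemma ent_mult:
  assumes "finite S" "\<And>t. t \<notin> S \<Longrightarrow> ent x i t = 0 \<or> ent y t j = 0"
  shows "ent (x * y) i j = (\<Sum>t\<in>S. ent x i t * ent y t j)"
proof -
  have "(\<Sum>t\<in>{t. ent x i t \<noteq> 0}. ent x i t * ent y t j) = (\<Sum>t\<in>{t. ent x i t \<noteq> 0} \<inter> S. ent x i t * ent y t j)"
    by (rule sum.mono_neutral_right) (use assms(2) in fastforce)+
  also have "\<dots> = (\<Sum>t\<in>S. ent x i t * ent y t j)"
    by (rule sum.mono_neutral_left) (use assms(1) in auto)
  finally show ?thesis by (simp add: times_rcf.rep_eq)
qed

instance
proof
  fix x y z :: "'a rcf"
  show "x * y * z = x * (y * z)"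
  proof (rule rcf_eqI)
    fix i j
    define S where "S = {t. ent x i t \<noteq> 0}"
    define T where "T = (\<Union>s\<in>S. {t. ent y s t \<noteq> 0})"
    have S: "finite S" and T: "finite T" by (auto simp: S_def T_def)
    have xy: "ent (x * y) i t = (\<Sum>s\<in>S. ent x i s * ent y s t)" for t
      by (rule ent_mult[OF S]) (simp add: S_def)
    have yz: "ent (y * z) s j = (\<Sum>t\<in>T. ent y s t * ent z t j)" if "s \<in> S" for s
      by (rule ent_mult[OF T]) (use that in \<open>auto simp: T_def\<close>)
    have "ent (x * y * z) i j = (\<Sum>t\<in>T. ent (x * y) i t * ent z t j)"
      by (rule ent_mult[OF T]) (use xy in \<open>auto simp: T_def intro!: sum.neutral\<close>)
    also have "\<dots> = (\<Sum>s\<in>S. \<Sum>t\<in>T. ent x i s * (ent y s t * ent z t j))"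
      unfolding xy sum_distrib_right by (subst sum.swap) (simp add: mult.assoc)
    also have "\<dots> = (\<Sum>s\<in>S. ent x i s * ent (y * z) s j)"
      by (simp add: yz sum_distrib_left)
    also have "\<dots> = ent (x * (y * z)) i j"
      by (rule ent_mult[OF S, symmetric]) (simp add: S_def)
    finally show "ent (x * y * z) i j = ent (x * (y * z)) i j" .
  qed
  show "(x + y) * z = x * z + y * z"
  proof (rule rcf_eqI)
    fix i j
    note e = ent_mult[of "{t. ent z t j \<noteq> 0}" _ i z j, simplified]
    show "ent ((x + y) * z) i j = ent (x * z + y * z) i j"
      by (simp add: e plus_rcf.rep_eq algebra_simps sum.distrib)
  qed
  show "x * (y + z) = x * y + x * z"
  proof (rule rcf_eqI)
    fix i j
    note e = ent_mult[of "{t. ent x i t \<noteq> 0}" x i _ j, simplified]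
    show "ent (x * (y + z)) i j = ent (x * y + x * z) i j"
      by (simp add: e plus_rcf.rep_eq algebra_simps sum.distrib)
  qed
  show "1 * x = x"
  proof (rule rcf_eqI)
    fix i j
    show "ent (1 * x) i j = ent x i j"
      by (subst ent_mult[of "{i}"]) (auto simp: one_rcf.rep_eq)
  qed
  show "x * 1 = x"
  proof (rule rcf_eqI)
    fix i j
    show "ent (x * 1) i j = ent x i j"
      by (subst ent_mult[of "{j}"]) (auto simp: one_rcf.rep_eq)
  qed
  show "x + y + z = x + (y + z)" "x + y = y + x" "0 + x = x" "- x + x = 0"
    by (rule rcf_eqI, simp add: plus_rcf.rep_eq zero_rcf.rep_eq uminus_rcf.rep_eq add_ac)+
  show "x - y = x + - y" by (simp add: minus_rcf_def)
  have "ent 0 0 0 \<noteq> (ent 1 0 0 :: 'a)" by (simp add: zero_rcf.rep_eq one_rcf.rep_eq)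
  then show "0 \<noteq> (1 :: 'a rcf)" by metis
qed

end

instantiation rcf :: (real_algebra_1) real_algebra_1
begin

lift_definition scaleR_rcf :: "real \<Rightarrow> 'a rcf \<Rightarrow> 'a rcf" is "\<lambda>r x i j. r *\<^sub>R x i j"
proof (intro conjI allI)
  fix r and x :: "nat \<Rightarrow> nat \<Rightarrow> 'a" and i j
  assume "(\<forall>i. finite {j. x i j \<noteq> 0}) \<and> (\<forall>j. finite {i. x i j \<noteq> 0})"
  then have "finite {j. x i j \<noteq> 0}" "finite {i. x i j \<noteq> 0}" by auto
  then show "finite {j. r *\<^sub>R x i j \<noteq> 0}" "finite {i. r *\<^sub>R x i j \<noteq> 0}"
    by (auto elim!: rev_finite_subset)
qed

instance
proof
  fix x y :: "'a rcf" and r s :: real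
  show "r *\<^sub>R (x + y) = r *\<^sub>R x + r *\<^sub>R y" "(r + s) *\<^sub>R x = r *\<^sub>R x + s *\<^sub>R x"
    "r *\<^sub>R s *\<^sub>R x = (r * s) *\<^sub>R x" "1 *\<^sub>R x = x"
    by (rule rcf_eqI, simp add: plus_rcf.rep_eq scaleR_rcf.rep_eq algebra_simps)+
  show "r *\<^sub>R x * y = r *\<^sub>R (x * y)"
  proof (rule rcf_eqI)
    fix i j
    note e = ent_mult[of "{t. ent y t j \<noteq> 0}" _ i y j, simplified]
    show "ent (r *\<^sub>R x * y) i j = ent (r *\<^sub>R (x * y)) i j"
      by (simp add: e scaleR_rcf.rep_eq scaleR_sum_right)
  qed
  show "x * r *\<^sub>R y = r *\<^sub>R (x * y)"
  proof (rule rcf_eqI)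
    fix i j
    note e = ent_mult[of "{t. ent x i t \<noteq> 0}" x i _ j, simplified]
    show "ent (x * r *\<^sub>R y) i j = ent (r *\<^sub>R (x * y)) i j"
      by (simp add: e scaleR_rcf.rep_eq scaleR_sum_right)
  qed
qed

end

lemma ent_minus [simp]: "ent (x - y) i j = ent x i j - ent y i j"
  by (simp only: minus_rcf_def plus_rcf.rep_eq uminus_rcf.rep_eq diff_conv_add_uminus)

lemmas ent_simps [simp] = zero_rcf.rep_eq one_rcf.rep_eq plus_rcf.rep_eq uminus_rcf.rep_eq
  scaleR_rcf.rep_eq

lemma ent_sum: "ent (sum f I) i j = (\<Sum>t\<in>I. ent (f t) i j)"
  by (induction I rule: infinite_finite_induct) simp_all

lift_definition rstar :: "'b::cstar_algebra rcf \<Rightarrow> 'b rcf" is "\<lambda>x i j. cstar (x j i)"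
proof -
  fix x :: "nat \<Rightarrow> nat \<Rightarrow> 'b"
  have "cstar y \<noteq> 0 \<longleftrightarrow> y \<noteq> 0" for y :: 'b by (metis cstar_0 cstar_cstar)
  moreover assume "(\<forall>i. finite {j. x i j \<noteq> 0}) \<and> (\<forall>j. finite {i. x i j \<noteq> 0})"
  ultimately show "(\<forall>i. finite {j. cstar (x j i) \<noteq> 0}) \<and> (\<forall>j. finite {i. cstar (x j i) \<noteq> 0})"
    by auto
qed

lemma ent_rstar [simp]: "ent (rstar x) i j = cstar (ent x j i)"
  by (simp add: rstar.rep_eq)

lemma rstar_simps [simp]:
  fixes x y :: "'b::cstar_algebra_1 rcf"
  shows "rstar (rstar x) = x" "rstar 0 = (0 :: 'b rcf)" "rstar 1 = (1 :: 'b rcf)"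
  "rstar (x + y) = rstar x + rstar y" "rstar (x - y) = rstar x - rstar y"
  "rstar (- x) = - rstar x" "rstar (r *\<^sub>R x) = r *\<^sub>R rstar x"
  by (rule rcf_eqI, simp add: cstar_cstar cstar_add cstar_diff)+

lemma rstar_mult [simp]: "rstar (x * y) = rstar y * rstar (x::'b::cstar_algebra_1 rcf)"
proof (rule rcf_eqI)
  fix i j
  show "ent (rstar (x * y)) i j = ent (rstar y * rstar x) i j"
  proof -
    let ?S = "{t. ent y t i \<noteq> 0}"
    have "ent (x * y) j i = (\<Sum>t\<in>?S. ent x j t * ent y t i)"
      by (rule ent_mult) auto
    moreover have "ent (rstar y * rstar x) i j = (\<Sum>t\<in>?S. ent (rstar y) i t * ent (rstar x) t j)"
      by (rule ent_mult) auto
    ultimately show ?thesis by (simp add: cstar_sum cstar_mult)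
  qed
qed

lemma rstar_power: "rstar (x ^ n) = rstar (x::'b::cstar_algebra_1 rcf) ^ n"
  by (induction n) (simp_all add: power_commutes)

section \<open>The order on matrices\<close>

definition nneg :: "'b::cstar_algebra_1 rcf \<Rightarrow> bool" where
  "nneg T \<longleftrightarrow> (\<forall>\<xi> i. Pos (ent (rstar \<xi> * T * \<xi>) i i))"

lemma nneg_add: "nneg S \<Longrightarrow> nneg T \<Longrightarrow> nneg (S + T)"
  by (simp add: nneg_def algebra_simps Pos_add)

lemma nneg_0 [simp]: "nneg 0"
  by (simp add: nneg_def)

lemma nneg_scaleR: "nneg T \<Longrightarrow> r \<ge> 0 \<Longrightarrow> nneg (r *\<^sub>R T)"
  by (simp add: nneg_def Pos_scaleR)

lemma nneg_scaleR_cancel: "nneg (r *\<^sub>R T) \<Longrightarrow> r > 0 \<Longrightarrow> nneg T"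
  using nneg_scaleR[of "r *\<^sub>R T" "1 / r"] by simp

lemma nneg_sum: "(\<And>i. i \<in> I \<Longrightarrow> nneg (f i)) \<Longrightarrow> nneg (sum f I)"
  by (induction I rule: infinite_finite_induct) (simp_all add: nneg_add)

lemma nneg_conj: assumes "nneg T" shows "nneg (rstar x * T * x)"
  unfolding nneg_def
proof (intro allI)
  fix \<xi> i
  have "rstar \<xi> * (rstar x * T * x) * \<xi> = rstar (x * \<xi>) * T * (x * \<xi>)" by (simp add: mult.assoc)
  then show "Pos (ent (rstar \<xi> * (rstar x * T * x) * \<xi>) i i)"
    using assms by (metis nneg_def)
qed

lemma ent_rstar_mult_self:
  assumes "finite S" "\<And>t. t \<notin> S \<Longrightarrow> ent x t i = 0"
  shows "ent (rstar x * x) i i = (\<Sum>t\<in>S. cstar (ent x t i) * ent (x::'b::cstar_algebra_1 rcf) t i)"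
  using assms by (subst ent_mult[of S]) auto

lemma Pos_ent_rstar_mult_self: "Pos (ent (rstar x * x) i i)"
  by (subst ent_rstar_mult_self[of "{t. ent x t i \<noteq> 0}"]) (auto intro!: Pos_sum Pos_cstar_mult_self)

lemma nneg_rstar_mult_self [simp]: "nneg (rstar x * x)"
  unfolding nneg_def
proof (intro allI)
  fix \<xi> i
  have "rstar \<xi> * (rstar x * x) * \<xi> = rstar (x * \<xi>) * (x * \<xi>)" by (simp add: mult.assoc)
  then show "Pos (ent (rstar \<xi> * (rstar x * x) * \<xi>) i i)" by (metis Pos_ent_rstar_mult_self)
qed

lemma nneg_1 [simp]: "nneg 1"
  using nneg_rstar_mult_self[of 1] by simp

lemma nneg_diag: "nneg T \<Longrightarrow> Pos (ent T i i)"
  unfolding nneg_def by (metis mult_1_left mult_1_right rstar_simps(3))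

section \<open>Entrywise limits\<close>

definition elim :: "(nat \<Rightarrow> 'b::real_normed_vector rcf) \<Rightarrow> 'b rcf \<Rightarrow> bool" where
  "elim X L \<longleftrightarrow> (\<forall>i j. (\<lambda>n. ent (X n) i j) \<longlonglongrightarrow> ent L i j)"

lemma elim_unique: "elim X L \<Longrightarrow> elim X M \<Longrightarrow> L = M"
  unfolding elim_def by (rule rcf_eqI) (blast intro: LIMSEQ_unique)

lemma elim_const [simp]: "elim (\<lambda>n. x) x"
  by (simp add: elim_def)

lemma elim_add:
  fixes X Y :: "nat \<Rightarrow> 'b::real_normed_algebra_1 rcf"
  shows "elim X L \<Longrightarrow> elim Y M \<Longrightarrow> elim (\<lambda>n. X n + Y n) (L + M)"
  by (simp add: elim_def tendsto_add)

lemma elim_diff: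
  fixes X Y :: "nat \<Rightarrow> 'b::real_normed_algebra_1 rcf"
  shows "elim X L \<Longrightarrow> elim Y M \<Longrightarrow> elim (\<lambda>n. X n - Y n) (L - M)"
  by (simp add: elim_def tendsto_diff)

lemma elim_scaleR_left:
  fixes L :: "'b::real_normed_algebra_1 rcf"
  shows "r \<longlonglongrightarrow> s \<Longrightarrow> elim (\<lambda>n. r n *\<^sub>R L) (s *\<^sub>R L)"
  by (simp add: elim_def tendsto_scaleR)

lemma elim_rstar:
  fixes X :: "nat \<Rightarrow> 'b::cstar_algebra_1 rcf"
  shows "elim X L \<Longrightarrow> elim (\<lambda>n. rstar (X n)) (rstar L)"
  by (simp add: elim_def tendsto_cstar)

text \<open>The form at a single column of \<open>\<xi>\<close> involves finitely many entries of
  the matrix, so entrywise convergence is enough.\<close>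

lemma nneg_limit:
  fixes L :: "'b::cstar_algebra_1 rcf"
  assumes "\<And>n. nneg (X n)" "elim X L" shows "nneg L"
  unfolding nneg_def
proof (intro allI)
  fix \<xi> :: "'b rcf" and i
  define S where "S = {t. ent \<xi> t i \<noteq> 0}"
  have S: "finite S" by (simp add: S_def)
  have e: "ent (rstar \<xi> * T * \<xi>) i i = (\<Sum>t\<in>S. (\<Sum>s\<in>S. cstar (ent \<xi> s i) * ent T s t) * ent \<xi> t i)" for T
    by (subst ent_mult[OF S], simp add: S_def, intro sum.cong refl, subst ent_mult[OF S])
       (auto simp: S_def)
  show "Pos (ent (rstar \<xi> * L * \<xi>) i i)"
  proof (rule Pos_limit)
    show "Pos (ent (rstar \<xi> * X n * \<xi>) i i)" for n using assms(1) by (simp add: nneg_def)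
    show "(\<lambda>n. ent (rstar \<xi> * X n * \<xi>) i i) \<longlonglongrightarrow> ent (rstar \<xi> * L * \<xi>) i i"
      unfolding e using assms(2)
      by (auto simp: elim_def intro!: tendsto_sum tendsto_mult tendsto_const)
  qed
qed

text \<open>Diagonal outside an \<open>n\<close> by \<open>n\<close> block. Unlike support inside
  the block, this admits 1 and all polynomials in a block matrix. It also fixes the finite index
  range of a product along a whole sequence, which \<open>elim_mult\<close> relies on.\<close>

definition diagb :: "nat \<Rightarrow> 'b::zero rcf \<Rightarrow> bool" where
  "diagb n x \<longleftrightarrow> (\<forall>i j. i \<noteq> j \<longrightarrow> n \<le> i \<or> n \<le> j \<longrightarrow> ent x i j = 0)"

lemma diagb_ent_mult:
  assumes "diagb n x" shows "ent (x * y) i j = (\<Sum>t\<in>insert i {..<n}. ent x i t * ent y t j)"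
  using assms by (intro ent_mult) (auto simp: diagb_def)

lemma diagb_simps [simp]:
  fixes x y :: "'b::real_algebra_1 rcf"
  shows "diagb n 0" "diagb n (1 :: 'b rcf)" "diagb n x \<Longrightarrow> diagb n y \<Longrightarrow> diagb n (x + y)"
  "diagb n x \<Longrightarrow> diagb n y \<Longrightarrow> diagb n (x - y)" "diagb n x \<Longrightarrow> diagb n (- x)"
  "diagb n x \<Longrightarrow> diagb n (r *\<^sub>R x)"
  by (auto simp: diagb_def)

lemma diagb_rstar [simp]: "diagb n x \<Longrightarrow> diagb n (rstar (x::'b::cstar_algebra_1 rcf))"
  by (auto simp: diagb_def)

lemma diagb_mult [simp]:
  fixes x y :: "'b::real_algebra_1 rcf"
  assumes "diagb n x" "diagb n y" shows "diagb n (x * y)"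
  unfolding diagb_def
proof (intro allI impI)
  fix i j :: nat assume ij: "i \<noteq> j" "n \<le> i \<or> n \<le> j"
  have "ent x i t * ent y t j = 0" for t
    using assms ij unfolding diagb_def by (cases "t = i"; cases "t = j") auto
  then show "ent (x * y) i j = 0" by (simp add: diagb_ent_mult[OF assms(1)])
qed

lemma diagb_limit: "(\<And>k. diagb n (X k)) \<Longrightarrow> elim X L \<Longrightarrow> diagb n L"
  for X :: "nat \<Rightarrow> 'b::real_normed_algebra_1 rcf"
  unfolding diagb_def elim_def by (metis (no_types, lifting) LIMSEQ_const_iff ext)

lemma elim_mult:
  fixes X Y :: "nat \<Rightarrow> 'b::real_normed_algebra_1 rcf"
  assumes "\<And>k. diagb n (X k)" "elim X L" "elim Y M"
  shows "elim (\<lambda>k. X k * Y k) (L * M)"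
  unfolding elim_def
proof (intro allI)
  fix i j
  show "(\<lambda>k. ent (X k * Y k) i j) \<longlonglongrightarrow> ent (L * M) i j"
    unfolding diagb_ent_mult[OF assms(1)] diagb_ent_mult[OF diagb_limit[OF assms(1,2)]]
    using assms(2,3) by (auto simp: elim_def simp del: sum.insert intro!: tendsto_sum tendsto_mult)
qed

section \<open>Order bounds and bounds on entries\<close>

definition supp :: "nat \<Rightarrow> nat \<Rightarrow> 'b::zero rcf \<Rightarrow> bool" where
  "supp l k x \<longleftrightarrow> (\<forall>i j. l \<le> i \<or> k \<le> j \<longrightarrow> ent x i j = 0)"

text \<open>The difference is half of the double sum of the squares of
  \<open>z u - z v\<close>.\<close>

lemma cauchy_schwarz_sum:
  fixes z :: "nat \<Rightarrow> 'b::cstar_algebra_1"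
  shows "Pos (real n *\<^sub>R (\<Sum>u<n. cstar (z u) * z u) - cstar (\<Sum>u<n. z u) * (\<Sum>u<n. z u))"
proof -
  let ?D = "\<Sum>u<n. \<Sum>v<n. cstar (z u - z v) * (z u - z v)"
  have "?D = (\<Sum>u<n. \<Sum>v<n. cstar (z u) * z u + cstar (z v) * z v - cstar (z u) * z v - cstar (z v) * z u)"
    by (intro sum.cong refl) (simp add: cstar_diff algebra_simps)
  also have "\<dots> = 2 *\<^sub>R (real n *\<^sub>R (\<Sum>u<n. cstar (z u) * z u) - cstar (\<Sum>u<n. z u) * (\<Sum>u<n. z u))"
  proof -
    have 1: "(\<Sum>u<n. \<Sum>v<n. cstar (z u) * z u) = real n *\<^sub>R (\<Sum>u<n. cstar (z u) * z u)"
      "(\<Sum>u<n. \<Sum>v<n. cstar (z v) * z v) = real n *\<^sub>R (\<Sum>u<n. cstar (z u) * z u)"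
      by (simp_all add: sum_constant_scaleR scaleR_sum_right del: sum_constant)
    have 2: "(\<Sum>u<n. \<Sum>v<n. cstar (z u) * z v) = cstar (\<Sum>u<n. z u) * (\<Sum>u<n. z u)"
      by (simp add: cstar_sum sum_product)
    then have 3: "(\<Sum>u<n. \<Sum>v<n. cstar (z v) * z u) = cstar (\<Sum>u<n. z u) * (\<Sum>u<n. z u)"
      by (subst sum.swap)
    show ?thesis unfolding sum.distrib sum_subtractf 1 2 3 by (simp add: scaleR_2)
  qed
  finally have "real n *\<^sub>R (\<Sum>u<n. cstar (z u) * z u) - cstar (\<Sum>u<n. z u) * (\<Sum>u<n. z u)
      = (1/2) *\<^sub>R ?D" by simp
  moreover have "Pos ((1/2) *\<^sub>R ?D)"
    by (intro Pos_scaleR Pos_sum Pos_cstar_mult_self) auto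
  ultimately show ?thesis by simp
qed

text \<open>A converse of \<open>norm_ent_le\<close> up to the size. One factor \<open>n\<close>
  comes from Cauchy-Schwarz within a row, the other from adding \<open>n\<close> rows.\<close>

lemma nneg_bound:
  fixes x :: "'b::cstar_algebra_1 rcf"
  assumes "supp n n x" "\<And>i j. norm (ent x i j) \<le> \<tau>"
  shows "nneg ((real n * \<tau>)\<^sup>2 *\<^sub>R 1 - rstar x * x)"
  unfolding nneg_def
proof (intro allI)
  fix \<xi> :: "'b rcf" and i
  define S where "S = {t. ent \<xi> t i \<noteq> 0} \<union> {..<n}"
  have S: "finite S" "{..<n} \<subseteq> S" by (simp_all add: S_def)
  let ?c = "(real n * \<tau>)\<^sup>2"
  define z where "z s u = ent x s u * ent \<xi> u i" for s u
  define q where "q u = cstar (ent \<xi> u i) * ent \<xi> u i" for u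
  have e1: "ent (rstar \<xi> * \<xi>) i i = (\<Sum>t\<in>S. q t)"
    unfolding q_def by (rule ent_rstar_mult_self) (auto simp: S_def)
  have e2: "ent (x * \<xi>) s i = (\<Sum>u<n. z s u)" for s
    unfolding z_def by (rule ent_mult) (use assms(1) in \<open>auto simp: supp_def\<close>)
  have e3: "ent (rstar (x * \<xi>) * (x * \<xi>)) i i = (\<Sum>s<n. cstar (\<Sum>u<n. z s u) * (\<Sum>u<n. z s u))"
    unfolding e2[symmetric]
    by (rule ent_rstar_mult_self) (use assms(1) in \<open>auto simp: e2 supp_def z_def intro!: sum.neutral\<close>)
  have "rstar \<xi> * (?c *\<^sub>R 1 - rstar x * x) * \<xi> = ?c *\<^sub>R (rstar \<xi> * \<xi>) - rstar (x * \<xi>) * (x * \<xi>)"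
    by (simp add: algebra_simps)
  then have "ent (rstar \<xi> * (?c *\<^sub>R 1 - rstar x * x) * \<xi>) i i =
      ?c *\<^sub>R (\<Sum>t\<in>S. q t) - (\<Sum>s<n. cstar (\<Sum>u<n. z s u) * (\<Sum>u<n. z s u))"
    by (simp only: ent_minus ent_simps e1 e3)
  also have "(\<Sum>t\<in>S. q t) = (\<Sum>t\<in>S - {..<n}. q t) + (\<Sum>t<n. q t)"
    using S by (metis sum.subset_diff)
  also have "?c *\<^sub>R ((\<Sum>t\<in>S - {..<n}. q t) + (\<Sum>t<n. q t)) - (\<Sum>s<n. cstar (\<Sum>u<n. z s u) * (\<Sum>u<n. z s u)) =
     ?c *\<^sub>R (\<Sum>t\<in>S - {..<n}. q t) +
     (\<Sum>s<n. real n *\<^sub>R (\<Sum>u<n. \<tau>\<^sup>2 *\<^sub>R q u - cstar (z s u) * z s u) +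
        (real n *\<^sub>R (\<Sum>u<n. cstar (z s u) * z s u) - cstar (\<Sum>u<n. z s u) * (\<Sum>u<n. z s u)))"
    by (simp add: sum.distrib sum_subtractf scaleR_sum_right[symmetric] scaleR_right_distrib scaleR_right_diff_distrib
        sum_constant_scaleR power_mult_distrib power2_eq_square mult_ac del: sum_constant)
  finally have eq: "ent (rstar \<xi> * (?c *\<^sub>R 1 - rstar x * x) * \<xi>) i i = \<dots>" .
  have "Pos (\<tau>\<^sup>2 *\<^sub>R q u - cstar (z s u) * z s u)" for s u
    using Pos_conj[OF norm_le_imp_Pos_bound[OF assms(2)[of s u]], of "ent \<xi> u i"]
    by (simp add: q_def z_def cstar_mult algebra_simps)
  moreover have "Pos (q u)" for u by (simp add: q_def Pos_cstar_mult_self)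
  ultimately show "Pos (ent (rstar \<xi> * (?c *\<^sub>R 1 - rstar x * x) * \<xi>) i i)"
    unfolding eq by (intro Pos_add Pos_sum Pos_scaleR cauchy_schwarz_sum) auto
qed

lemma norm_ent_le:
  fixes T :: "'b::cstar_algebra_1 rcf"
  assumes "nneg (r\<^sup>2 *\<^sub>R 1 - rstar T * T)" "r \<ge> 0"
  shows "norm (ent T i j) \<le> r"
proof -
  define S where "S = insert i {t. ent T t j \<noteq> 0}"
  have S: "finite S" "i \<in> S" by (simp_all add: S_def)
  have "ent (rstar T * T) j j = (\<Sum>t\<in>S. cstar (ent T t j) * ent T t j)"
    by (rule ent_rstar_mult_self) (auto simp: S_def)
  also have "\<dots> = cstar (ent T i j) * ent T i j + (\<Sum>t\<in>S-{i}. cstar (ent T t j) * ent T t j)"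
    using S by (rule sum.remove)
  finally have "r\<^sup>2 *\<^sub>R 1 - cstar (ent T i j) * ent T i j =
      ent (r\<^sup>2 *\<^sub>R 1 - rstar T * T) j j + (\<Sum>t\<in>S-{i}. cstar (ent T t j) * ent T t j)"
    by simp
  also have "Pos \<dots>"
    using nneg_diag[OF assms(1)] by (intro Pos_add Pos_sum Pos_cstar_mult_self)
  finally show ?thesis using assms(2) by (rule Pos_bound_imp_norm_le)
qed

text \<open>Conjugation preserves \<open>nneg\<close>, whereas a plain product offers no such rule;
  so \<open>r^2 - T^2\<close>, the product of \<open>r - T\<close> and \<open>r + T\<close>, is
  multiplied by \<open>2r\<close>, the sum of the two factors, to become a sum of two
  conjugates.\<close>

lemma nneg_square_bound:
  fixes T :: "'b::cstar_algebra_1 rcf"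
  assumes "rstar T = T" "nneg (r *\<^sub>R 1 - T)" "nneg (r *\<^sub>R 1 + T)" "r > 0"
  shows "nneg (r\<^sup>2 *\<^sub>R 1 - rstar T * T)"
proof -
  let ?P = "r *\<^sub>R 1 + T" and ?M = "r *\<^sub>R 1 - T"
  have "?M * ?P * ?M + ?P * ?M * ?P = (2 * r) *\<^sub>R (r\<^sup>2 *\<^sub>R 1 - T * T)"
    by (simp add: algebra_simps power2_eq_square scaleR_2 flip: scaleR_scaleR)
  then have "(2 * r) *\<^sub>R (r\<^sup>2 *\<^sub>R 1 - rstar T * T) = rstar ?M * ?P * ?M + rstar ?P * ?M * ?P"
    using assms(1) by simp
  moreover have "nneg (rstar ?M * ?P * ?M + rstar ?P * ?M * ?P)"
    by (intro nneg_add nneg_conj assms)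
  ultimately show ?thesis using assms(4) by (metis nneg_scaleR_cancel zero_less_mult_iff zero_less_numeral)
qed

lemma norm_ent_le_selfadjoint:
  fixes T :: "'b::cstar_algebra_1 rcf"
  assumes "rstar T = T" "nneg (r *\<^sub>R 1 - T)" "nneg (r *\<^sub>R 1 + T)" "r > 0"
  shows "norm (ent T i j) \<le> r"
  using nneg_square_bound[OF assms] assms(4) by (intro norm_ent_le) auto

lemma nneg_selfadjoint_bound:
  fixes T :: "'b::cstar_algebra_1 rcf"
  assumes "rstar T = T" "nneg (r\<^sup>2 *\<^sub>R 1 - rstar T * T)" "r > 0"
  shows "nneg (r *\<^sub>R 1 - T)"
proof -
  have "(2 * r) *\<^sub>R (r *\<^sub>R 1 - T) = rstar (r *\<^sub>R 1 - T) * (r *\<^sub>R 1 - T) + (r\<^sup>2 *\<^sub>R 1 - rstar T * T)"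
    using assms(1) by (simp add: algebra_simps power2_eq_square scaleR_2 flip: scaleR_scaleR)
  moreover have "nneg \<dots>" by (intro nneg_add assms nneg_rstar_mult_self)
  ultimately show ?thesis using assms(3) by (metis nneg_scaleR_cancel zero_less_mult_iff zero_less_numeral)
qed

section \<open>Functional calculus for matrices\<close>

definition rpoly :: "real poly \<Rightarrow> 'a::real_algebra_1 \<Rightarrow> 'a" where
  "rpoly p x = (\<Sum>i\<le>degree p. coeff p i *\<^sub>R x ^ i)"

lemma rpoly_altdef:
  assumes "degree p \<le> n" shows "rpoly p x = (\<Sum>i\<le>n. coeff p i *\<^sub>R x ^ i)"
  unfolding rpoly_def
  by (rule sum.mono_neutral_left) (use assms in \<open>auto simp: coeff_eq_0\<close>)

lemma rpoly_0 [simp]: "rpoly 0 x = 0"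
  by (simp add: rpoly_def)

lemma smult_sum_right: "smult a (sum f I) = (\<Sum>i\<in>I. smult a (f i))"
  by (induction I rule: infinite_finite_induct) (simp_all add: smult_add_right)

lemma rpoly_pCons [simp]: "rpoly (pCons a p) x = a *\<^sub>R 1 + x * rpoly p x"
proof -
  have "rpoly (pCons a p) x = (\<Sum>i\<le>Suc (degree p). coeff (pCons a p) i *\<^sub>R x ^ i)"
    by (rule rpoly_altdef) (simp add: degree_pCons_le)
  also have "\<dots> = a *\<^sub>R 1 + (\<Sum>i\<le>degree p. coeff p i *\<^sub>R (x * x ^ i))"
    by (simp add: sum.atMost_Suc_shift del: sum.atMost_Suc)
  also have "(\<Sum>i\<le>degree p. coeff p i *\<^sub>R (x * x ^ i)) = x * rpoly p x"
    by (simp add: rpoly_def sum_distrib_left)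
  finally show ?thesis .
qed

lemma rpoly_1 [simp]: "rpoly 1 x = 1"
  by (simp add: one_pCons)

lemma rpoly_add [simp]: "rpoly (p + q) x = rpoly p x + rpoly q x"
proof -
  let ?n = "max (degree p) (degree q)"
  show ?thesis
    by (simp add: rpoly_altdef[of _ ?n] degree_add_le scaleR_add_left sum.distrib)
qed

lemma rpoly_smult [simp]: "rpoly (smult a p) x = a *\<^sub>R rpoly p x"
  by (simp add: rpoly_altdef[OF degree_smult_le] scaleR_sum_right rpoly_def)

lemma rpoly_minus [simp]: "rpoly (- p) x = - rpoly p x"
  using rpoly_smult[of "-1" p x] by simp

lemma rpoly_diff [simp]: "rpoly (p - q) x = rpoly p x - rpoly q x"
  using rpoly_add[of p "- q" x] by simp

lemma rpoly_commute: "x * rpoly p x = rpoly p x * x"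
  by (simp add: rpoly_def sum_distrib_left sum_distrib_right power_commutes)

lemma rpoly_mult [simp]: "rpoly (p * q) x = rpoly p x * rpoly q x"
  by (induction p) (simp_all add: algebra_simps)

lemma rpoly_power [simp]: "rpoly (p ^ n) x = rpoly p x ^ n"
  by (induction n) simp_all

lemma rpoly_sum: "rpoly (sum f I) x = (\<Sum>i\<in>I. rpoly (f i) x)"
  by (induction I rule: infinite_finite_induct) simp_all

lemma rpoly_pcompose: "rpoly (p \<circ>\<^sub>p q) x = rpoly p (rpoly q x)"
  by (induction p) (simp_all add: pcompose_pCons)

lemma rstar_rpoly: "rstar (x::'b::cstar_algebra_1 rcf) = x \<Longrightarrow> rstar (rpoly p x) = rpoly p x"
  by (induction p) (simp_all add: rpoly_commute)

lemma diagb_rpoly [simp]: "diagb n (x::'b::real_algebra_1 rcf) \<Longrightarrow> diagb n (rpoly p x)"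
  by (induction p) simp_all

section \<open>Positivity of polynomials by Bernstein expansion\<close>

lemma Suc_times_binomial_Suc: "Suc k * (n choose Suc k) = (n - k) * (n choose k)"
  using binomial_absorption[of k n] binomial_absorb_comp[of n k] by simp

text \<open>\<open>falling_ratio N k j\<close> is \<open>(j)\<^sub>k / (N)\<^sub>k\<close> with falling factorials. Using these in place of
  \<open>(j/N)\<^sup>k\<close> makes the Bernstein expansion of \<open>t\<^sup>k\<close> exact.\<close>

definition falling_ratio :: "nat \<Rightarrow> nat \<Rightarrow> nat \<Rightarrow> real" where
  "falling_ratio N k j = real (j choose k) / real (N choose k)"

lemma falling_ratio_Suc:
  assumes "k < N"
  shows "falling_ratio N (Suc k) j = falling_ratio N k j * (real (j - k) / real (N - k))"
proof -
  have "real (Suc k) * real (j choose Suc k) = real (j - k) * real (j choose k)"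
    "real (Suc k) * real (N choose Suc k) = real (N - k) * real (N choose k)"
    by (simp_all only: of_nat_mult[symmetric] Suc_times_binomial_Suc)
  then have "falling_ratio N (Suc k) j =
     (real (Suc k) * real (j choose Suc k)) / (real (Suc k) * real (N choose Suc k))"
    unfolding falling_ratio_def by (subst mult_divide_mult_cancel_left) auto
  also have "\<dots> = (real (j - k) * real (j choose k)) / (real (N - k) * real (N choose k))"
    by (simp only: of_nat_mult[symmetric] Suc_times_binomial_Suc)
  finally show ?thesis by (simp add: falling_ratio_def mult.commute)
qed

lemma falling_ratio_bounds:
  assumes "j \<le> N" shows "0 \<le> falling_ratio N k j" "falling_ratio N k j \<le> 1"
proof -
  show "0 \<le> falling_ratio N k j" by (simp add: falling_ratio_def)
  show "falling_ratio N k j \<le> 1"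
    using binomial_right_mono[OF assms, of k] by (cases "k \<le> N") (simp_all add: falling_ratio_def divide_le_eq_1)
qed

text \<open>The ratio is a product of factors \<open>(j - i) / (N - i)\<close>, each compared with
  \<open>j / N\<close>. All factors lie in [0, 1], so the errors add up, and the factor with index
  \<open>k\<close> contributes at most \<open>k / (N - k)\<close>.\<close>

lemma falling_ratio_approx:
  assumes "k < N" "j \<le> N"
  shows "\<bar>falling_ratio N k j - (real j / real N) ^ k\<bar> \<le> (real k)\<^sup>2 / real (N - k)"
  using assms(1)
proof (induction k)
  case 0
  then show ?case by (simp add: falling_ratio_def)
next
  case (Suc k)
  define u where "u = falling_ratio N k j"
  define a where "a = real j / real N"
  define b where "b = real (j - k) / real (N - k)"
  have a: "0 \<le> a" "a \<le> 1" using assms by (auto simp: a_def)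
  have u: "0 \<le> u" "u \<le> 1" using falling_ratio_bounds[OF assms(2)] by (simp_all add: u_def)
  \<comment> \<open>Natural subtraction makes \<open>b = 0\<close> when \<open>j \<le> k\<close>; in
    that case \<open>a\<close> itself is small enough.\<close>
  have ba: "\<bar>b - a\<bar> \<le> real k / real (N - k)"
  proof (cases "j \<le> k")
    case True
    have "real j / real N \<le> real k / real (N - k)"
      using True Suc.prems by (intro frac_le) auto
    then show ?thesis using True by (simp add: a_def b_def)
  next
    case False
    have "a - b = (real k / real (N - k)) * ((real N - real j) / real N)"
      using False Suc.prems assms(2) by (simp add: a_def b_def of_nat_diff field_simps)
    moreover have "0 \<le> (real N - real j) / real N" "(real N - real j) / real N \<le> 1"
      using assms(2) Suc.prems by auto
    ultimately show ?thesis
      by (smt (verit) mult_left_le divide_nonneg_nonneg mult_nonneg_nonneg of_nat_0_le_iff)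
  qed
  have "falling_ratio N (Suc k) j - a ^ Suc k = u * (b - a) + (u - a ^ k) * a"
    using Suc.prems by (simp add: falling_ratio_Suc u_def b_def algebra_simps)
  then have "\<bar>falling_ratio N (Suc k) j - a ^ Suc k\<bar> \<le> u * \<bar>b - a\<bar> + \<bar>u - a ^ k\<bar> * a"
    using a u abs_triangle_ineq[of "u * (b - a)" "(u - a ^ k) * a"] by (simp add: abs_mult)
  also have "\<dots> \<le> \<bar>b - a\<bar> + \<bar>u - a ^ k\<bar>"
    using a u by (intro add_mono mult_left_le_one_le mult_right_le_one_le) auto
  also have "\<dots> \<le> real k / real (N - k) + (real k)\<^sup>2 / real (N - k)"
    using ba Suc by (intro add_mono) (auto simp: u_def a_def)
  also have "\<dots> = (real k + (real k)\<^sup>2) / real (N - k)" by (simp add: add_divide_distrib)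
  also have "\<dots> \<le> (real (Suc k))\<^sup>2 / real (N - Suc k)"
    using Suc.prems by (intro frac_le) (auto simp: power2_eq_square algebra_simps)
  finally show ?case by (simp add: a_def)
qed

definition bernstein_poly :: "nat \<Rightarrow> nat \<Rightarrow> real poly" where
  "bernstein_poly N j = of_nat (N choose j) * [:0,1:] ^ j * [:1,-1:] ^ (N - j)"

text \<open>Trading \<open>(N choose j) (j choose k)\<close> for
  \<open>(N choose k) (N - k choose j - k)\<close> leaves \<open>X^k\<close> times the binomial
  expansion of \<open>(X + (1 - X))^(N - k)\<close>.\<close>

lemma bernstein_poly_moment:
  assumes "k \<le> N"
  shows "(\<Sum>j\<le>N. smult (falling_ratio N k j) (bernstein_poly N j)) = [:0,1:] ^ k"
proof -
  let ?X = "[:0,1:] :: real poly" and ?Y = "[:1,-1:] :: real poly"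
  have nz: "real (N choose k) \<noteq> 0" using assms by simp
  have "(\<Sum>j\<le>N. smult (falling_ratio N k j) (bernstein_poly N j)) =
    (\<Sum>j\<in>{k..N}. smult (falling_ratio N k j) (bernstein_poly N j))"
    by (rule sum.mono_neutral_right) (auto simp: falling_ratio_def)
  also have "\<dots> = (\<Sum>j\<in>{k..N}. of_nat ((N - k) choose (j - k)) * ?X ^ j * ?Y ^ (N - j))"
  proof (intro sum.cong refl)
    fix j assume j: "j \<in> {k..N}"
    have "real (N choose j) * real (j choose k) = real (N choose k) * real ((N - k) choose (j - k))"
      using j choose_mult[of k j N] by (simp flip: of_nat_mult)
    then have "falling_ratio N k j * real (N choose j) = real ((N - k) choose (j - k))"
      using nz by (simp add: falling_ratio_def field_simps)
    then have "smult (falling_ratio N k j) (of_nat (N choose j)) = of_nat ((N - k) choose (j - k))"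
      by (simp add: of_nat_poly)
    then show "smult (falling_ratio N k j) (bernstein_poly N j) =
        of_nat ((N - k) choose (j - k)) * ?X ^ j * ?Y ^ (N - j)"
      unfolding bernstein_poly_def by (metis mult_smult_left mult.assoc)
  qed
  also have "\<dots> = (\<Sum>i\<le>N - k. of_nat ((N - k) choose i) * ?X ^ (i + k) * ?Y ^ (N - k - i))"
    by (rule sum.reindex_bij_witness[of _ "\<lambda>i. i + k" "\<lambda>j. j - k"]) (use assms in auto)
  also have "\<dots> = ?X ^ k * (\<Sum>i\<le>N - k. of_nat ((N - k) choose i) * ?X ^ i * ?Y ^ (N - k - i))"
    by (simp only: sum_distrib_left power_add mult_ac)
  also have "\<dots> = ?X ^ k * (?X + ?Y) ^ (N - k)" by (simp only: binomial_ring)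
  also have "?X + ?Y = 1" by (simp add: one_pCons)
  finally show ?thesis by simp
qed

lemma poly_as_sum_power: "p = (\<Sum>k\<le>degree p. smult (coeff p k) ([:0,1:] ^ k))"
  using poly_as_sum_of_monoms[of p] by (simp add: monom_altdef)

lemma bernstein_poly_expansion:
  assumes "degree p \<le> N"
  shows "p = (\<Sum>j\<le>N. smult (\<Sum>k\<le>degree p. coeff p k * falling_ratio N k j) (bernstein_poly N j))"
proof -
  have "(\<Sum>k\<le>degree p. smult (coeff p k) ([:0,1:] ^ k)) = (\<Sum>k\<le>degree p. smult (coeff p k)
      (\<Sum>j\<le>N. smult (falling_ratio N k j) (bernstein_poly N j)))"
    using assms by (intro sum.cong refl) (simp add: bernstein_poly_moment)
  also have "\<dots> = (\<Sum>k\<le>degree p. \<Sum>j\<le>N. smult (coeff p k * falling_ratio N k j) (bernstein_poly N j))"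
    by (simp add: smult_sum_right)
  also have "\<dots> = (\<Sum>j\<le>N. \<Sum>k\<le>degree p. smult (coeff p k * falling_ratio N k j) (bernstein_poly N j))"
    by (rule sum.swap)
  also have "(\<Sum>k\<le>degree p. smult (coeff p k) ([:0,1:] ^ k)) = p"
    by (rule poly_as_sum_power[symmetric])
  finally show ?thesis by (simp add: smult_sum)
qed

text \<open>Half of each power goes to either side and acts by conjugation, which leaves exponents 0
  and 1.\<close>

lemma nneg_commuting_power:
  fixes x z :: "'b::cstar_algebra_1 rcf"
  assumes "rstar x = x" "nneg x" "nneg z" "x + z = 1"
  shows "nneg (x ^ i * z ^ j)"
proof -
  have zx: "z = 1 - x" using assms(4) by (simp add: algebra_simps)
  have zs: "rstar z = z" using assms(1) by (simp add: zx)
  have comm: "x * z = z * x" by (simp add: zx algebra_simps)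
  have xz: "nneg (x * z)"
  proof -
    \<comment> \<open>Multiplying \<open>x * z\<close> by \<open>x + z = 1\<close> produces a sum of
      two conjugates.\<close>
    have "x * z = x * z * x + z * x * z" unfolding zx by (simp add: algebra_simps)
    then show ?thesis using nneg_add[OF nneg_conj[OF assms(3), of x] nneg_conj[OF assms(2), of z]]
      by (simp add: assms(1) zs)
  qed
  have base: "nneg (x ^ r * z ^ s)" if "r < 2" "s < 2" for r s
    using that xz assms by (cases r; cases s) (auto simp: less_Suc_eq numeral_2_eq_2)
  have split: "w ^ n = w ^ (n div 2) * w ^ (n mod 2) * w ^ (n div 2)" for w :: "'b rcf" and n
    by (metis power_add add.commute div_mod_decomp mult_2_right add.assoc)
  have cxz: "x ^ a * z ^ b = z ^ b * x ^ a" for a b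
    by (metis comm power_commuting_commutes)
  let ?a = "i div 2" and ?b = "j div 2" and ?r = "i mod 2" and ?s = "j mod 2"
  have "x ^ i * z ^ j = (x ^ ?a * x ^ ?r * x ^ ?a) * (z ^ ?b * z ^ ?s * z ^ ?b)"
    using split[of x i] split[of z j] by simp
  also have "\<dots> = x ^ ?a * x ^ ?r * (x ^ ?a * z ^ ?b) * z ^ ?s * z ^ ?b"
    by (simp only: mult.assoc)
  also have "\<dots> = x ^ ?a * (x ^ ?r * z ^ ?b) * (x ^ ?a * z ^ ?s) * z ^ ?b"
    unfolding cxz[of ?a ?b] by (simp only: mult.assoc)
  also have "\<dots> = (x ^ ?a * z ^ ?b) * (x ^ ?r * z ^ ?s) * (x ^ ?a * z ^ ?b)"
    unfolding cxz[of ?r ?b] cxz[of ?a ?s] by (simp only: mult.assoc)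
  also have "\<dots> = rstar (x ^ ?a * z ^ ?b) * (x ^ ?r * z ^ ?s) * (x ^ ?a * z ^ ?b)"
  proof -
    have "rstar (x ^ ?a * z ^ ?b) = x ^ ?a * z ^ ?b"
      by (simp add: rstar_power assms(1) zs cxz)
    then show ?thesis by simp
  qed
  finally show ?thesis using nneg_conj[OF base[of ?r ?s], of "x ^ ?a * z ^ ?b"] by (simp only:)
qed

text \<open>This takes the place of the spectral theorem. A Bernstein coefficient of
  \<open>p\<close> exceeds \<open>p (j / N) - d N\<close>, up to equality, so \<open>p + d N\<close>
  has nonnegative coefficients and \<open>nneg_commuting_power\<close> handles each term; finally
  \<open>d N\<close> tends to 0.\<close>

lemma nneg_rpoly_unit_interval:
  fixes x :: "'b::cstar_algebra_1 rcf"
  assumes x: "rstar x = x" "nneg x" "nneg (1 - x)"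
    and p: "\<And>t. 0 \<le> t \<Longrightarrow> t \<le> 1 \<Longrightarrow> poly p t \<ge> 0"
  shows "nneg (rpoly p x)"
proof -
  define d where "d N = (\<Sum>k\<le>degree p. \<bar>coeff p k\<bar> * ((real k)\<^sup>2 / real (N - k)))" for N
  have *: "nneg (rpoly p x + d N *\<^sub>R 1)" if N: "degree p < N" for N
  proof -
    define q where "q j = (\<Sum>k\<le>degree p. coeff p k * falling_ratio N k j)" for j
    have q: "q j + d N \<ge> 0" if j: "j \<le> N" for j
    proof -
      have "poly p (real j / real N) - q j = (\<Sum>k\<le>degree p. coeff p k * ((real j / real N) ^ k - falling_ratio N k j))"
        by (simp add: q_def poly_altdef right_diff_distrib sum_subtractf)
      also have "\<dots> \<le> (\<Sum>k\<le>degree p. \<bar>coeff p k\<bar> * ((real k)\<^sup>2 / real (N - k)))"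
      proof (rule sum_mono)
        fix k assume "k \<in> {..degree p}"
        then have "\<bar>(real j / real N) ^ k - falling_ratio N k j\<bar> \<le> (real k)\<^sup>2 / real (N - k)"
          using falling_ratio_approx[of k N j] N j by (simp add: abs_minus_commute)
        then have "\<bar>coeff p k * ((real j / real N) ^ k - falling_ratio N k j)\<bar> \<le> \<bar>coeff p k\<bar> * ((real k)\<^sup>2 / real (N - k))"
          unfolding abs_mult by (intro mult_left_mono) auto
        then show "coeff p k * ((real j / real N) ^ k - falling_ratio N k j) \<le> \<bar>coeff p k\<bar> * ((real k)\<^sup>2 / real (N - k))"
          by (rule abs_le_D1)
      qed
      finally have "poly p (real j / real N) - q j \<le> d N" by (simp add: d_def)
      moreover have "poly p (real j / real N) \<ge> 0" using j N by (intro p) auto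
      ultimately show ?thesis by linarith
    qed
    have "p = (\<Sum>j\<le>N. smult (q j) (bernstein_poly N j))"
      unfolding q_def by (rule bernstein_poly_expansion) (use N in simp)
    moreover have "(1 :: real poly) = (\<Sum>j\<le>N. bernstein_poly N j)"
      using bernstein_poly_moment[of 0 N] by (simp add: falling_ratio_def)
    ultimately have "p + smult (d N) 1 = (\<Sum>j\<le>N. smult (q j) (bernstein_poly N j)) + smult (d N) (\<Sum>j\<le>N. bernstein_poly N j)"
      by simp
    also have "\<dots> = (\<Sum>j\<le>N. smult (q j + d N) (bernstein_poly N j))"
      by (simp add: smult_sum_right smult_add_left sum.distrib)
    finally have "rpoly (p + smult (d N) 1) x = (\<Sum>j\<le>N. rpoly (smult (q j + d N) (bernstein_poly N j)) x)"
      by (simp only: rpoly_sum)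
    then have "rpoly p x + d N *\<^sub>R 1 =
        (\<Sum>j\<le>N. ((q j + d N) * real (N choose j)) *\<^sub>R (x ^ j * (1 - x) ^ (N - j)))"
      by (simp add: bernstein_poly_def of_nat_poly one_pCons mult.assoc)
    also have "nneg \<dots>"
      using q x by (intro nneg_sum nneg_scaleR nneg_commuting_power) auto
    finally show ?thesis .
  qed
  \<comment> \<open>Starting beyond the degree keeps every denominator \<open>N - k\<close> in
    \<open>d N\<close> positive.\<close>
  define X where "X n = rpoly p x + d (n + Suc (degree p)) *\<^sub>R 1" for n
  have "(\<lambda>n. d (n + Suc (degree p))) \<longlonglongrightarrow> (\<Sum>k\<le>degree p. \<bar>coeff p k\<bar> * 0)"
    unfolding d_def
  proof (intro tendsto_sum tendsto_mult tendsto_const)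
    fix k assume "k \<in> {..degree p}"
    then have e: "real (n + Suc (degree p) - k) = real (n + (Suc (degree p) - k))" for n by simp
    have "(\<lambda>n. (real k)\<^sup>2 * inverse (real (n + (Suc (degree p) - k)))) \<longlonglongrightarrow> (real k)\<^sup>2 * 0"
      using LIMSEQ_ignore_initial_segment[OF lim_inverse_n[where ?'a=real]]
      by (intro tendsto_mult tendsto_const) simp
    then show "(\<lambda>n. (real k)\<^sup>2 / real (n + Suc (degree p) - k)) \<longlonglongrightarrow> 0"
      unfolding e divide_inverse by simp
  qed
  then have "elim X (rpoly p x + 0 *\<^sub>R 1)"
    unfolding X_def by (intro elim_add elim_const elim_scaleR_left) simp
  then show ?thesis
    using * nneg_limit[of X] by (simp add: X_def)
qed

section \<open>Continuous functions on the interval [0, M]\<close>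

definition spec_in :: "real \<Rightarrow> 'b::cstar_algebra_1 rcf \<Rightarrow> bool" where
  "spec_in M x \<longleftrightarrow> M > 0 \<and> rstar x = x \<and> nneg x \<and> nneg (M *\<^sub>R 1 - x)"

lemma nneg_rpoly:
  assumes "spec_in M x" "\<And>t. 0 \<le> t \<Longrightarrow> t \<le> M \<Longrightarrow> poly p t \<ge> 0"
  shows "nneg (rpoly p x)"
proof -
  have M: "M > 0" using assms(1) by (simp add: spec_in_def)
  define y where "y = (1/M) *\<^sub>R x"
  have "1 - y = (1/M) *\<^sub>R (M *\<^sub>R 1 - x)" using M by (simp add: y_def algebra_simps)
  then have "nneg (rpoly (p \<circ>\<^sub>p [:0, M:]) y)"
    using assms M by (intro nneg_rpoly_unit_interval)
      (auto simp: spec_in_def y_def poly_pcompose mult.commute intro!: nneg_scaleR)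
  then show ?thesis using M by (simp add: rpoly_pcompose y_def)
qed

text \<open>The sup norm on [0, M] controls every entry, which makes uniformly convergent
  polynomials entrywise Cauchy.\<close>

lemma norm_ent_rpoly_le:
  assumes "spec_in M x" "\<And>t. 0 \<le> t \<Longrightarrow> t \<le> M \<Longrightarrow> \<bar>poly p t\<bar> \<le> r" "r > 0"
  shows "norm (ent (rpoly p x) i j) \<le> r"
proof (rule norm_ent_le_selfadjoint)
  show "rstar (rpoly p x) = rpoly p x" using assms(1) by (simp add: spec_in_def rstar_rpoly)
  have "nneg (rpoly ([:r:] - p) x)" "nneg (rpoly ([:r:] + p) x)"
    using assms(2) by (intro nneg_rpoly[OF assms(1)]; fastforce simp: abs_le_iff)+
  then show "nneg (r *\<^sub>R 1 - rpoly p x)" "nneg (r *\<^sub>R 1 + rpoly p x)"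
    by simp_all
qed fact

abbreviation papprox :: "real \<Rightarrow> (nat \<Rightarrow> real poly) \<Rightarrow> (real \<Rightarrow> real) \<Rightarrow> bool" where
  "papprox M P f \<equiv> uniform_limit {0..M} (\<lambda>n t. poly (P n) t) f sequentially"

lemma papprox_iff:
  "papprox M P f \<longleftrightarrow> (\<forall>e>0. \<forall>\<^sub>F n in sequentially. \<forall>t\<in>{0..M}. \<bar>poly (P n) t - f t\<bar> < e)"
  by (simp add: uniform_limit_iff dist_real_def)

lemma papprox_exists:
  assumes "continuous_on {0..M} f" obtains P where "papprox M P f"
proof -
  have "\<exists>p. \<forall>t\<in>{0..M}. \<bar>poly p t - f t\<bar> < inverse (real (Suc n))" for n
  proof -
    obtain g where g: "real_polynomial_function g" "\<And>t. t \<in> {0..M} \<Longrightarrow> \<bar>f t - g t\<bar> < inverse (real (Suc n))"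
      using Stone_Weierstrass_real_polynomial_function[OF _ assms, of "inverse (real (Suc n))"] by auto
    then obtain a k where "g = (\<lambda>t. \<Sum>i\<le>k. a i * t ^ i)"
      by (auto simp: real_polynomial_function_iff_sum)
    then have "g t = poly (\<Sum>i\<le>k. monom (a i) i) t" for t
      by (simp add: poly_sum poly_monom)
    with g(2) show ?thesis by (metis abs_minus_commute)
  qed
  then obtain P where P: "\<And>n t. t \<in> {0..M} \<Longrightarrow> \<bar>poly (P n) t - f t\<bar> < inverse (real (Suc n))"
    by metis
  have "papprox M P f" unfolding papprox_iff
  proof (intro allI impI)
    fix e :: real assume "e > 0"
    then have "\<forall>\<^sub>F n in sequentially. inverse (real (Suc n)) < e"
      using LIMSEQ_inverse_real_of_nat by (rule order_tendstoD[rotated])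
    then show "\<forall>\<^sub>F n in sequentially. \<forall>t\<in>{0..M}. \<bar>poly (P n) t - f t\<bar> < e"
      by eventually_elim (use P less_trans in blast)
  qed
  then show ?thesis by (rule that)
qed

text \<open>The constant terms tend to \<open>f 0 = 0\<close> and can be subtracted. Without them
  the approximants stay among the matrices over A and are admissible in
  \<open>pos_part\<close>.\<close>

lemma papprox_exists_0:
  assumes "continuous_on {0..M} f" "f 0 = 0" "M \<ge> 0"
  obtains P where "papprox M P f" "\<And>n. poly (P n) 0 = 0"
proof -
  obtain P where P: "papprox M P f" using papprox_exists[OF assms(1)] by blast
  have "(\<lambda>n. poly (P n) 0) \<longlonglongrightarrow> f 0"
    using tendsto_uniform_limitI[OF P, of 0] assms(3) by simp
  then have "uniform_limit {0..M} (\<lambda>n t. poly (P n) 0) (\<lambda>t. 0) sequentially"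
    using assms(2) by (auto simp: uniform_limit_iff tendsto_iff)
  from uniform_limit_minus[OF P this]
  have "papprox M (\<lambda>n. P n - [:poly (P n) 0:]) f" by simp
  then show ?thesis by (rule that) simp
qed

text \<open>The condition \<open>diagb N x\<close> makes entrywise limits of polynomials in
  \<open>x\<close> row- and column-finite and lets such limits be multiplied.\<close>

locale fcalc =
  fixes M :: real and N :: nat and x :: "'b::cstar_algebra_1 rcf"
  assumes spec: "spec_in M x" and dg: "diagb N x"
begin

lemma M_pos: "M > 0"
  using spec by (simp add: spec_in_def)

lemma elim_null:
  assumes "papprox M P (\<lambda>_. 0)" shows "elim (\<lambda>n. rpoly (P n) x) 0"
  unfolding elim_def
proof (intro allI)
  fix i j
  show "(\<lambda>n. ent (rpoly (P n) x) i j) \<longlonglongrightarrow> ent 0 i j"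
    unfolding tendsto_iff
  proof (intro allI impI)
    fix e :: real assume e: "e > 0"
    have "\<forall>\<^sub>F n in sequentially. \<forall>t\<in>{0..M}. \<bar>poly (P n) t\<bar> < e/2"
      using assms[unfolded papprox_iff, rule_format, of "e/2"] e by simp
    then show "\<forall>\<^sub>F n in sequentially. dist (ent (rpoly (P n) x) i j) (ent 0 i j) < e"
    proof eventually_elim
      case (elim n)
      then have "norm (ent (rpoly (P n) x) i j) \<le> e/2"
        using e by (intro norm_ent_rpoly_le[OF spec]) (auto intro: less_imp_le)
      then show ?case using e by simp
    qed
  qed
qed

lemma fc_ex:
  assumes "continuous_on {0..M} f"
  shows "\<exists>T. \<forall>P. papprox M P f \<longrightarrow> elim (\<lambda>n. rpoly (P n) x) T"
proof -
  obtain Q where Q: "papprox M Q f" using papprox_exists[OF assms] by blast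
  have "Cauchy (\<lambda>n. ent (rpoly (Q n) x) i j)" for i j
  proof (rule metric_CauchyI)
    fix e :: real assume e: "e > 0"
    have "\<forall>\<^sub>F n in sequentially. \<forall>t\<in>{0..M}. \<bar>poly (Q n) t - f t\<bar> < e/4"
      using Q[unfolded papprox_iff, rule_format, of "e/4"] e by simp
    then obtain K where K: "\<And>n t. n \<ge> K \<Longrightarrow> t \<in> {0..M} \<Longrightarrow> \<bar>poly (Q n) t - f t\<bar> < e/4"
      unfolding eventually_sequentially by blast
    show "\<exists>K. \<forall>m\<ge>K. \<forall>n\<ge>K. dist (ent (rpoly (Q m) x) i j) (ent (rpoly (Q n) x) i j) < e"
    proof (intro exI allI impI)
      fix m n assume mn: "m \<ge> K" "n \<ge> K"
      have "norm (ent (rpoly (Q m - Q n) x) i j) \<le> e/2"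
      proof (rule norm_ent_rpoly_le[OF spec])
        fix t assume "0 \<le> t" "t \<le> M"
        with K[of m t] K[of n t] mn have "\<bar>poly (Q m) t - f t\<bar> < e/4" "\<bar>poly (Q n) t - f t\<bar> < e/4"
          by auto
        then show "\<bar>poly (Q m - Q n) t\<bar> \<le> e/2" unfolding poly_diff by linarith
      qed (use e in simp)
      then show "dist (ent (rpoly (Q m) x) i j) (ent (rpoly (Q n) x) i j) < e"
        using e by (simp add: dist_norm)
    qed
  qed
  then have lim: "(\<lambda>n. ent (rpoly (Q n) x) i j) \<longlonglongrightarrow> lim (\<lambda>n. ent (rpoly (Q n) x) i j)" for i j
    by (simp add: Cauchy_convergent_iff convergent_LIMSEQ_iff)
  define L where "L i j = lim (\<lambda>n. ent (rpoly (Q n) x) i j)" for i j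
  have L0: "L i j = 0" if "i \<noteq> j" "N \<le> i \<or> N \<le> j" for i j
  proof -
    have "ent (rpoly (Q n) x) i j = 0" for n
      using diagb_rpoly[OF dg, of "Q n"] that unfolding diagb_def by blast
    then show ?thesis by (simp add: L_def)
  qed
  have "finite {j. L i j \<noteq> 0}" "finite {j. L j i \<noteq> 0}" for i
    by (rule finite_subset[of _ "insert i {..<N}"]; use L0 in \<open>auto simp: not_le[symmetric]\<close>)+
  then have entL: "ent (Rcf L) = L" by (intro Rcf_inverse) auto
  then have T: "elim (\<lambda>n. rpoly (Q n) x) (Rcf L)"
    using lim by (simp add: elim_def L_def)
  show ?thesis
  proof (intro exI[of _ "Rcf L"] allI impI)
    fix P assume "papprox M P f"
    from uniform_limit_minus[OF this Q] have "papprox M (\<lambda>n. P n - Q n) (\<lambda>_. 0)" by simp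
    from elim_add[OF elim_null[OF this] T] show "elim (\<lambda>n. rpoly (P n) x) (Rcf L)" by simp
  qed
qed

definition fc :: "(real \<Rightarrow> real) \<Rightarrow> 'b rcf" where
  "fc f = (SOME T. \<forall>P. papprox M P f \<longrightarrow> elim (\<lambda>n. rpoly (P n) x) T)"

lemma fc_elim:
  assumes "continuous_on {0..M} f" "papprox M P f"
  shows "elim (\<lambda>n. rpoly (P n) x) (fc f)"
  using someI_ex[OF fc_ex[OF assms(1)]] assms(2) unfolding fc_def by blast

lemma fc_eqI:
  assumes "continuous_on {0..M} f" "papprox M P f" "elim (\<lambda>n. rpoly (P n) x) T"
  shows "fc f = T"
  using elim_unique[OF fc_elim[OF assms(1,2)] assms(3)] .

lemma fc_poly: "fc (poly p) = rpoly p x"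
  by (rule fc_eqI[of _ "\<lambda>_. p"]) (auto intro: continuous_intros simp: uniform_limit_iff)

lemma fc_mult:
  assumes "continuous_on {0..M} f" "continuous_on {0..M} g"
  shows "fc f * fc g = fc (\<lambda>t. f t * g t)"
proof -
  obtain P Q where PQ: "papprox M P f" "papprox M Q g" using papprox_exists assms by metis
  have "papprox M (\<lambda>n. P n * Q n) (\<lambda>t. f t * g t)"
    using uniform_lim_mult[OF PQ] assms
    by (simp add: compact_continuous_image compact_imp_bounded)
  moreover have "elim (\<lambda>n. rpoly (P n * Q n) x) (fc f * fc g)"
    unfolding rpoly_mult using assms PQ dg
    by (intro elim_mult[where n = N] fc_elim) simp_all
  ultimately show ?thesis
    using assms by (intro fc_eqI[symmetric] continuous_intros)
qed

lemma fc_diff: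
  assumes "continuous_on {0..M} f" "continuous_on {0..M} g"
  shows "fc f - fc g = fc (\<lambda>t. f t - g t)"
proof -
  obtain P Q where PQ: "papprox M P f" "papprox M Q g" using papprox_exists assms by metis
  show ?thesis
    using elim_diff[OF fc_elim[OF assms(1) PQ(1)] fc_elim[OF assms(2) PQ(2)]] uniform_limit_minus[OF PQ] assms
    by (intro fc_eqI[symmetric, where P = "\<lambda>n. P n - Q n"] continuous_intros) simp_all
qed

lemma fc_cong: "(\<And>t. t \<in> {0..M} \<Longrightarrow> f t = g t) \<Longrightarrow> fc f = fc g"
proof -
  assume "\<And>t. t \<in> {0..M} \<Longrightarrow> f t = g t"
  then have "papprox M P f \<longleftrightarrow> papprox M P g" for P
    by (intro uniform_limit_cong') auto
  then show ?thesis by (simp add: fc_def)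
qed

lemma fc_rstar: assumes "continuous_on {0..M} f" shows "rstar (fc f) = fc f"
proof -
  obtain P where P: "papprox M P f" using papprox_exists[OF assms] by blast
  have "rstar (rpoly (P n) x) = rpoly (P n) x" for n
    using spec by (simp add: rstar_rpoly spec_in_def)
  then have "elim (\<lambda>n. rpoly (P n) x) (rstar (fc f))"
    using elim_rstar[OF fc_elim[OF assms P]] by simp
  then show ?thesis using fc_elim[OF assms P] by (rule elim_unique)
qed

lemma fc_nneg:
  assumes "continuous_on {0..M} f" "\<And>t. t \<in> {0..M} \<Longrightarrow> f t \<ge> 0"
  shows "nneg (fc f)"
proof -
  let ?g = "\<lambda>t. sqrt (f t)"
  have g: "continuous_on {0..M} ?g" using assms(1) by (intro continuous_intros)
  have "fc f = fc (\<lambda>t. ?g t * ?g t)" by (rule fc_cong) (use assms(2) in simp)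
  then have "fc f = rstar (fc ?g) * fc ?g"
    by (simp add: fc_mult[OF g g] fc_rstar[OF g])
  then show ?thesis by simp
qed

end

section \<open>Stable rank one for matrices\<close>

definition runit :: "'a::ring_1 \<Rightarrow> bool" where
  "runit x \<longleftrightarrow> (\<exists>y. x * y = 1 \<and> y * x = 1)"

lemma runitI: "x * y = 1 \<Longrightarrow> y * x = 1 \<Longrightarrow> runit x"
  by (auto simp: runit_def)

lemma runit_mult: "runit x \<Longrightarrow> runit y \<Longrightarrow> runit (x * y)"
proof -
  assume "runit x" "runit y"
  then obtain a b where "x * a = 1" "a * x = 1" "y * b = 1" "b * y = 1"
    by (auto simp: runit_def)
  then show ?thesis
    by (intro runitI[of _ "b * a"]) (metis mult.assoc mult_1_left)+
qed

lemma runit_1_plus_nilpotent: "n * n = 0 \<Longrightarrow> runit (1 + n)"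
  by (rule runitI[of _ "1 - n"]) (simp_all add: algebra_simps)

text \<open>Gaussian elimination of the corner \<open>u = P X P\<close> reduces \<open>X + g\<close> to the block diagonal
  element \<open>u + (Schur complement + g)\<close>.\<close>

lemma runit_schur:
  fixes P X :: "'a::ring_1"
  assumes P: "P * P = P"
    and u: "P * X * P * v = P" "v * (P * X * P) = P" "P * v = v" "v * P = v"
    and g: "P * g = 0" "g * P = 0"
    and S: "runit (P + ((1 - P) * X * (1 - P) - (1 - P) * X * v * X * (1 - P)) + g)"
  shows "runit (X + g)"
proof -
  define Q where "Q = 1 - P"
  define u where "u = P * X * P"
  define S where "S = Q * X * Q - Q * X * v * X * Q"
  define T where "T = S + g"
  have PQ: "P * Q = 0" "Q * P = 0" "P + Q = 1" "Q * Q = Q"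
    using P by (simp_all add: Q_def algebra_simps)
  have uv: "u * v = P" "v * u = P" "P * u = u" "u * P = u"
    using assms by (simp_all add: u_def) (simp_all add: mult.assoc P, simp add: mult.assoc[symmetric] P)
  have vQ: "v * Q = 0" "Q * v = 0" using u(3,4) by (simp_all add: Q_def algebra_simps)
  have QS: "P * T = 0" "T * P = 0"
    using g PQ by (simp_all add: T_def S_def distrib_left distrib_right right_diff_distrib left_diff_distrib
        mult.assoc) (simp_all add: mult.assoc[symmetric])
  have vT: "v * T = 0" "T * v = 0"
    by (metis u(4) QS(1) mult.assoc mult_zero_right) (metis u(3) QS(2) mult.assoc mult_zero_left)
  obtain y where y: "(P + T) * y = 1" "y * (P + T) = 1"
    using S by (auto simp: runit_def T_def S_def Q_def add.assoc)
  have "P * (P + T) = P" "(P + T) * P = P" using QS P by (simp_all add: algebra_simps)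
  then have yP: "y * P = P" "P * y = P" using y by (metis mult.assoc mult_1_left mult_1_right)+
  have Ty: "T * y = Q" using y(1) yP by (simp add: Q_def algebra_simps)
  have yT: "y * T = Q" using y(2) yP by (simp add: Q_def algebra_simps)
  \<comment> \<open>\<open>y\<close> inverts \<open>P + T\<close>, so \<open>y - P\<close> inverts
    \<open>T\<close> on the complement of \<open>P\<close>; adding the corner inverse
    \<open>v\<close> inverts \<open>u + T\<close>.\<close>
  have D: "runit (u + T)"
  proof (rule runitI)
    have uy: "u * (y - P) = 0" "v * (y - P) = 0"
      by (metis uv(4) yP(2) P mult.assoc right_diff_distrib cancel_comm_monoid_add_class.diff_cancel mult_zero_right)
         (metis u(4) yP(2) P mult.assoc right_diff_distrib cancel_comm_monoid_add_class.diff_cancel mult_zero_right)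
    have yu: "(y - P) * u = 0"
      by (metis uv(3) yP(1) P mult.assoc left_diff_distrib cancel_comm_monoid_add_class.diff_cancel mult_zero_left)
    have "(u + T) * (v + (y - P)) = u * v + u * (y - P) + T * v + (T * y - T * P)"
      by (simp add: algebra_simps)
    also have "\<dots> = 1" using uv uy vT QS Ty PQ by simp
    finally show "(u + T) * (v + (y - P)) = 1" .
    have "(v + (y - P)) * (u + T) = v * u + (y - P) * u + v * T + (y * T - P * T)"
      by (simp add: algebra_simps)
    also have "\<dots> = 1" using uv yu vT QS yT PQ by simp
    finally show "(v + (y - P)) * (u + T) = 1" .
  qed
  have L: "runit (1 + Q * X * v)"
  proof (rule runit_1_plus_nilpotent)
    have "Q * X * v * (Q * X * v) = Q * X * (v * Q) * X * v" by (simp only: mult.assoc)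
    then show "Q * X * v * (Q * X * v) = 0" by (simp add: vQ)
  qed
  have U: "runit (1 + v * X * Q)"
  proof (rule runit_1_plus_nilpotent)
    have "v * X * Q * (v * X * Q) = v * X * (Q * v) * X * Q" by (simp only: mult.assoc)
    then show "v * X * Q * (v * X * Q) = 0" by (simp add: vQ)
  qed
  \<comment> \<open>From here a lower triangular, a diagonal and an upper triangular factor are
    multiplied out. As \<open>P\<close> annihilates \<open>g\<close> on both sides, the triangular
    factors leave \<open>g\<close> unchanged.\<close>
  have 1: "(1 + Q * X * v) * (u + T) = u + T + Q * X * P"
  proof -
    have "Q * X * v * (u + T) = Q * X * (v * u) + Q * X * (v * T)"
      by (simp only: distrib_left mult.assoc)
    then show ?thesis by (simp add: distrib_right uv vT)
  qed
  have "(u + T + Q * X * P) * (v * X * Q) = (u * v) * X * Q + (T * v) * X * Q + Q * X * (P * v) * X * Q"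
    by (simp only: distrib_right mult.assoc)
  also have "\<dots> = P * X * Q + Q * X * v * X * Q" by (simp add: uv vT u)
  finally have 2: "(u + T + Q * X * P) * (1 + v * X * Q) =
     u + T + Q * X * P + (P * X * Q + Q * X * v * X * Q)"
    by (simp add: distrib_left)
  have "X = (P + Q) * X * (P + Q)" by (simp add: PQ)
  also have "\<dots> = P * X * P + Q * X * P + P * X * Q + Q * X * Q"
    by (simp only: distrib_left distrib_right ac_simps)
  finally have Xd: "X = P * X * P + Q * X * P + P * X * Q + Q * X * Q" .
  have "X + g = P * X * P + Q * X * P + P * X * Q + Q * X * Q + g"
    by (simp only: Xd[symmetric])
  also have "\<dots> = (1 + Q * X * v) * (u + T) * (1 + v * X * Q)"
    unfolding 1 2 by (simp add: T_def S_def u_def)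
  finally have "X + g = (1 + Q * X * v) * (u + T) * (1 + v * X * Q)" .
  then show ?thesis using L D U runit_mult by metis
qed

text \<open>The image of the \<open>l\<close> by \<open>k\<close> matrices over A inside the ring of
  matrices over the unitization.\<close>

definition jm :: "nat \<Rightarrow> nat \<Rightarrow> 'a::cstar_algebra unitz rcf \<Rightarrow> bool" where
  "jm l k x \<longleftrightarrow> supp l k x \<and> (\<forall>i j. in_ideal (ent x i j))"

lemma jm_simps [simp]:
  "jm l k 0" "jm l k x \<Longrightarrow> jm l k y \<Longrightarrow> jm l k (x + y)"
  "jm l k x \<Longrightarrow> jm l k y \<Longrightarrow> jm l k (x - y)" "jm l k x \<Longrightarrow> jm l k (- x)"
  "jm l k x \<Longrightarrow> jm l k (r *\<^sub>R x)"
  by (auto simp: jm_def supp_def)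

lemma jm_rstar [simp]: "jm l k x \<Longrightarrow> jm k l (rstar x)"
  by (auto simp: jm_def supp_def)

lemma jm_mult_left:
  assumes "jm l n x" "\<And>i j. k \<le> j \<Longrightarrow> ent y i j = 0" shows "jm l k (x * y)"
proof -
  have "ent (x * y) i j = (\<Sum>t<n. ent x i t * ent y t j)" for i j
    by (rule ent_mult) (use assms in \<open>auto simp: jm_def supp_def\<close>)
  then show ?thesis using assms
    by (auto simp: jm_def supp_def intro!: in_ideal_sum)
qed

lemma jm_mult [simp]: "jm l n x \<Longrightarrow> jm n' k y \<Longrightarrow> jm l k (x * y)"
  by (rule jm_mult_left) (auto simp: jm_def supp_def)

text \<open>The middle factor may be any matrix over the unitization, such as an inverse: the outer
  factors supply the support and the membership in the ideal.\<close>

lemma jm_sandwich: assumes "jm l n x" "jm n' k z" shows "jm l k (x * y * z)"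
proof -
  have "ent (y * z) i j = (\<Sum>t<n'. ent y i t * ent z t j)" for i j
    by (rule ent_mult) (use assms in \<open>auto simp: jm_def supp_def\<close>)
  then have "ent (y * z) i j = 0" if "k \<le> j" for i j
    using assms(2) that by (simp add: jm_def supp_def)
  then show ?thesis unfolding mult.assoc using assms(1) by (rule jm_mult_left[rotated])
qed

lemma jm_mono: "jm l k x \<Longrightarrow> l \<le> l' \<Longrightarrow> k \<le> k' \<Longrightarrow> jm l' k' x"
  by (auto simp: jm_def supp_def)

lemma jm_diagb: "jm l k x \<Longrightarrow> l \<le> n \<Longrightarrow> k \<le> n \<Longrightarrow> diagb n x"
  by (auto simp: jm_def supp_def diagb_def)

lemma jm_limit: "(\<And>n. jm l k (X n)) \<Longrightarrow> elim X L \<Longrightarrow> jm l k L"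
  unfolding jm_def supp_def
proof (intro conjI allI impI)
  fix i j
  assume jm: "\<And>n. (\<forall>i j. l \<le> i \<or> k \<le> j \<longrightarrow> ent (X n) i j = 0) \<and> (\<forall>i j. in_ideal (ent (X n) i j))"
    and "elim X L"
  then have lim: "(\<lambda>n. ent (X n) i j) \<longlonglongrightarrow> ent L i j" by (simp add: elim_def)
  show "in_ideal (ent L i j)" by (rule in_ideal_limit[OF _ lim]) (use jm in blast)
  assume "l \<le> i \<or> k \<le> j"
  then have "ent (X n) i j = 0" for n using jm by blast
  then show "ent L i j = 0" using lim by (simp add: LIMSEQ_const_iff)
qed

lemma jm_rpoly_minus_const: "jm n n x \<Longrightarrow> jm n n (rpoly p x - coeff p 0 *\<^sub>R 1)"
proof (induction p)
  case (pCons a p)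
  have "x * rpoly p x = coeff p 0 *\<^sub>R x + x * (rpoly p x - coeff p 0 *\<^sub>R 1)"
    by (simp add: algebra_simps)
  moreover have "jm n n \<dots>" using pCons by (auto intro: jm_mult)
  ultimately show ?case by simp
qed simp

lemma jm_rpoly: "jm n n x \<Longrightarrow> poly p 0 = 0 \<Longrightarrow> jm n n (rpoly p x)"
  using jm_rpoly_minus_const[of n x p] by (simp add: poly_0_coeff_0)

section \<open>Splitting off the last diagonal entry\<close>

lift_definition corner :: "nat \<Rightarrow> 'b::zero \<Rightarrow> 'b rcf" is
  "\<lambda>m c i j. if i = m \<and> j = m then c else 0"
  by (auto intro: finite_subset[of _ "{m}" for m])

lemma ent_corner [simp]: "ent (corner m c) i j = (if i = m \<and> j = m then c else 0)"
  by (simp add: corner.rep_eq)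

lemma ent_corner_mult: "ent (corner m c * x) i j = (if i = m then c * ent x m j else 0)"
  for x :: "'b::ring_1 rcf"
  by (subst ent_mult[of "{m}"]) auto

lemma ent_mult_corner: "ent (x * corner m c) i j = (if j = m then ent x i m * c else 0)"
  for x :: "'b::ring_1 rcf"
  by (subst ent_mult[of "{m}"]) auto

lemma corner_mult: "corner m c * corner m d = corner m (c * d :: 'b::ring_1)"
  by (rule rcf_eqI) (simp add: ent_corner_mult)

lemma corner_compress: "corner m 1 * x * corner m 1 = corner m (ent x m m :: 'b::ring_1)"
  by (rule rcf_eqI) (simp add: ent_corner_mult ent_mult_corner)

lemma jm_corner_zero: assumes "jm m m x" shows "corner m c * x = 0" "x * corner m c = 0"
  using assms by (auto intro!: rcf_eqI simp: ent_corner_mult ent_mult_corner jm_def supp_def)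

lemma jm_corner: "in_ideal c \<Longrightarrow> jm (Suc m) (Suc m) (corner m c)"
  by (auto simp: jm_def supp_def)

lemma jm_delete:
  assumes "jm (Suc m) (Suc m) x" "P = corner m 1"
  shows "jm m m ((1 - P) * x * (1 - P))"
proof -
  have "ent ((1 - P) * x * (1 - P)) i j = (if i = m \<or> j = m then 0 else ent x i j)" for i j
    by (simp add: assms(2) algebra_simps ent_corner_mult ent_mult_corner)
  moreover have "m \<le> i \<longleftrightarrow> i = m \<or> Suc m \<le> i" for i by auto
  ultimately show ?thesis using assms(1) by (auto simp: jm_def supp_def)
qed

text \<open>Induction on the size: the last diagonal entry is perturbed to an invertible one, and
  the induction hypothesis treats its Schur complement. The inverse \<open>1 + g'\<close> of
  \<open>1 + g\<close> is part of the claim because multiplying by it turns \<open>1 + x + g\<close>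
  into \<open>1 + x * (1 + g')\<close>, whose unit part is exact. Smallness is asked of
  \<open>g'\<close> for the same reason.\<close>

lemma stable_rank_one_matrix:
  fixes x :: "'a::cstar_algebra unitz rcf"
  assumes sr: "stable_rank_one TYPE('a)" and "jm m m x" "\<eta> > 0"
  shows "\<exists>g g'. jm m m g \<and> jm m m g' \<and> (1 + g) * (1 + g') = 1 \<and> (1 + g') * (1 + g) = 1 \<and>
    (\<forall>i j. norm (ent g' i j) \<le> \<eta>) \<and> runit (1 + x + g)"
  using assms(2)
proof (induction m arbitrary: x)
  case 0
  then have "x = 0" by (intro rcf_eqI) (simp add: jm_def supp_def)
  with assms(3) show ?case by (intro exI[of _ 0]) (auto intro: runitI[of _ 1])
next
  case (Suc m)
  \<comment> \<open>The bound 1/2 keeps the Neumann quotient \<open>norm g0 / (1 - norm g0)\<close>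
    at most \<open>2 * e\<close>, hence at most \<open>\<eta>\<close>.\<close>
  define e where "e = min (1/2) (\<eta> / 2)"
  have e: "e > 0" "e \<le> 1/2" "2 * e \<le> \<eta>" using assms(3) by (auto simp: e_def)
  have "in_ideal (ent x m m)" using Suc.prems by (simp add: jm_def)
  then obtain g0 v where g0: "in_ideal g0" "norm g0 < e"
      and v: "(1 + ent x m m + g0) * v = 1" "v * (1 + ent x m m + g0) = 1"
    using stable_rank_one_invertible[OF sr _ e(1)] by blast
  obtain w where w: "(1 + g0) * w = 1" "w * (1 + g0) = 1" "norm (w - 1) \<le> norm g0 / (1 - norm g0)"
    using neumann_inverse[of "- g0"] g0(2) e(2) by (auto simp: algebra_simps)
  have "norm g0 / (1 - norm g0) \<le> e / (1/2)"
    using g0(2) e by (intro frac_le) auto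
  then have w1: "norm (w - 1) \<le> \<eta>" using w(3) e by simp
  have "w - 1 = - (g0 * w)" using w(1) by (simp add: algebra_simps)
  then have wJ: "in_ideal (w - 1)" using g0(1) by simp
  define P where "P = corner m (1 :: 'a unitz)"
  define X where "X = 1 + x + corner m g0"
  define V where "V = corner m v"
  have PP: "P * P = P" and PV: "P * V = V" and VP: "V * P = V" by (simp_all add: P_def V_def corner_mult)
  have PXP: "P * X * P = corner m (1 + ent x m m + g0)" by (simp add: P_def X_def corner_compress)
  \<comment> \<open>The Schur complement of \<open>X\<close> without its identity part. The entry
    \<open>v\<close> lives in the unitization only, but \<open>x * V * x\<close> is a matrix over A
    because \<open>x\<close> is.\<close>
  define x' where "x' = (1 - P) * (x - x * V * x) * (1 - P)"
  have x': "jm m m x'" unfolding x'_def P_def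
    by (rule jm_delete) (use Suc.prems jm_sandwich[OF Suc.prems Suc.prems] in simp_all)
  from Suc.IH[OF x'] obtain g1 g1' where g1: "jm m m g1" "jm m m g1'" "(1 + g1) * (1 + g1') = 1"
      "(1 + g1') * (1 + g1) = 1" "\<And>i j. norm (ent g1' i j) \<le> \<eta>" "runit (1 + x' + g1)"
    by blast
  have c0: "corner m c * g1 = 0" "g1 * corner m c = 0" "corner m c * g1' = 0" "g1' * corner m c = 0" for c
    using jm_corner_zero g1(1,2) by blast+
  \<comment> \<open>Multiplication by \<open>1 - P\<close> removes the corner \<open>g0\<close> and,
    next to \<open>V\<close>, also the identity, so \<open>X\<close> may be replaced by
    \<open>x\<close> there.\<close>
  have QX: "(1 - P) * X * V = (1 - P) * x * V" "V * X * (1 - P) = V * x * (1 - P)"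
    "(1 - P) * X * (1 - P) = 1 - P + (1 - P) * x * (1 - P)"
  proof -
    have z: "(1 - P) * corner m c = 0" "corner m c * (1 - P) = 0" for c
      by (simp_all add: P_def algebra_simps corner_mult)
    have "(1 - P) * X * V = (1 - P) * V + (1 - P) * x * V + (1 - P) * corner m g0 * V"
      by (simp only: X_def distrib_left distrib_right mult_1_right)
    then show "(1 - P) * X * V = (1 - P) * x * V" by (simp add: z V_def)
    have "V * X * (1 - P) = V * (1 - P) + V * x * (1 - P) + V * (corner m g0 * (1 - P))"
      by (simp only: X_def distrib_left distrib_right mult_1_right mult.assoc)
    then show "V * X * (1 - P) = V * x * (1 - P)" by (simp add: z V_def)
    have "(1 - P) * X * (1 - P) = (1 - P) * (1 - P) + (1 - P) * x * (1 - P) + (1 - P) * corner m g0 * (1 - P)"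
      by (simp only: X_def distrib_left distrib_right mult_1_right)
    moreover have "(1 - P) * (1 - P) = 1 - P" by (simp add: algebra_simps PP)
    ultimately show "(1 - P) * X * (1 - P) = 1 - P + (1 - P) * x * (1 - P)" by (simp only: z mult_zero_left add_0_right)
  qed
  have "P + ((1 - P) * X * (1 - P) - (1 - P) * X * V * X * (1 - P)) + g1 = 1 + x' + g1"
  proof -
    have "(1 - P) * X * V * X * (1 - P) = (1 - P) * X * (V * X * (1 - P))" by (simp only: mult.assoc)
    also have "\<dots> = (1 - P) * X * V * x * (1 - P)" unfolding QX(2) by (simp only: mult.assoc)
    also have "\<dots> = (1 - P) * x * V * x * (1 - P)" by (simp only: QX(1))
    finally show ?thesis unfolding QX(3) x'_def
      by (simp only: right_diff_distrib left_diff_distrib mult.assoc) simp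
  qed
  moreover have "P * X * P * V = P" "V * (P * X * P) = P"
    unfolding PXP unfolding V_def P_def by (simp_all add: corner_mult v)
  ultimately have "runit (X + g1)"
    using g1(6) PP PV VP c0 by (intro runit_schur[of P X V g1]) (simp_all add: P_def)
  then have "runit (1 + x + (corner m g0 + g1))" by (simp add: X_def add.assoc)
  moreover have "(1 + (corner m g0 + g1)) * (1 + (corner m (w - 1) + g1')) = 1"
    "(1 + (corner m (w - 1) + g1')) * (1 + (corner m g0 + g1)) = 1"
  proof -
    have cadd: "corner m c + corner m d = corner m (c + d)" for c d :: "'a unitz"
      by (rule rcf_eqI) simp
    have c00: "corner m 0 = (0 :: 'a unitz rcf)" by (rule rcf_eqI) simp
    \<comment> \<open>The corner and the smaller block annihilate each other, so the product is
      formed in each of them separately.\<close>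
    have gen: "(1 + (corner m c + h)) * (1 + (corner m d + h')) =
      corner m (c + d + c * d) + (1 + h) * (1 + h')"
      if "corner m c * h' = 0" "h * corner m d = 0" for c d :: "'a unitz" and h h'
      using that by (simp add: distrib_left distrib_right corner_mult add_ac flip: cadd)
    have "g0 + (w - 1) + g0 * (w - 1) = 0" "(w - 1) + g0 + (w - 1) * g0 = 0"
      using w by (simp_all add: algebra_simps)
    then show "(1 + (corner m g0 + g1)) * (1 + (corner m (w - 1) + g1')) = 1"
      "(1 + (corner m (w - 1) + g1')) * (1 + (corner m g0 + g1)) = 1"
      by (simp_all only: gen c0 g1 c00) simp_all
  qed
  moreover have "jm (Suc m) (Suc m) (corner m g0 + g1)" "jm (Suc m) (Suc m) (corner m (w - 1) + g1')"
    by (rule jm_simps(2)[OF jm_corner[OF g0(1)] jm_mono[OF g1(1)]], simp_all)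
       (rule jm_simps(2)[OF jm_corner[OF wJ] jm_mono[OF g1(2)]], simp_all)
  moreover have "norm (ent (corner m (w - 1) + g1') i j) \<le> \<eta>" for i j
  proof (cases "i = m \<and> j = m")
    case True
    then have "ent g1' i j = 0" using g1(2) by (simp add: jm_def supp_def)
    then show ?thesis using True w1 by simp
  qed (use g1(5) in auto)
  ultimately show ?case by blast
qed

section \<open>Cancellation\<close>

context fcalc
begin

lemma fc_id: "fc (\<lambda>t. t) = x"
proof -
  have "fc (poly [:0, 1:]) = x" unfolding fc_poly by simp
  moreover have "poly [:0, 1:] = (\<lambda>t::real. t)" by auto
  ultimately show ?thesis by simp
qed

lemma fc_const: "fc (\<lambda>t. r) = r *\<^sub>R 1"
proof -
  have "fc (poly [:r:]) = r *\<^sub>R 1" unfolding fc_poly by simp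
  moreover have "poly [:r:] = (\<lambda>t::real. r)" by auto
  ultimately show ?thesis by simp
qed

end

lemma jm_fc:
  assumes "fcalc M N x" "jm n n x" "continuous_on {0..M} f" "f 0 = 0"
  shows "jm n n (fcalc.fc M x f)"
proof -
  interpret fcalc M N x by fact
  obtain P where P: "papprox M P f" "\<And>n. poly (P n) 0 = 0"
    using papprox_exists_0[OF assms(3,4)] M_pos by (metis less_imp_le)
  show ?thesis
    by (rule jm_limit[OF _ fc_elim[OF assms(3) P(1)]]) (rule jm_rpoly[OF assms(2) P(2)])
qed

lemma fcalc_rstar_mult_self:
  assumes "jm n n x" obtains M where "fcalc M n (rstar x * x)"
proof -
  define t where "t = Max (insert 1 ((\<lambda>(i, j). norm (ent x i j)) ` ({..<n} \<times> {..<n})))"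
  have t1: "t \<ge> 1" unfolding t_def by (rule Max_ge) auto
  have "norm (ent x i j) \<le> t" for i j
  proof (cases "i < n \<and> j < n")
    case True
    then show ?thesis unfolding t_def by (intro Max_ge) auto
  next
    case False
    then have "ent x i j = 0" using assms by (auto simp: jm_def supp_def not_less)
    then show ?thesis using t1 by simp
  qed
  then have b: "nneg ((real n * t)\<^sup>2 *\<^sub>R 1 - rstar x * x)"
    using assms by (intro nneg_bound) (auto simp: jm_def)
  \<comment> \<open>The added 1 keeps the bound positive even for \<open>n = 0\<close>.\<close>
  have "nneg (((real n * t)\<^sup>2 *\<^sub>R 1 - rstar x * x) + 1)"
    by (intro nneg_add b nneg_1)
  then have "nneg (((real n * t)\<^sup>2 + 1) *\<^sub>R 1 - rstar x * x)"
    by (simp add: algebra_simps)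
  moreover have "diagb n (rstar x * x)" using assms jm_diagb[of n n x n] by simp
  moreover have "(real n * t)\<^sup>2 + 1 > 0" by (simp add: add_nonneg_pos)
  ultimately have "fcalc ((real n * t)\<^sup>2 + 1) n (rstar x * x)"
    by (simp add: fcalc_def spec_in_def)
  then show ?thesis by (rule that)
qed

text \<open>In terms of the order: an element is a contraction if its adjoint is. The proof writes
  the difference as a square plus a conjugate.\<close>

lemma nneg_1_minus_flip:
  assumes "nneg (1 - x * rstar x)" shows "nneg (1 - rstar x * x)"
proof -
  let ?g = "rstar x * x"
  have "1 - ?g = rstar (1 - ?g) * (1 - ?g) + rstar x * (1 - x * rstar x) * x"
    by (simp add: algebra_simps)
  also have "nneg \<dots>" by (intro nneg_add nneg_conj assms nneg_rstar_mult_self)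
  finally show ?thesis .
qed

text \<open>Write \<open>a\<close> and \<open>h\<close> for the two Gram matrices. The witness is
  \<open>r = W * rt\<close>, with \<open>W\<close> for \<open>(h + \<eta>)^(-1/2)\<close> and
  \<open>rt\<close> for the root of \<open>a\<close>. The hypothesis makes \<open>r\<close> a
  contraction, and \<open>W * h * W = 1 - \<eta> W * W\<close> makes the error equal to
  \<open>- \<eta> rstar r * r\<close>.\<close>

lemma approx_of_nneg:
  fixes \<alpha> \<beta> :: "'a::cstar_algebra unitz rcf"
  assumes \<alpha>: "jm n n \<alpha>" and \<beta>: "jm n n \<beta>" and ak: "jm k k (rstar \<alpha> * \<alpha>)"
    and hk: "jm k k (rstar \<beta> * \<beta>)"
    and \<eta>: "\<eta> > 0" and le: "nneg (rstar \<beta> * \<beta> + \<eta> *\<^sub>R 1 - rstar \<alpha> * \<alpha>)"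
  shows "\<exists>r. jm k k r \<and> (\<forall>i j. norm (ent (rstar r * (rstar \<beta> * \<beta>) * r - rstar \<alpha> * \<alpha>) i j) \<le> \<eta>)"
proof -
  define a where "a = rstar \<alpha> * \<alpha>"
  define h where "h = rstar \<beta> * \<beta>"
  obtain Ma where "fcalc Ma n a" using fcalc_rstar_mult_self[OF \<alpha>] unfolding a_def by blast
  then interpret A: fcalc Ma n a .
  obtain Mh where "fcalc Mh n h" using fcalc_rstar_mult_self[OF \<beta>] unfolding h_def by blast
  then interpret H: fcalc Mh n h .
  \<comment> \<open>The maximum makes \<open>f\<close> continuous on the whole line.\<close>
  define f where "f t = 1 / sqrt (max t 0 + \<eta>)" for t
  have cf: "continuous_on S f" for S
    unfolding f_def using \<eta> by (intro continuous_intros) (auto simp: add_nonneg_pos less_imp_neq[symmetric])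
  define W where "W = H.fc f"
  define rt where "rt = A.fc sqrt"
  have rt: "rt * rt = a"
  proof -
    have "rt * rt = A.fc (\<lambda>t. sqrt t * sqrt t)"
      unfolding rt_def by (intro A.fc_mult continuous_intros)
    also have "\<dots> = A.fc (\<lambda>t. t)" by (rule A.fc_cong) simp
    finally show ?thesis by (simp add: A.fc_id)
  qed
  have rts: "rstar rt = rt" unfolding rt_def by (intro A.fc_rstar continuous_intros)
  have Ws: "rstar W = W" unfolding W_def by (intro H.fc_rstar cf)
  have jrt: "jm k k rt"
    unfolding rt_def by (rule jm_fc[OF A.fcalc_axioms]) (use ak in \<open>auto simp: a_def intro: continuous_intros\<close>)
  \<comment> \<open>\<open>W\<close> has the scalar part \<open>f 0\<close> and is not a matrix over
    A; only the difference is. In \<open>r\<close> the scalar part multiplies \<open>rt\<close>,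
    which lies over A.\<close>
  have "jm k k (H.fc (\<lambda>t. f t - f 0))"
    by (rule jm_fc[OF H.fcalc_axioms]) (use hk cf in \<open>auto simp: h_def intro: continuous_intros\<close>)
  also have "H.fc (\<lambda>t. f t - f 0) = W - f 0 *\<^sub>R 1"
    unfolding W_def using H.fc_diff[of f "\<lambda>t. f 0"] cf by (simp add: H.fc_const)
  finally have jW: "jm k k (W - f 0 *\<^sub>R 1)" .
  have WW: "W * h * W = 1 - \<eta> *\<^sub>R (W * W)"
  proof -
    have ci: "continuous_on S (\<lambda>t::real. t)" for S by (rule continuous_on_id)
    have "W * h * W = H.fc f * H.fc (\<lambda>t. t) * H.fc f" by (simp add: W_def H.fc_id)
    also have "\<dots> = H.fc (\<lambda>t. f t * t * f t)"
      using cf ci by (simp add: H.fc_mult continuous_on_mult)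
    also have "\<dots> = H.fc (\<lambda>t. 1 - \<eta> * (f t * f t))"
    proof (rule H.fc_cong)
      fix t assume "t \<in> {0..Mh}"
      then have t: "t \<ge> 0" by simp
      then have "f t * f t = 1 / (t + \<eta>)" using \<eta> by (simp add: f_def)
      moreover have "t / (t + \<eta>) = 1 - \<eta> / (t + \<eta>)" using t \<eta> by (simp add: field_simps)
      ultimately show "f t * t * f t = 1 - \<eta> * (f t * f t)"
        by (metis mult.assoc mult.commute times_divide_eq_right mult_1_right)
    qed
    also have "\<dots> = H.fc (\<lambda>t. 1) - H.fc (\<lambda>t. \<eta>) * (H.fc f * H.fc f)"
      using cf by (simp add: H.fc_mult H.fc_diff continuous_on_mult continuous_on_const continuous_on_diff)
    finally show ?thesis by (simp add: H.fc_const W_def)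
  qed
  define r where "r = W * rt"
  have "r = f 0 *\<^sub>R rt + (W - f 0 *\<^sub>R 1) * rt" by (simp add: r_def algebra_simps)
  also have "jm k k \<dots>" using jrt jW by (auto intro: jm_mult)
  finally have jr: "jm k k r" .
  have "W * h * W + \<eta> *\<^sub>R (W * W) = 1" using WW by simp
  moreover have "r * rstar r = W * (rt * rt) * W" by (simp add: r_def Ws rts mult.assoc)
  ultimately have "1 - r * rstar r = W * h * W + \<eta> *\<^sub>R (W * W) - W * (rt * rt) * W"
    by simp
  also have "\<dots> = rstar W * (h + \<eta> *\<^sub>R 1 - a) * W"
    by (simp add: rt Ws algebra_simps)
  finally have "nneg (1 - r * rstar r)"
    using nneg_conj[OF le] by (simp add: a_def h_def)
  then have g: "nneg (1 - rstar r * r)" by (rule nneg_1_minus_flip)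
  define T where "T = rstar r * h * r - a"
  have "rstar r * h * r = rt * (W * h * W) * rt" by (simp add: r_def rts Ws mult.assoc)
  also have "\<dots> = rt * rt - \<eta> *\<^sub>R (rt * (W * W) * rt)"
    unfolding WW by (simp add: algebra_simps)
  finally have T: "T = - (\<eta> *\<^sub>R (rstar r * r))"
    by (simp add: T_def rt r_def rts Ws mult.assoc)
  have "norm (ent T i j) \<le> \<eta>" for i j
  proof (rule norm_ent_le_selfadjoint[OF _ _ _ \<eta>])
    show "rstar T = T" by (simp add: T)
    show "nneg (\<eta> *\<^sub>R 1 - T)" unfolding T using \<eta>
      by (auto intro!: nneg_add nneg_scaleR)
    have "\<eta> *\<^sub>R 1 + T = \<eta> *\<^sub>R (1 - rstar r * r)" by (simp add: T algebra_simps)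
    then show "nneg (\<eta> *\<^sub>R 1 + T)" using g \<eta> by (simp add: nneg_scaleR)
  qed
  then show ?thesis using jr by (auto simp: T_def a_def h_def)
qed

text \<open>\<open>v\<close> is the first component of \<open>(x1, y1) - (x2, y2) s\<close>, whose
  second component is 0; so \<open>v\<close> has the same square as the whole column, and this is
  expressed by the Gram entries.\<close>

lemma residual_expansion:
  fixes s :: "'b::cstar_algebra_1 rcf"
  assumes "y2 * s = y1" "v = x1 - x2 * s"
  shows "rstar v * v = (rstar x1 * x1 + rstar y1 * y1) - (rstar x1 * x2 + rstar y1 * y2) * s
     - rstar ((rstar x1 * x2 + rstar y1 * y2) * s) + rstar s * (rstar x2 * x2 + rstar y2 * y2) * s"
  unfolding assms(2) assms(1)[symmetric] by (simp add: algebra_simps)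

text \<open>Expanding the square of \<open>\<theta> - T * s\<close> bounds the cross term by a
  multiple of \<open>1 + rstar s * s\<close>, whatever the size of \<open>s\<close>.\<close>

lemma nneg_cross_term:
  fixes T s :: "'b::cstar_algebra_1 rcf"
  assumes "nneg (\<theta>\<^sup>2 *\<^sub>R 1 - rstar T * T)" "\<theta> > 0"
  shows "nneg (\<theta> *\<^sub>R (1 + rstar s * s) - (T * s + rstar (T * s)))"
proof -
  have "rstar (\<theta> *\<^sub>R 1 - T * s) * (\<theta> *\<^sub>R 1 - T * s) + rstar s * (\<theta>\<^sup>2 *\<^sub>R 1 - rstar T * T) * s
     = \<theta> *\<^sub>R (\<theta> *\<^sub>R (1 + rstar s * s) - (T * s + rstar (T * s)))"
    by (simp add: algebra_simps power2_eq_square)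
  moreover have "nneg (rstar (\<theta> *\<^sub>R 1 - T * s) * (\<theta> *\<^sub>R 1 - T * s) + rstar s * (\<theta>\<^sup>2 *\<^sub>R 1 - rstar T * T) * s)"
    by (intro nneg_add nneg_conj assms nneg_rstar_mult_self)
  ultimately show ?thesis using assms(2) by (metis nneg_scaleR_cancel)
qed

lemma elim_eventually_small:
  fixes L :: "'b::real_normed_algebra_1 rcf"
  assumes "elim X L" "\<And>n. supp N N (X n)" "\<And>i j. norm (ent L i j) < \<tau>" "\<tau> > 0"
  shows "\<forall>\<^sub>F n in sequentially. \<forall>i j. norm (ent (X n) i j) \<le> \<tau>"
proof -
  have "\<forall>\<^sub>F n in sequentially. norm (ent (X n) i j) < \<tau>" for i j
    by (rule order_tendstoD(2)[OF tendsto_norm]) (use assms(1,3) in \<open>auto simp: elim_def\<close>)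
  then have "\<forall>\<^sub>F n in sequentially. \<forall>i\<in>{..<N}. \<forall>j\<in>{..<N}. norm (ent (X n) i j) < \<tau>"
    by (intro eventually_ball_finite ballI finite_lessThan)
  then show ?thesis
  proof eventually_elim
    case (elim n)
    show ?case
    proof (intro allI)
      fix i j
      show "norm (ent (X n) i j) \<le> \<tau>"
        using elim assms(2)[of n] assms(4)
        by (cases "i < N \<and> j < N") (auto simp: supp_def not_less intro: less_imp_le)
    qed
  qed
qed

section \<open>Spectral cut-offs and the equation for \<open>s\<close>\<close>

definition ramp :: "real \<Rightarrow> real \<Rightarrow> real \<Rightarrow> real" where
  "ramp w p t = max 0 (min 1 ((t - p) / w))"

lemma continuous_on_ramp: "w > 0 \<Longrightarrow> continuous_on S (ramp w p)"
  unfolding ramp_def by (intro continuous_intros) auto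

lemma ramp_eq_1: "w > 0 \<Longrightarrow> t \<ge> p + w \<Longrightarrow> ramp w p t = 1"
  by (simp add: ramp_def le_divide_eq)

lemma ramp_eq_0: "w > 0 \<Longrightarrow> t \<le> p \<Longrightarrow> ramp w p t = 0"
  using divide_nonpos_pos[of "t - p" w] by (simp add: ramp_def)

lemma ramp_mult: "w > 0 \<Longrightarrow> ramp w p t * ramp w (p + w) t = ramp w (p + w) t"
  by (cases "t \<ge> p + w") (simp_all add: ramp_eq_1 ramp_eq_0)

text \<open>With \<open>b = y2 - e2\<close> the equation \<open>s + b * (1 + q) * s = y1\<close> is
  solvable. It exhibits \<open>s\<close> as a combination of \<open>y1\<close> and a multiple of
  \<open>b\<close>, both fixed by \<open>e1\<close>; an additive perturbation of
  \<open>1 + b\<close> would bring in a term outside \<open>e1\<close>. Multiplying the equation by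
  \<open>e3\<close> cancels the unit against \<open>e2\<close> and leaves a perturbation of
  \<open>y2\<close>.\<close>

lemma solve_after_perturbation:
  fixes y1 y2 e1 e2 e3 :: "'a::cstar_algebra unitz rcf"
  assumes sr: "stable_rank_one TYPE('a)"
    and jm: "jm m k y1" "jm m m y2" "jm m m e2"
    and e: "e3 * y1 = y1" "e3 * y2 = y2" "e3 * e2 = e3" "e1 * e2 = e2" "e1 * y1 = y1" "e1 * y2 = y2"
    and "\<eta> > 0"
  shows "\<exists>s q. jm m k s \<and> jm m m q \<and> (\<forall>i j. norm (ent q i j) \<le> \<eta>) \<and> e1 * s = s \<and>
     (y2 + (y2 - e3) * q) * s = y1"
proof -
  define b where "b = y2 - e2"
  have jb: "jm m m b" using jm by (simp add: b_def)
  obtain g q where q: "jm m m q" "(1 + g) * (1 + q) = 1" "(1 + q) * (1 + g) = 1"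
      "\<And>i j. norm (ent q i j) \<le> \<eta>" "runit (1 + b + g)"
    using stable_rank_one_matrix[OF sr jb \<open>\<eta> > 0\<close>] by blast
  have "runit ((1 + b + g) * (1 + q))" using q(2,3) by (intro runit_mult q(5) runitI[of _ "1 + g"])
  moreover have "(1 + b + g) * (1 + q) = 1 + b * (1 + q)"
  proof -
    have "(1 + b + g) * (1 + q) = (1 + g) * (1 + q) + b * (1 + q)" by (simp add: algebra_simps)
    then show ?thesis by (simp only: q(2))
  qed
  ultimately obtain Y where Y: "(1 + b * (1 + q)) * Y = 1" by (auto simp: runit_def)
  define s where "s = Y * y1"
  have s: "s + b * (1 + q) * s = y1"
  proof -
    have "(1 + b * (1 + q)) * Y * y1 = y1" by (simp only: Y mult_1_left)
    then show ?thesis by (simp only: s_def distrib_right mult_1_left mult.assoc)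
  qed
  then have seq: "s = y1 - b * (1 + q) * s" by (metis add_diff_cancel_right')
  have js: "jm m k s"
  proof -
    \<comment> \<open>\<open>Y\<close> is a matrix over the unitization; placed between
      \<open>b\<close> and \<open>y1\<close> it yields a matrix over A.\<close>
    have "s = y1 - b * ((1 + q) * Y) * y1" using seq by (simp only: s_def mult.assoc)
    moreover have "jm m k (b * ((1 + q) * Y) * y1)" by (rule jm_sandwich[OF jb jm(1)])
    ultimately show ?thesis using jm(1) by (metis jm_simps(3))
  qed
  have "e1 * b = b" by (simp add: b_def right_diff_distrib e)
  have "e1 * s = e1 * y1 - (e1 * b) * (1 + q) * s" by (subst seq) (simp only: right_diff_distrib mult.assoc)
  then have es: "e1 * s = s" using seq \<open>e1 * b = b\<close> e(5) by simp
  have "y2 * (1 + q) * s = y1 - s + e2 * (1 + q) * s"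
    using s by (simp add: b_def algebra_simps)
  then have "e3 * (y2 * (1 + q) * s) = e3 * y1 - e3 * s + e3 * (e2 * (1 + q) * s)"
    by (simp only: distrib_left[of e3 "y1 - s"] right_diff_distrib)
  then have "(e3 * y2) * (1 + q) * s = e3 * y1 - e3 * s + (e3 * e2) * (1 + q) * s"
    by (simp only: mult.assoc)
  then have "y2 * (1 + q) * s = y1 - e3 * s + e3 * (1 + q) * s" by (simp only: e)
  then have "(y2 + (y2 - e3) * q) * s = y1" by (simp add: algebra_simps)
  with js q es show ?thesis by blast
qed

lemma cancellation_core:
  fixes a \<beta> c :: "'a::cstar_algebra unitz rcf"
  assumes sr: "stable_rank_one TYPE('a)"
    and a: "jm k k a" "rstar a = a"
    and \<beta>: "jm l l \<beta>"
    and c: "fcalc M m c" "jm m m c"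
    and \<epsilon>: "\<epsilon> > 0" and \<eta>: "\<eta> > 0"
    and approx: "\<And>\<tau>. \<tau> > 0 \<Longrightarrow> \<exists>z11 z12 z21 z22. jm l k z11 \<and> jm l m z12 \<and> jm m k z21 \<and> jm m m z22 \<and>
      (\<forall>i j. norm (ent (rstar z11 * (rstar \<beta> * \<beta>) * z11 + rstar z21 * fcalc.fc M c (\<lambda>t. max (t - \<epsilon>) 0) * z21 - a) i j) < \<tau>) \<and>
      (\<forall>i j. norm (ent (rstar z11 * (rstar \<beta> * \<beta>) * z12 + rstar z21 * fcalc.fc M c (\<lambda>t. max (t - \<epsilon>) 0) * z22) i j) < \<tau>) \<and>
      (\<forall>i j. norm (ent (rstar z12 * (rstar \<beta> * \<beta>) * z12 + rstar z22 * fcalc.fc M c (\<lambda>t. max (t - \<epsilon>) 0) * z22 - c) i j) < \<tau>)"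
  shows "\<exists>R. jm l k R \<and> nneg (rstar R * (rstar \<beta> * \<beta>) * R + \<eta> *\<^sub>R 1 - a)"
proof -
  interpret fcalc M m c by (rule c(1))
  \<comment> \<open>All cut-offs vanish on [0, w]; \<open>e1\<close>, \<open>e2\<close>,
    \<open>e3\<close> rise on the next three intervals of length \<open>w\<close>, and
    \<open>e3\<close> is 1 from \<open>\<epsilon>\<close> on, where \<open>\<delta>\<close>
    lives.\<close>
  define w where "w = \<epsilon> / 4"
  have w: "w > 0" using \<epsilon> by (simp add: w_def)
  \<comment> \<open>One \<open>\<theta>\<close> from \<open>E11\<close> and one from the cross term
    are charged to \<open>\<eta>\<close>; one from \<open>E22\<close> and one from the cross term
    are charged to the multiple \<open>w\<close> of \<open>rstar S * S\<close>.\<close>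
  define \<theta> where "\<theta> = min (\<eta> / 2) (w / 2)"
  have \<theta>: "\<theta> > 0" "2 * \<theta> \<le> \<eta>" "2 * \<theta> \<le> w" using \<eta> w by (auto simp: \<theta>_def)
  \<comment> \<open>All error matrices fit into size \<open>N\<close>, so entries up to
    \<open>\<tau>\<close> give the order bound \<open>\<theta>\<close>. \<open>Suc\<close> makes the
    division by \<open>N\<close> legitimate.\<close>
  define N where "N = Suc (k + l + m)"
  define \<tau> where "\<tau> = \<theta> / real N"
  have \<tau>: "\<tau> > 0" "real N * \<tau> = \<theta>" using \<theta>(1) by (simp_all add: \<tau>_def N_def)
  define d where "d = fc (\<lambda>t. max (t - \<epsilon>) 0)"
  define \<delta> where "\<delta> = fc (\<lambda>t. sqrt (max (t - \<epsilon>) 0))"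
  have cd: "continuous_on S (\<lambda>t. sqrt (max (t - \<epsilon>) 0))" for S by (intro continuous_intros)
  have \<delta>s: "rstar \<delta> = \<delta>" unfolding \<delta>_def by (rule fc_rstar[OF cd])
  have d: "d = rstar \<delta> * \<delta>"
  proof -
    have "\<delta> * \<delta> = fc (\<lambda>t. sqrt (max (t - \<epsilon>) 0) * sqrt (max (t - \<epsilon>) 0))"
      unfolding \<delta>_def by (rule fc_mult[OF cd cd])
    then show ?thesis by (simp add: \<delta>s d_def)
  qed
  have cr: "continuous_on S (ramp w p)" for S p by (rule continuous_on_ramp[OF w])
  define e1 where "e1 = fc (ramp w w)"
  define e2 where "e2 = fc (ramp w (w + w))"
  define e3 where "e3 = fc (ramp w (w + w + w))"
  have e: "e3 * e2 = e3" "e1 * e2 = e2"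
    unfolding e1_def e2_def e3_def fc_mult[OF cr cr]
    by (rule fc_cong, subst mult.commute, rule ramp_mult[OF w]) (rule fc_cong, rule ramp_mult[OF w])
  have e\<delta>: "fc (ramp w p) * \<delta> = \<delta>" if "p + w \<le> \<epsilon>" for p
  proof -
    have "fc (ramp w p) * \<delta> = fc (\<lambda>t. ramp w p t * sqrt (max (t - \<epsilon>) 0))"
      unfolding \<delta>_def by (rule fc_mult[OF cr cd])
    also have "\<dots> = \<delta>" unfolding \<delta>_def
      by (rule fc_cong) (use that w in \<open>auto simp: ramp_eq_1 max_def\<close>)
    finally show ?thesis .
  qed
  have e1\<delta>: "e1 * \<delta> = \<delta>" and e3\<delta>: "e3 * \<delta> = \<delta>"
    unfolding e1_def e3_def using \<epsilon> by (intro e\<delta>; simp add: w_def)+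
  have e1s: "rstar e1 = e1" unfolding e1_def by (rule fc_rstar[OF cr])
  \<comment> \<open>\<open>e1\<close> vanishes wherever \<open>t - w\<close> is negative.\<close>
  have ece: "nneg (e1 * (c - w *\<^sub>R 1) * e1)"
  proof -
    have cid: "continuous_on S (\<lambda>t::real. t)" for S by (rule continuous_on_id)
    have cw: "c - w *\<^sub>R 1 = fc (\<lambda>t. t - w)"
      using fc_diff[of "\<lambda>t. t" "\<lambda>t. w"] by (simp add: fc_id fc_const continuous_on_id continuous_on_const)
    have "e1 * (c - w *\<^sub>R 1) * e1 = fc (\<lambda>t. ramp w w t * (t - w) * ramp w w t)"
      unfolding cw e1_def using cr[of "{0..M}" w] cid[of "{0..M}"]
      by (simp add: fc_mult continuous_on_mult continuous_on_diff continuous_on_const)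
    moreover have "nneg (fc (\<lambda>t. ramp w w t * (t - w) * ramp w w t))"
    proof (rule fc_nneg)
      show "continuous_on {0..M} (\<lambda>t. ramp w w t * (t - w) * ramp w w t)"
        using cr by (intro continuous_intros)
      fix t
      show "0 \<le> ramp w w t * (t - w) * ramp w w t"
        using w by (cases "t \<le> w") (simp_all add: ramp_eq_0, simp add: ramp_def)
    qed
    ultimately show ?thesis by simp
  qed
  have jfc: "jm m m (fc f)" if "continuous_on {0..M} f" "f 0 = 0" for f
    by (rule jm_fc[OF c that])
  have j\<delta>: "jm m m \<delta>" unfolding \<delta>_def by (rule jfc[OF cd]) (use \<epsilon> in simp)
  have je2: "jm m m e2" and je3: "jm m m e3" unfolding e2_def e3_def
    by (rule jfc[OF cr], use w in \<open>simp add: ramp_eq_0\<close>)+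
  obtain z11 z12 z21 z22 where z: "jm l k z11" "jm l m z12" "jm m k z21" "jm m m z22"
    and z_1: "\<And>i j. norm (ent (rstar z11 * (rstar \<beta> * \<beta>) * z11 + rstar z21 * d * z21 - a) i j) < \<tau>"
    and z_2: "\<And>i j. norm (ent (rstar z11 * (rstar \<beta> * \<beta>) * z12 + rstar z21 * d * z22) i j) < \<tau>"
    and z_3: "\<And>i j. norm (ent (rstar z12 * (rstar \<beta> * \<beta>) * z12 + rstar z22 * d * z22 - c) i j) < \<tau>"
    using approx[OF \<tau>(1)] unfolding d_def by blast
  define x1 where "x1 = \<beta> * z11"
  define x2 where "x2 = \<beta> * z12"
  define y1 where "y1 = \<delta> * z21"
  define y2 where "y2 = \<delta> * z22"
  have jx: "jm l k x1" "jm l m x2" and jy: "jm m k y1" "jm m m y2"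
    using z \<beta> j\<delta> by (auto simp: x1_def x2_def y1_def y2_def intro: jm_mult)
  have ey: "e3 * y1 = y1" "e3 * y2 = y2" "e1 * y1 = y1" "e1 * y2 = y2"
    by (simp_all add: y1_def y2_def e1\<delta> e3\<delta> mult.assoc[symmetric])
  have "\<exists>s q. jm m k s \<and> jm m m q \<and> (\<forall>i j. norm (ent q i j) \<le> inverse (real (Suc n))) \<and> e1 * s = s \<and>
     (y2 + (y2 - e3) * q) * s = y1" for n
    by (rule solve_after_perturbation[OF sr jy je2]) (use ey e in auto)
  then obtain s q where sq: "\<And>n. jm m k (s n)" "\<And>n. jm m m (q n)"
      "\<And>n i j. norm (ent (q n) i j) \<le> inverse (real (Suc n))"
      "\<And>n. e1 * s n = s n" "\<And>n. (y2 + (y2 - e3) * q n) * s n = y1"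
    by metis
  define y2' where "y2' n = y2 + (y2 - e3) * q n" for n
  have jy2': "jm m m (y2' n)" for n unfolding y2'_def by (blast intro: jm_simps jm_mult jy je3 sq)
  have "elim q 0"
    unfolding elim_def
  proof (intro allI)
    fix i j
    show "(\<lambda>n. ent (q n) i j) \<longlonglongrightarrow> ent 0 i j"
    proof -
      have "\<forall>n. norm (ent (q n) i j) \<le> inverse (real (Suc n))" using sq(3) by blast
      from Lim_null_comparison[OF always_eventually[OF this] LIMSEQ_inverse_real_of_nat]
      show ?thesis by simp
    qed
  qed
  then have "elim (\<lambda>n. y2 + (y2 - e3) * q n) (y2 + (y2 - e3) * 0)"
    using jm_diagb[OF jm_simps(3)[OF jy(2) je3]] by (intro elim_add elim_const elim_mult[where n = m]) auto
  then have y2'lim: "elim y2' y2" by (simp add: y2'_def[abs_def])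
  have dN: "diagb N z" if "jm p p' z" "p \<le> N" "p' \<le> N" for p p' and z :: "'a unitz rcf"
    using jm_diagb that by blast
  have leN: "k \<le> N" "l \<le> N" "m \<le> N" by (simp_all add: N_def)
  have suppN: "supp N N z" if "jm p p' z" "p \<le> N" "p' \<le> N" for p p' and z :: "'a unitz rcf"
    using that by (auto simp: jm_def supp_def)
  \<comment> \<open>The equation for \<open>s n\<close> is exact with the perturbed
    \<open>y2' n\<close>. These errors do not contain \<open>s n\<close>, which may be unbounded, so
    an \<open>n\<close> with small errors can be fixed before \<open>s n\<close> is used.\<close>
  define E12 where "E12 n = rstar x1 * x2 + rstar y1 * y2' n" for n
  define E22 where "E22 n = rstar x2 * x2 + rstar (y2' n) * y2' n - c" for n
  have "elim E12 (rstar x1 * x2 + rstar y1 * y2)"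
    unfolding E12_def[abs_def] using y2'lim dN[OF jy(1)] leN
    by (intro elim_add elim_const elim_mult[where n = N]) auto
  moreover have "rstar x1 * x2 + rstar y1 * y2 = rstar z11 * (rstar \<beta> * \<beta>) * z12 + rstar z21 * d * z22"
    by (simp add: x1_def x2_def y1_def y2_def d mult.assoc)
  ultimately have F1: "\<forall>\<^sub>F n in sequentially. \<forall>i j. norm (ent (E12 n) i j) \<le> \<tau>"
  proof (intro elim_eventually_small)
    fix n
    have "jm k m (E12 n)" unfolding E12_def by (blast intro: jm_simps jm_mult jm_rstar jx jy jy2')
    then show "supp N N (E12 n)" using suppN leN by blast
  qed (use z_2 \<tau> in auto)
  have "elim E22 (rstar x2 * x2 + rstar y2 * y2 - c)"
    unfolding E22_def[abs_def] using y2'lim dN[OF jy2'] leN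
    by (intro elim_add elim_diff elim_const elim_mult[where n = N] elim_rstar) auto
  moreover have "rstar x2 * x2 + rstar y2 * y2 - c = rstar z12 * (rstar \<beta> * \<beta>) * z12 + rstar z22 * d * z22 - c"
    by (simp add: x1_def x2_def y1_def y2_def d mult.assoc)
  ultimately have F2: "\<forall>\<^sub>F n in sequentially. \<forall>i j. norm (ent (E22 n) i j) \<le> \<tau>"
  proof (intro elim_eventually_small)
    fix n
    have "jm m m (E22 n)" unfolding E22_def by (blast intro: jm_simps jm_mult jm_rstar jx jy2' c(2))
    then show "supp N N (E22 n)" using suppN leN by blast
  qed (use z_3 \<tau> in auto)
  have "\<exists>n. (\<forall>i j. norm (ent (E12 n) i j) \<le> \<tau>) \<and> (\<forall>i j. norm (ent (E22 n) i j) \<le> \<tau>)"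
    using eventually_happens[OF eventually_conj[OF F1 F2]] by simp
  then obtain n where n: "\<And>i j. norm (ent (E12 n) i j) \<le> \<tau>" "\<And>i j. norm (ent (E22 n) i j) \<le> \<tau>"
    by blast
  define E11 where "E11 = rstar x1 * x1 + rstar y1 * y1 - a"
  have "E11 = rstar z11 * (rstar \<beta> * \<beta>) * z11 + rstar z21 * d * z21 - a"
    by (simp add: E11_def x1_def y1_def d mult.assoc)
  then have n0: "norm (ent E11 i j) \<le> \<tau>" for i j using z_1 less_imp_le by metis
  define S where "S = s n"
  define v where "v = x1 - x2 * S"
  have bound: "nneg (\<theta>\<^sup>2 *\<^sub>R 1 - rstar E * E)" if "supp N N E" "\<And>i j. norm (ent E i j) \<le> \<tau>" for E :: "'a unitz rcf"
    using nneg_bound[OF that] by (simp only: \<tau>(2))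
  have sN: "supp N N E11" "supp N N (E12 n)" "supp N N (E22 n)"
  proof -
    have "jm k k E11" unfolding E11_def by (blast intro: jm_simps jm_mult jm_rstar jx jy a(1))
    then show "supp N N E11" using suppN leN by blast
    have "jm k m (E12 n)" unfolding E12_def by (blast intro: jm_simps jm_mult jm_rstar jx jy jy2')
    then show "supp N N (E12 n)" using suppN leN by blast
    have "jm m m (E22 n)" unfolding E22_def by (blast intro: jm_simps jm_mult jm_rstar jx jy2' c(2))
    then show "supp N N (E22 n)" using suppN leN by blast
  qed
  have cs: "rstar c = c" using spec by (simp add: spec_in_def)
  have p1: "nneg (\<theta> *\<^sub>R 1 + E11)"
  proof -
    have "rstar E11 = E11" by (simp add: E11_def a(2))
    with bound[OF sN(1) n0] have "nneg (\<theta>\<^sup>2 *\<^sub>R 1 - rstar (- E11) * (- E11))" "rstar (- E11) = - E11"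
      by simp_all
    then have "nneg (\<theta> *\<^sub>R 1 - (- E11))"
      using nneg_selfadjoint_bound[OF _ _ \<theta>(1)] by blast
    then show ?thesis by simp
  qed
  have "nneg (\<theta> *\<^sub>R 1 + E22 n)"
  proof -
    have "rstar (E22 n) = E22 n" by (simp add: E22_def cs)
    with bound[OF sN(3) n(2)] have "nneg (\<theta>\<^sup>2 *\<^sub>R 1 - rstar (- E22 n) * (- E22 n))"
        "rstar (- E22 n) = - E22 n"
      by simp_all
    then have "nneg (\<theta> *\<^sub>R 1 - (- E22 n))"
      using nneg_selfadjoint_bound[OF _ _ \<theta>(1)] by blast
    then show ?thesis by simp
  qed
  then have p2: "nneg (rstar S * (\<theta> *\<^sub>R 1 + E22 n) * S)" by (rule nneg_conj)
  have p3: "nneg (\<theta> *\<^sub>R (1 + rstar S * S) - (E12 n * S + rstar (E12 n * S)))"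
    by (rule nneg_cross_term[OF bound[OF sN(2) n(1)] \<theta>(1)])
  \<comment> \<open>The identity \<open>e1 * S = S\<close> inserts the cut-off on both sides of
    \<open>c - w\<close>.\<close>
  have p4: "nneg (rstar S * (c - w *\<^sub>R 1) * S)"
  proof -
    have "rstar S * (c - w *\<^sub>R 1) * S = rstar (e1 * S) * (c - w *\<^sub>R 1) * (e1 * S)"
      using sq(4) by (simp add: S_def)
    also have "\<dots> = rstar S * (e1 * (c - w *\<^sub>R 1) * e1) * S" by (simp add: e1s mult.assoc)
    finally show ?thesis using nneg_conj[OF ece] by simp
  qed
  have p5: "nneg ((w - 2 * \<theta>) *\<^sub>R (rstar S * S))" using \<theta> by (intro nneg_scaleR) auto
  have p6: "nneg ((\<eta> - 2 * \<theta>) *\<^sub>R 1)" using \<theta> by (intro nneg_scaleR nneg_1) auto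
  have "rstar v * v = (a + E11) - E12 n * S - rstar (E12 n * S) + rstar S * (c + E22 n) * S"
    using residual_expansion[of "y2' n" S y1 v x1 x2] sq(5)[of n]
    by (simp add: v_def S_def E11_def E12_def E22_def y2'_def)
  moreover have double: "(\<theta> * 2) *\<^sub>R z = \<theta> *\<^sub>R z + \<theta> *\<^sub>R z" for z :: "'a unitz rcf"
    by (simp flip: scaleR_add_left)
  \<comment> \<open>On the right the added scalars sum to \<open>\<eta>\<close>, and the multiples
    of \<open>rstar S * S\<close> cancel.\<close>
  ultimately have "rstar v * v + \<eta> *\<^sub>R 1 - a = (\<theta> *\<^sub>R 1 + E11) + rstar S * (\<theta> *\<^sub>R 1 + E22 n) * S
      + (\<theta> *\<^sub>R (1 + rstar S * S) - (E12 n * S + rstar (E12 n * S)))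
      + rstar S * (c - w *\<^sub>R 1) * S + (w - 2 * \<theta>) *\<^sub>R (rstar S * S) + (\<eta> - 2 * \<theta>) *\<^sub>R 1"
    by (simp add: algebra_simps double)
  also have "nneg \<dots>" by (intro nneg_add p1 p2 p3 p4 p5 p6)
  finally have "nneg (rstar v * v + \<eta> *\<^sub>R 1 - a)" .
  moreover have "rstar v * v = rstar (z11 - z12 * S) * (rstar \<beta> * \<beta>) * (z11 - z12 * S)"
  proof -
    have "v = \<beta> * (z11 - z12 * S)" by (simp add: v_def x1_def x2_def algebra_simps)
    then show ?thesis by (simp add: mult.assoc)
  qed
  moreover have "jm l k (z11 - z12 * S)" unfolding S_def by (blast intro: jm_simps jm_mult z sq)
  ultimately show ?thesis by metis
qed

section \<open>Matrices over A and Cuntz comparison\<close>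

definition lift_mat :: "(nat \<Rightarrow> nat \<Rightarrow> 'a::cstar_algebra) \<Rightarrow> 'a unitz rcf" where
  "lift_mat x = Rcf (\<lambda>i j. incl (x i j))"

lemma ent_lift_mat:
  assumes "mat_in l k x" shows "ent (lift_mat x) i j = incl (x i j)"
proof -
  have "finite {j. incl (x i j) \<noteq> 0}" for i
    by (rule finite_subset[of _ "{..<k}"]) (use assms in \<open>auto simp: mat_in_def not_le[symmetric]\<close>)
  moreover have "finite {i. incl (x i j) \<noteq> 0}" for j
    by (rule finite_subset[of _ "{..<l}"]) (use assms in \<open>auto simp: mat_in_def not_le[symmetric]\<close>)
  ultimately show ?thesis by (simp add: lift_mat_def Rcf_inverse)
qed

lemma jm_lift_mat: "mat_in l k x \<Longrightarrow> jm l k (lift_mat x)"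
  by (auto simp: jm_def supp_def ent_lift_mat) (auto simp: mat_in_def)

lemma jm_imp_lift_mat:
  assumes "jm l k y" obtains x where "mat_in l k x" "y = lift_mat x"
proof -
  define x where "x i j = fst (of_unitz (ent y i j))" for i j
  have e: "ent y i j = incl (x i j)" for i j
    using assms in_idealE[of "ent y i j"] by (metis jm_def x_def incl.rep_eq fst_conv)
  have "incl (x i j) = 0" if "l \<le> i \<or> k \<le> j" for i j
    using assms that unfolding e[symmetric] jm_def supp_def by blast
  then have m: "mat_in l k x" unfolding mat_in_def by (metis incl_0 incl_inject)
  moreover have "y = lift_mat x" by (rule rcf_eqI) (simp add: e ent_lift_mat[OF m])
  ultimately show ?thesis by (rule that)
qed

lemma mat_in_mmul: "mat_in l n x \<Longrightarrow> mat_in n k y \<Longrightarrow> mat_in l k (mmul n x y)"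
  by (auto simp: mat_in_def mmul_def intro!: sum.neutral)

lemma mat_in_mstar: "mat_in l k x \<Longrightarrow> mat_in k l (mstar x)"
  by (auto simp: mat_in_def mstar_def)

lemma lift_mat_mmul:
  assumes "mat_in l n x" "mat_in n k y" shows "lift_mat (mmul n x y) = lift_mat x * lift_mat y"
proof (rule rcf_eqI)
  fix i j
  have "ent (lift_mat x * lift_mat y) i j = (\<Sum>t<n. ent (lift_mat x) i t * ent (lift_mat y) t j)"
    by (rule ent_mult) (use assms in \<open>auto simp: ent_lift_mat mat_in_def\<close>)
  then show "ent (lift_mat (mmul n x y)) i j = ent (lift_mat x * lift_mat y) i j"
    using ent_lift_mat[OF mat_in_mmul[OF assms]] assms
    by (simp add: ent_lift_mat mmul_def incl_sum incl_mult)
qed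

lemma lift_mat_mstar:
  assumes "mat_in l k x" shows "lift_mat (mstar x) = rstar (lift_mat x)"
  using ent_lift_mat[OF assms] ent_lift_mat[OF mat_in_mstar[OF assms]]
  by (intro rcf_eqI) (simp add: mstar_def incl_cstar)

lemma mat_in_mpow: "mat_in k k c \<Longrightarrow> mat_in k k (mpow k c n)"
  by (induction n) (auto intro: mat_in_mmul)

text \<open>\<open>mpow\<close> counts from exponent 1, so no unit is required in A; this is the
  source of the shift.\<close>

lemma lift_mat_mpow: "mat_in k k c \<Longrightarrow> lift_mat (mpow k c n) = lift_mat c ^ Suc n"
  by (induction n) (simp_all add: lift_mat_mmul[OF mat_in_mpow] power_commutes mult.assoc)

lemma incl_peval:
  assumes "mat_in k k c" "poly p 0 = 0"
  shows "incl (peval k p c i j) = ent (rpoly p (lift_mat c)) i j"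
proof -
  have "rpoly p (lift_mat c) = (\<Sum>t<degree p. coeff p (Suc t) *\<^sub>R lift_mat c ^ Suc t)"
    using assms(2) unfolding rpoly_def by (simp add: sum.atMost_shift poly_0_coeff_0)
  also have "ent \<dots> i j = (\<Sum>t<degree p. coeff p (Suc t) *\<^sub>R incl (mpow k c t i j))"
    by (simp only: ent_sum ent_simps lift_mat_mpow[OF assms(1), symmetric] ent_lift_mat[OF mat_in_mpow[OF assms(1)]])
  finally show ?thesis
    by (simp add: peval_def incl_sum scaleR_cscale[symmetric] incl_scaleR)
qed

text \<open>A competing \<open>d\<close> may come with another interval [0, R]. Polynomials
  approximating on [0, max M R] serve both intervals and identify the two limits, which is the
  uniqueness behind \<open>THE\<close>.\<close>

lemma pos_part_fc:
  assumes c: "mat_in m m c" and fc: "fcalc M m (lift_mat c)" and \<epsilon>: "\<epsilon> > 0"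
  shows "incl (pos_part m c \<epsilon> i j) = ent (fcalc.fc M (lift_mat c) (\<lambda>t. max (t - \<epsilon>) 0)) i j"
    and "mat_in m m (pos_part m c \<epsilon>)"
proof -
  interpret fcalc M m "lift_mat c" by fact
  let ?f = "\<lambda>t::real. max (t - \<epsilon>) 0"
  have cf: "continuous_on S ?f" for S by (intro continuous_intros)
  have "jm m m (fc ?f)"
    by (rule jm_fc[OF fc jm_lift_mat[OF c] cf]) (use \<epsilon> in simp)
  then obtain D where D: "mat_in m m D" "fc ?f = lift_mat D" by (rule jm_imp_lift_mat)
  define lim where "lim R d \<longleftrightarrow> (\<forall>P :: nat \<Rightarrow> real poly. ((\<forall>n. poly (P n) 0 = 0) \<and>
       (\<forall>e>0. \<forall>\<^sub>F n in sequentially. \<forall>t\<in>{0..R}. \<bar>poly (P n) t - max (t - \<epsilon>) 0\<bar> < e))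
      \<longrightarrow> (\<forall>i j. (\<lambda>n. peval m (P n) c i j) \<longlonglongrightarrow> d i j))" for R d
  have peval_lim: "(\<lambda>n. peval m (P n) c i j) \<longlonglongrightarrow> D i j"
    if "\<And>n. poly (P n) 0 = 0" "papprox M P ?f" for P i j
  proof -
    have "(\<lambda>n. ent (rpoly (P n) (lift_mat c)) i j) \<longlonglongrightarrow> ent (fc ?f) i j"
      using fc_elim[OF cf that(2)] by (simp add: elim_def)
    then have "(\<lambda>n. incl (peval m (P n) c i j)) \<longlonglongrightarrow> incl (D i j)"
      by (simp add: incl_peval[OF c that(1)] D(2) ent_lift_mat[OF D(1)])
    then show ?thesis by (simp add: incl_tendsto_iff)
  qed
  have "pos_part m c \<epsilon> = (THE d. \<exists>R>0. lim R d)"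
    unfolding pos_part_def lim_def ..
  also have "\<dots> = D"
  proof (rule the_equality)
    show "\<exists>R>0. lim R D"
      using peval_lim M_pos unfolding lim_def papprox_iff by blast
    fix d assume "\<exists>R>0. lim R d"
    then obtain R where R: "R > 0" "lim R d" by blast
    have f0: "?f 0 = 0" and MR: "0 \<le> max M R" using \<epsilon> M_pos by auto
    obtain P where P: "papprox (max M R) P ?f" "\<And>n. poly (P n) 0 = 0"
      using papprox_exists_0[OF cf f0 MR] by blast
    have "papprox R P ?f" "papprox M P ?f"
      by (rule uniform_limit_on_subset[OF P(1)]; auto)+
    then have "(\<lambda>n. peval m (P n) c i j) \<longlonglongrightarrow> d i j" "(\<lambda>n. peval m (P n) c i j) \<longlonglongrightarrow> D i j" for i j
      using R(2) P(2) peval_lim unfolding lim_def papprox_iff by blast+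
    then show "d = D" by (intro ext) (rule LIMSEQ_unique)
  qed
  finally have "pos_part m c \<epsilon> = D" .
  with D show "incl (pos_part m c \<epsilon> i j) = ent (fc ?f) i j" "mat_in m m (pos_part m c \<epsilon>)"
    by (simp_all add: ent_lift_mat)
qed

text \<open>The sesquilinear form of \<open>x\<close> on two columns. Written this way, a block
  decomposition is just a split of the index range.\<close>

definition mform :: "nat \<Rightarrow> (nat \<Rightarrow> nat \<Rightarrow> 'a::cstar_algebra) \<Rightarrow> (nat \<Rightarrow> 'a) \<Rightarrow> (nat \<Rightarrow> 'a) \<Rightarrow> 'a" where
  "mform n x u v = (\<Sum>s<n. cstar (u s) * (\<Sum>t<n. x s t * v t))"

lemma mmul_sandwich: "mmul n (mstar r) (mmul n x r) i j = mform n x (\<lambda>s. r s i) (\<lambda>s. r s j)"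
  by (simp add: mmul_def mstar_def mform_def)

lemma ent_sandwich_lift:
  assumes "mat_in n p z" "mat_in n n x" "mat_in n q z'"
  shows "ent (rstar (lift_mat z) * lift_mat x * lift_mat z') i j =
    incl (mform n x (\<lambda>s. z s i) (\<lambda>s. z' s j))"
proof -
  have "rstar (lift_mat z) * lift_mat x * lift_mat z' = lift_mat (mmul n (mstar z) (mmul n x z'))"
    using assms by (simp add: lift_mat_mmul[OF mat_in_mstar mat_in_mmul] lift_mat_mmul lift_mat_mstar mult.assoc)
  then show ?thesis
    using ent_lift_mat[OF mat_in_mmul[OF mat_in_mstar[OF assms(1)] mat_in_mmul[OF assms(2,3)]]]
    by (simp add: mmul_def mstar_def mform_def)
qed

lemma sum_lessThan_add: "(\<Sum>s<l + m. f s) = (\<Sum>s<l. f s) + (\<Sum>s<m. f (l + s :: nat))"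
  for f :: "nat \<Rightarrow> 'b::comm_monoid_add"
  by (induction m) (simp_all add: add.assoc)

lemma mform_dsum:
  "mform (l + m) (dsum l b d) u v = mform l b u v + mform m d (\<lambda>s. u (l + s)) (\<lambda>s. v (l + s))"
  by (simp add: mform_def sum_lessThan_add dsum_def)

lemma dsum_blocks:
  "i < k \<Longrightarrow> j < k \<Longrightarrow> dsum k a c i j = a i j" "i < k \<Longrightarrow> dsum k a c i (k + j) = 0"
  "dsum k a c (k + i) (k + j) = c i j"
  by (simp_all add: dsum_def)

text \<open>Only finitely many entries are concerned, so one member of the sequence serves all of
  them.\<close>

lemma cuntz_le_entries:
  assumes "cuntz_le k l a b" "\<tau> > 0"
  obtains r where "mat_in l k r" "\<And>i j. i < k \<Longrightarrow> j < k \<Longrightarrow>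
    norm (mform l b (\<lambda>s. r s i) (\<lambda>s. r s j) - a i j) < \<tau>"
proof -
  obtain r where r: "\<And>n. mat_in l k (r n)"
      "\<And>i j. (\<lambda>n. mform l b (\<lambda>s. r n s i) (\<lambda>s. r n s j)) \<longlonglongrightarrow> a i j"
    using assms(1) unfolding cuntz_le_def mmul_sandwich by blast
  have "\<forall>\<^sub>F n in sequentially. norm (mform l b (\<lambda>s. r n s i) (\<lambda>s. r n s j) - a i j) < \<tau>" for i j
    using tendstoD[OF r(2) assms(2)] by (simp add: dist_norm)
  then have "\<forall>\<^sub>F n in sequentially. \<forall>i\<in>{..<k}. \<forall>j\<in>{..<k}.
      norm (mform l b (\<lambda>s. r n s i) (\<lambda>s. r n s j) - a i j) < \<tau>"
    by (intro eventually_ball_finite ballI finite_lessThan)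
  from eventually_happens'[OF sequentially_bot this]
  obtain n where n: "\<forall>i\<in>{..<k}. \<forall>j\<in>{..<k}.
      norm (mform l b (\<lambda>s. r n s i) (\<lambda>s. r n s j) - a i j) < \<tau>"
    by (elim exE)
  show ?thesis by (rule that[OF r(1)[of n]]) (use n in blast)
qed

theorem theorem4p3:
  fixes a b c :: "nat \<Rightarrow> nat \<Rightarrow> 'a::cstar_algebra"
    and k l m :: nat and \<epsilon> :: real
  assumes "stable_rank_one TYPE('a)"
    and "mpositive k a" and "mpositive l b" and "mpositive m c"
    and "\<epsilon> > 0"
    and "cuntz_le (k + m) (l + m) (dsum k a c) (dsum l b (pos_part m c \<epsilon>))"
  shows "cuntz_le k l a b"
proof -
  obtain \<alpha>' where \<alpha>': "mat_in k k a" "mat_in k k \<alpha>'" "a = mmul k (mstar \<alpha>') \<alpha>'"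
    using assms(2) unfolding mpositive_def by blast
  obtain \<beta>' where \<beta>': "mat_in l l b" "mat_in l l \<beta>'" "b = mmul l (mstar \<beta>') \<beta>'"
    using assms(3) unfolding mpositive_def by blast
  obtain \<gamma>' where \<gamma>': "mat_in m m c" "mat_in m m \<gamma>'" "c = mmul m (mstar \<gamma>') \<gamma>'"
    using assms(4) unfolding mpositive_def by blast
  define \<alpha> where "\<alpha> = lift_mat \<alpha>'"
  define \<beta> where "\<beta> = lift_mat \<beta>'"
  have a: "lift_mat a = rstar \<alpha> * \<alpha>" and b: "lift_mat b = rstar \<beta> * \<beta>"
    and c: "lift_mat c = rstar (lift_mat \<gamma>') * lift_mat \<gamma>'"
    using \<alpha>' \<beta>' \<gamma>' by (simp_all add: \<alpha>_def \<beta>_def lift_mat_mmul[OF mat_in_mstar] lift_mat_mstar)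
  have j\<alpha>: "jm k k \<alpha>" and j\<beta>: "jm l l \<beta>" and ja: "jm k k (lift_mat a)" and jc: "jm m m (lift_mat c)"
    using \<alpha>' \<beta>' \<gamma>' by (simp_all add: \<alpha>_def \<beta>_def jm_lift_mat)
  obtain M where fcM: "fcalc M m (lift_mat c)"
    using fcalc_rstar_mult_self[OF jm_lift_mat[OF \<gamma>'(2)]] unfolding c by blast
  define d where "d = pos_part m c \<epsilon>"
  have d: "mat_in m m d" unfolding d_def by (rule pos_part_fc[OF \<gamma>'(1) fcM assms(5)])
  have ld: "fcalc.fc M (lift_mat c) (\<lambda>t. max (t - \<epsilon>) 0) = lift_mat d"
    by (rule rcf_eqI) (simp add: ent_lift_mat[OF d], simp add: d_def pos_part_fc[OF \<gamma>'(1) fcM assms(5)])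
  have core: "\<exists>R. jm l k R \<and> nneg (rstar R * (rstar \<beta> * \<beta>) * R + \<eta> *\<^sub>R 1 - lift_mat a)"
    if "\<eta> > 0" for \<eta>
  proof (rule cancellation_core[OF assms(1) ja _ j\<beta> fcM jc assms(5) that])
    show "rstar (lift_mat a) = lift_mat a" by (simp add: a)
    fix \<tau> :: real assume \<tau>: "\<tau> > 0"
    obtain r where r: "mat_in (l + m) (k + m) r" "\<And>i j. i < k + m \<Longrightarrow> j < k + m \<Longrightarrow>
        norm (mform (l + m) (dsum l b d) (\<lambda>s. r s i) (\<lambda>s. r s j) - dsum k a c i j) < \<tau>"
      using cuntz_le_entries[OF assms(6) \<tau>] unfolding d_def by blast
    \<comment> \<open>The blocks of \<open>r\<close> are padded with zeros, so that outside the
      stated sizes all error entries vanish and only the entries inside need the estimate.\<close>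
    define w11 where "w11 i j = (if i < l \<and> j < k then r i j else 0)" for i j
    define w12 where "w12 i j = (if i < l \<and> j < m then r i (k + j) else 0)" for i j
    define w21 where "w21 i j = (if i < m \<and> j < k then r (l + i) j else 0)" for i j
    define w22 where "w22 i j = (if i < m \<and> j < m then r (l + i) (k + j) else 0)" for i j
    have w: "mat_in l k w11" "mat_in l m w12" "mat_in m k w21" "mat_in m m w22"
      by (auto simp: mat_in_def w11_def w12_def w21_def w22_def)
    have mf: "mform l b (\<lambda>s. w11 s i) v = mform l b (\<lambda>s. r s i) v"
      "mform m d (\<lambda>s. w21 s i) v' = mform m d (\<lambda>s. r (l + s) i) v'"
      "mform l b u (\<lambda>s. w11 s i) = mform l b u (\<lambda>s. r s i)"
      "mform m d u' (\<lambda>s. w21 s i) = mform m d u' (\<lambda>s. r (l + s) i)" if "i < k" for i u v u' v'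
      using that by (simp_all add: mform_def w11_def w21_def)
    have mf': "mform l b (\<lambda>s. w12 s i) v = mform l b (\<lambda>s. r s (k + i)) v"
      "mform m d (\<lambda>s. w22 s i) v' = mform m d (\<lambda>s. r (l + s) (k + i)) v'"
      "mform l b u (\<lambda>s. w12 s i) = mform l b u (\<lambda>s. r s (k + i))"
      "mform m d u' (\<lambda>s. w22 s i) = mform m d u' (\<lambda>s. r (l + s) (k + i))" if "i < m" for i u v u' v'
      using that by (simp_all add: mform_def w12_def w22_def)
    have e1: "norm (ent (rstar (lift_mat w11) * lift_mat b * lift_mat w11 + rstar (lift_mat w21) * lift_mat d * lift_mat w21 - lift_mat a) i j) < \<tau>" for i j
    proof (cases "i < k \<and> j < k")
      case True
      then show ?thesis using r(2)[of i j]
        by (simp add: ent_sandwich_lift[OF w(1) \<beta>'(1) w(1)] ent_sandwich_lift[OF w(3) d w(3)]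
          ent_lift_mat[OF \<alpha>'(1)] mf mform_dsum dsum_blocks flip: incl_add incl_diff)
    next
      case False
      have "jm k k (rstar (lift_mat w11) * lift_mat b * lift_mat w11 + rstar (lift_mat w21) * lift_mat d * lift_mat w21 - lift_mat a)"
        by (blast intro: jm_simps jm_mult jm_rstar jm_lift_mat w \<beta>' d \<alpha>')
      then show ?thesis using False \<tau> by (auto simp: jm_def supp_def not_less)
    qed
    have e2: "norm (ent (rstar (lift_mat w11) * lift_mat b * lift_mat w12 + rstar (lift_mat w21) * lift_mat d * lift_mat w22) i j) < \<tau>" for i j
    proof (cases "i < k \<and> j < m")
      case True
      then show ?thesis using r(2)[of i "k + j"]
        by (simp add: ent_sandwich_lift[OF w(1) \<beta>'(1) w(2)] ent_sandwich_lift[OF w(3) d w(4)]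
          mf mf' mform_dsum dsum_blocks flip: incl_add incl_diff)
    next
      case False
      have "jm k m (rstar (lift_mat w11) * lift_mat b * lift_mat w12 + rstar (lift_mat w21) * lift_mat d * lift_mat w22)"
        by (blast intro: jm_simps jm_mult jm_rstar jm_lift_mat w \<beta>' d \<alpha>')
      then show ?thesis using False \<tau> by (auto simp: jm_def supp_def not_less)
    qed
    have e3: "norm (ent (rstar (lift_mat w12) * lift_mat b * lift_mat w12 + rstar (lift_mat w22) * lift_mat d * lift_mat w22 - lift_mat c) i j) < \<tau>" for i j
    proof (cases "i < m \<and> j < m")
      case True
      then show ?thesis using r(2)[of "k + i" "k + j"]
        by (simp add: ent_sandwich_lift[OF w(2) \<beta>'(1) w(2)] ent_sandwich_lift[OF w(4) d w(4)]
          ent_lift_mat[OF \<gamma>'(1)] mf' mform_dsum dsum_blocks flip: incl_add incl_diff)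
    next
      case False
      have "jm m m (rstar (lift_mat w12) * lift_mat b * lift_mat w12 + rstar (lift_mat w22) * lift_mat d * lift_mat w22 - lift_mat c)"
        by (blast intro: jm_simps jm_mult jm_rstar jm_lift_mat w \<beta>' d \<gamma>')
      then show ?thesis using False \<tau> by (auto simp: jm_def supp_def not_less)
    qed
    show "\<exists>z11 z12 z21 z22. jm l k z11 \<and> jm l m z12 \<and> jm m k z21 \<and> jm m m z22 \<and>
      (\<forall>i j. norm (ent (rstar z11 * (rstar \<beta> * \<beta>) * z11 + rstar z21 * fcalc.fc M (lift_mat c) (\<lambda>t. max (t - \<epsilon>) 0) * z21 - lift_mat a) i j) < \<tau>) \<and>
      (\<forall>i j. norm (ent (rstar z11 * (rstar \<beta> * \<beta>) * z12 + rstar z21 * fcalc.fc M (lift_mat c) (\<lambda>t. max (t - \<epsilon>) 0) * z22) i j) < \<tau>) \<and>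
      (\<forall>i j. norm (ent (rstar z12 * (rstar \<beta> * \<beta>) * z12 + rstar z22 * fcalc.fc M (lift_mat c) (\<lambda>t. max (t - \<epsilon>) 0) * z22 - lift_mat c) i j) < \<tau>)"
      unfolding ld b[symmetric] using e1 e2 e3 jm_lift_mat[OF w(1)] jm_lift_mat[OF w(2)]
        jm_lift_mat[OF w(3)] jm_lift_mat[OF w(4)] by blast
  qed
  have "\<exists>r. mat_in l k r \<and> (\<forall>i j. norm (mform l b (\<lambda>s. r s i) (\<lambda>s. r s j) - a i j) \<le> \<eta>)"
    if \<eta>: "\<eta> > 0" for \<eta>
  proof -
    obtain R where R: "jm l k R" "nneg (rstar R * (rstar \<beta> * \<beta>) * R + \<eta> *\<^sub>R 1 - lift_mat a)"
      using core[OF \<eta>] by blast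
    \<comment> \<open>\<open>\<alpha>\<close> is \<open>k\<close> by \<open>k\<close> and
      \<open>\<beta> * R\<close> is \<open>l\<close> by \<open>k\<close>;
      \<open>approx_of_nneg\<close> takes both inside one square size.\<close>
    let ?N = "max k l"
    have eq: "rstar (\<beta> * R) * (\<beta> * R) = rstar R * (rstar \<beta> * \<beta>) * R" by (simp add: mult.assoc)
    have j\<beta>R: "jm l k (\<beta> * R)" by (rule jm_mult[OF j\<beta> R(1)])
    have "jm k k (rstar (\<beta> * R) * (\<beta> * R))" by (rule jm_mult[OF jm_rstar[OF j\<beta>R] j\<beta>R])
    with j\<beta>R have "\<exists>s. jm k k s \<and> (\<forall>i j. norm (ent (rstar s * (rstar (\<beta> * R) * (\<beta> * R)) * s - rstar \<alpha> * \<alpha>) i j) \<le> \<eta>)"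
      using R(2) ja j\<alpha> unfolding a eq[symmetric]
      by (intro approx_of_nneg[where n = ?N] \<eta>) (auto intro: jm_mono)
    then obtain s where s: "jm k k s"
        "\<And>i j. norm (ent (rstar s * (rstar (\<beta> * R) * (\<beta> * R)) * s - rstar \<alpha> * \<alpha>) i j) \<le> \<eta>"
      by blast
    \<comment> \<open>\<open>R\<close> comes from the cancellation and \<open>s\<close> from turning
      the order relation into a Cuntz relation; their product is the witness that compares
      \<open>a\<close> with \<open>b\<close>.\<close>
    have "jm l k (R * s)" by (rule jm_mult[OF R(1) s(1)])
    then obtain r where r: "mat_in l k r" "R * s = lift_mat r" by (rule jm_imp_lift_mat)
    have "rstar s * (rstar (\<beta> * R) * (\<beta> * R)) * s = rstar (R * s) * lift_mat b * (R * s)"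
      by (simp add: b mult.assoc)
    then have "norm (mform l b (\<lambda>s. r s i) (\<lambda>s. r s j) - a i j) \<le> \<eta>" for i j
      using s(2)[of i j] unfolding r(2) a[symmetric]
      by (simp add: ent_sandwich_lift[OF r(1) \<beta>'(1) r(1)] ent_lift_mat[OF \<alpha>'(1)] flip: incl_diff)
    with r(1) show ?thesis by blast
  qed
  then have "\<forall>n. \<exists>r. mat_in l k r \<and> (\<forall>i j. norm (mform l b (\<lambda>s. r s i) (\<lambda>s. r s j) - a i j) \<le> inverse (real (Suc n)))"
    by simp
  then obtain r where r: "\<And>n. mat_in l k (r n)"
      "\<And>n i j. norm (mform l b (\<lambda>s. r n s i) (\<lambda>s. r n s j) - a i j) \<le> inverse (real (Suc n))"
    by metis
  have "(\<lambda>n. mform l b (\<lambda>s. r n s i) (\<lambda>s. r n s j)) \<longlonglongrightarrow> a i j" for i j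
  proof -
    have "\<forall>n. norm (mform l b (\<lambda>s. r n s i) (\<lambda>s. r n s j) - a i j) \<le> inverse (real (Suc n))"
      using r(2) by blast
    from Lim_null_comparison[OF always_eventually[OF this] LIMSEQ_inverse_real_of_nat]
    show ?thesis by (rule LIM_zero_cancel)
  qed
  with r(1) show ?thesis unfolding cuntz_le_def mmul_sandwich by blast
qed

end
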